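(* Let $\alpha\geq0$ and, for a real-valued initial datum $u_0$ on $\mathbb{R}$, let $$u^*(x)=\sup_{\substack{t>0\\ |y-x|\leq\alpha t}}P(\cdot,t)*|u_0|(y),\qquad P(x,t)=\frac{1}{\pi}\frac{t}{x^2+t^2}.$$ Then: (i) If $1<p\leq\infty$ and $u_0\in W^{1,p}(\mathbb{R})$, then $u^*\in W^{1,p}(\mathbb{R})$ and $\|(u^* )'\|_{L^p(\mathbb{R})}\leq\|u_0'\|_{L^p(\mathbb{R})}$. (ii) If $u_0\in W^{1,1}(\mathbb{R})$, then $u^*\in L^\infty(\mathbb{R})$ and $u^*$ has a weak derivative $(u^* )'$ satisfying $\|(u^* )'\|_{L^1(\mathbb{R})}\leq\|u_0'\|_{L^1(\mathbb{R})}$. (iii) If $u_0$ is of bounded variation on $\mathbb{R}$, then $u^*$ is of bounded variation on $\mathbb{R}$ and $V(u^* )\leq V(u_0)$.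
   Context: $V(f)$ denotes the total variation of $f:\mathbb{R}\to\mathbb{R}$ (supremum over finite partitions of sums of absolute increments). *)

theory Defs
  imports "HOL-Analysis.Analysis" "HOL-Probability.Essential_Supremum"
begin

definition poisson :: "real \<Rightarrow> real \<Rightarrow> real" where
  "poisson x t = (1 / pi) * (t / (x\<^sup>2 + t\<^sup>2))"

definition poisson_ext :: "(real \<Rightarrow> real) \<Rightarrow> real \<Rightarrow> real \<Rightarrow> real" where
  "poisson_ext u0 y t = (LINT z|lborel. poisson (y - z) t * \<bar>u0 z\<bar>)"

definition nt_max :: "real \<Rightarrow> (real \<Rightarrow> real) \<Rightarrow> real \<Rightarrow> real" where
  "nt_max \<alpha> u0 x = (SUP yt \<in> {(y, t). t > 0 \<and> \<bar>y - x\<bar> \<le> \<alpha> * t}. poisson_ext u0 (fst yt) (snd yt))"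

definition test_fun :: "(real \<Rightarrow> real) \<Rightarrow> bool" where
  "test_fun \<phi> \<longleftrightarrow> (\<forall>k. (deriv ^^ k) \<phi> differentiable_on UNIV) \<and> compact (closure {x. \<phi> x \<noteq> 0})"

definition locally_integrable :: "(real \<Rightarrow> real) \<Rightarrow> bool" where
  "locally_integrable f \<longleftrightarrow> (\<forall>a b. set_integrable lborel {a..b} f)"

definition has_weak_deriv :: "(real \<Rightarrow> real) \<Rightarrow> (real \<Rightarrow> real) \<Rightarrow> bool" where
  "has_weak_deriv u g \<longleftrightarrow> locally_integrable u \<and> locally_integrable g \<and>
     (\<forall>\<phi>. test_fun \<phi> \<longrightarrow>
        (LINT x|lborel. u x * deriv \<phi> x) = - (LINT x|lborel. g x * \<phi> x))"

definition memLp :: "ereal \<Rightarrow> (real \<Rightarrow> real) \<Rightarrow> bool" where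
  "memLp p f \<longleftrightarrow> f \<in> borel_measurable lborel \<and>
     (if p = \<infinity> then esssup lborel (\<lambda>x. ereal \<bar>f x\<bar>) < \<infinity>
      else integrable lborel (\<lambda>x. \<bar>f x\<bar> powr (real_of_ereal p)))"

definition Lp_norm :: "ereal \<Rightarrow> (real \<Rightarrow> real) \<Rightarrow> real" where
  "Lp_norm p f = (if p = \<infinity> then real_of_ereal (esssup lborel (\<lambda>x. ereal \<bar>f x\<bar>))
      else (LINT x|lborel. \<bar>f x\<bar> powr (real_of_ereal p)) powr (1 / real_of_ereal p))"

definition total_var :: "(real \<Rightarrow> real) \<Rightarrow> ereal" where
  "total_var f = (SUP xs \<in> {xs :: real list. sorted xs}.
      ereal (\<Sum>i < length xs - 1. \<bar>f (xs ! Suc i) - f (xs ! i)\<bar>))"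

definition bounded_var :: "(real \<Rightarrow> real) \<Rightarrow> bool" where
  "bounded_var f \<longleftrightarrow> total_var f < \<infinity>"

end

theory Submission
  imports Defs "HOL-Probability.Sinc_Integral" "HOL-Complex_Analysis.Complex_Analysis"
begin

text \<open>
  For a partition and a slope \<open>\<kappa> \<ge> 0\<close> consider the excess sum of \<open>max 0 (\<bar>\<Delta>f\<bar> - \<kappa> \<Delta>x)\<close>. Everything
  follows from the fact that for \<open>\<kappa> > 0\<close> the excess of the maximal function is at most the largest
  excess of the initial datum. Letting \<open>\<kappa> \<rightarrow> 0\<close> gives the bound on the total variation. If the datum
  is a primitive of \<open>g0\<close>, its excess is at most the integral of \<open>(\<bar>g0\<bar> - \<kappa>)+\<close>, which tends to 0 as
  \<open>\<kappa> \<rightarrow> \<infinity>\<close>; hence the maximal function is absolutely continuous, its derivative \<open>g\<close> satisfies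
  \<open>\<integral> (\<bar>g\<bar> - \<kappa>)+ \<le> \<integral> (\<bar>g0\<bar> - \<kappa>)+\<close> for all \<open>\<kappa> > 0\<close>, and by the layer cake formula all \<open>L^p\<close> norms
  of \<open>g\<close> are bounded by those of \<open>g0\<close>.

  The excess inequality rests on the maximum principle: with the datum replaced by its Poisson
  extension \<open>U\<close> at a small height, the maximal function \<open>v \<ge> U\<close> minus any affine function attains its
  maximum over \<open>[p, q]\<close> at an end point, unless \<open>U\<close> reaches the same value inside. A partition point
  at which \<open>v\<close> is favourably high can therefore be moved to a neighbouring point and merged with it,
  or to a point where \<open>U\<close> does as well; at low points \<open>U \<le> v\<close> is enough.
\<close>

section \<open>Excess sums\<close>

text \<open>Total variation alone would only reach p = 1 and bounded variation. The excesses at all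
  slopes record how the absolute derivative is distributed over its levels, and comparing them level
  by level is a majorization in the sense of Hardy, Littlewood and Polya; it settles every p,
  infinity included, at once. For p > 1 the datum may have infinite variation, but its excess is
  finite at large slopes. A positive slope also compensates for the line not being compact: the
  outermost points of a partition have a neighbour on one side only, and boundedness together with
  the slope keeps them from escaping to infinity. In return the maximum principle must hold modulo
  affine functions and not only modulo constants. Excess controls derivatives only. That the maximal
  function itself lies in L^p for 1 < p < infinity comes from the Hardy-Littlewood maximal theorem,
  and that it is bounded from the embedding of Sobolev functions into bounded functions. Weak
  derivatives are translated into primitives by the du Bois-Reymond lemma and back by integration by
  parts.\<close>

fun excess :: "real \<Rightarrow> (real \<Rightarrow> real) \<Rightarrow> real list \<Rightarrow> real" where
  "excess \<kappa> f (x # y # xs) = max 0 (\<bar>f y - f x\<bar> - \<kappa> * (y - x)) + excess \<kappa> f (y # xs)"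
| "excess \<kappa> f xs = 0"

lemma excess_nonneg: "0 \<le> excess \<kappa> f xs"
  by (induction \<kappa> f xs rule: excess.induct) auto

lemma excess_zero: "excess 0 f xs = (\<Sum>i < length xs - 1. \<bar>f (xs ! Suc i) - f (xs ! i)\<bar>)"
proof (induction "0::real" f xs rule: excess.induct)
  case (1 f x y xs)
  show ?case
    using 1 by (simp add: sum.lessThan_Suc_shift del: sum.lessThan_Suc)
qed auto

text \<open>
  Choosing a sign \<open>\<bar>r\<bar> \<le> 1\<close> on every interval of a partition bounds the excess from below by the sum of
  \<open>r \<Delta>f - \<kappa> \<bar>r\<bar> \<Delta>x\<close>. After Abel summation, the point \<open>x\<close> where the sign changes from \<open>s\<close> to \<open>r\<close> and the
  function takes the value \<open>w\<close> contributes \<open>jump \<kappa> s r x w\<close>.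
\<close>

definition jump :: "real \<Rightarrow> real \<Rightarrow> real \<Rightarrow> real \<Rightarrow> real \<Rightarrow> real" where
  "jump \<kappa> s r x w = (s - r) * w - \<kappa> * (\<bar>s\<bar> - \<bar>r\<bar>) * x"

text \<open>Merging rests on this identity: two sign changes at the same point with the same value
  collapse to one, so a point moved onto its neighbour disappears from the chain at no cost.\<close>

lemma jump_add: "jump \<kappa> s r x w + jump \<kappa> r q x w = jump \<kappa> s q x w"
  by (simp add: jump_def algebra_simps)

text \<open>
  An entry \<open>(x, r, b)\<close> means that the sign is \<open>r\<close> to the right of \<open>x\<close>; the tag \<open>b\<close> says that the
  value at \<open>x\<close> is taken from \<open>U\<close> instead of \<open>v\<close>. Only high points, where the sign drops, may be
  tagged: merging with a tagged point replaces \<open>U\<close> by \<open>v\<close> there, which must not decrease the gain.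
\<close>

type_synonym chain = "(real \<times> real \<times> bool) list"

fun gain :: "real \<Rightarrow> (real \<Rightarrow> real) \<Rightarrow> (real \<Rightarrow> real) \<Rightarrow> real \<Rightarrow> chain \<Rightarrow> real" where
  "gain \<kappa> v U s [] = 0"
| "gain \<kappa> v U s ((x, r, b) # cs) = jump \<kappa> s r x (if b then U x else v x) + gain \<kappa> v U r cs"

fun final_sign :: "real \<Rightarrow> chain \<Rightarrow> real" where
  "final_sign s [] = s"
| "final_sign s ((x, r, b) # cs) = final_sign r cs"

fun tags_high :: "real \<Rightarrow> chain \<Rightarrow> bool" where
  "tags_high s [] = True"
| "tags_high s ((x, r, b) # cs) \<longleftrightarrow> (b \<longrightarrow> r < s) \<and> tags_high r cs"

text \<open>While \<open>tags_high\<close> is the invariant of the reduction, this is the state in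
  which it stops: every point with a positive coefficient \<open>s - r\<close> already takes its
  value from \<open>U\<close>.\<close>

fun high_tagged :: "real \<Rightarrow> chain \<Rightarrow> bool" where
  "high_tagged s [] = True"
| "high_tagged s ((x, r, b) # cs) \<longleftrightarrow> (r < s \<longrightarrow> b) \<and> high_tagged r cs"

text \<open>The sign is 0 before the first and after the last point, so Abel summation leaves no
  boundary terms.\<close>

definition chain_ok :: "chain \<Rightarrow> bool" where
  "chain_ok cs \<longleftrightarrow> sorted (map fst cs) \<and> (\<forall>(x, r, b) \<in> set cs. \<bar>r\<bar> \<le> 1) \<and> final_sign 0 cs = 0 \<and> tags_high 0 cs"

lemma gain_append: "gain \<kappa> v U s (as @ cs) = gain \<kappa> v U s as + gain \<kappa> v U (final_sign s as) cs"
  by (induction s as rule: final_sign.induct) auto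

lemma final_sign_append: "final_sign s (as @ cs) = final_sign (final_sign s as) cs"
  by (induction s as rule: final_sign.induct) auto

lemma tags_high_append: "tags_high s (as @ cs) \<longleftrightarrow> tags_high s as \<and> tags_high (final_sign s as) cs"
  by (induction s as rule: final_sign.induct) auto

lemma not_high_taggedE:
  assumes "\<not> high_tagged s cs"
  obtains as x r bs where "cs = as @ (x, r, False) # bs" "r < final_sign s as"
proof -
  have "\<exists>as x r bs. cs = as @ (x, r, False) # bs \<and> r < final_sign s as"
    using assms
  proof (induction s cs rule: high_tagged.induct)
    case (2 s x r b cs)
    show ?case
    proof (cases "r < s \<longrightarrow> b")
      case True
      then obtain as y q bs where "cs = as @ (y, q, False) # bs" "q < final_sign r as"
        using 2 by auto
      then have "(x, r, b) # cs = ((x, r, b) # as) @ (y, q, False) # bs \<and> q < final_sign s ((x, r, b) # as)"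
        by simp
      then show ?thesis by blast
    next
      case False
      then have "(x, r, b) # cs = [] @ (x, r, False) # cs \<and> r < final_sign s []" by simp
      then show ?thesis by blast
    qed
  qed simp
  then show ?thesis using that by blast
qed

text \<open>At an untagged high point the contribution is \<open>(s - r) * (v x - k * x)\<close>
  with \<open>s - r > 0\<close>, so \<open>K\<close> for this slope \<open>k\<close> lets the point
  move without loss: to a neighbour, where it is merged, or to some \<open>z\<close> between the
  neighbours where \<open>U\<close> is as large, and there it is tagged. Tagging lowers the number
  of untagged points. Merging lowers the length and does not raise that number, even if the
  neighbour loses its tag. Hence the sum of the two decreases.\<close>

lemma chain_step:
  assumes vU: "\<And>x. U x \<le> v x" and bd: "\<And>x. \<bar>v x\<bar> \<le> B" and lam: "\<kappa> > 0"
    and K: "\<And>p x q k. p \<le> x \<Longrightarrow> x \<le> q \<Longrightarrow> v x - k * x \<le> v p - k * p \<or> v x - k * x \<le> v q - k * q \<or>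
        (\<exists>z. p \<le> z \<and> z \<le> q \<and> v x - k * x \<le> U z - k * z)"
    and ok: "chain_ok (as @ (x, r, False) # bs)" and high: "r < final_sign 0 as"
  obtains cs where "chain_ok cs" "gain \<kappa> v U 0 (as @ (x, r, False) # bs) \<le> gain \<kappa> v U 0 cs"
    "length cs + length (filter (\<lambda>(x, r, b). \<not> b) cs) <
     length (as @ (x, r, False) # bs) + length (filter (\<lambda>(x, r, b). \<not> b) (as @ (x, r, False) # bs))"
proof -
  define s where "s = final_sign 0 as"
  define k where "k = \<kappa> * (\<bar>s\<bar> - \<bar>r\<bar>) / (s - r)"
  have rs: "r < s" using high by (simp add: s_def)
  have J: "jump \<kappa> s r y w = (s - r) * (w - k * y)" for y w
    using rs by (simp add: jump_def k_def field_simps)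
  \<comment> \<open>At either end of the chain a far point replaces the missing neighbour. There one
    of the signs is 0, so \<open>k\<close> is \<open>- \<kappa>\<close> on the left and
    \<open>\<kappa>\<close> on the right; over the distance \<open>(2 * B + 1) / \<kappa>\<close>
    the affine term changes by \<open>2 * B + 1\<close>, more than \<open>v\<close> can vary. This
    excludes the alternative in which the point would move there.\<close>
  define P where "P = (if as = [] then x - (2 * B + 1) / \<kappa> else fst (last as))"
  define Q where "Q = (if bs = [] then x + (2 * B + 1) / \<kappa> else fst (hd bs))"
  have B: "B \<ge> 0" using bd[of 0] by linarith
  have sorted: "sorted (map fst (as @ (x, r, False) # bs))" using ok by (simp add: chain_ok_def)
  have Px: "P \<le> x"
    using sorted B lam by (auto simp: P_def sorted_append)
  have xQ: "x \<le> Q"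
    using sorted B lam by (auto simp: Q_def sorted_append)
  have left: "as \<noteq> []" if "v x - k * x \<le> v P - k * P"
  proof
    assume e: "as = []"
    then have "s = 0" by (simp add: s_def)
    then have "k = - \<kappa>" using rs by (simp add: k_def)
    moreover have "\<kappa> * P = \<kappa> * x - (2 * B + 1)" using lam e by (simp add: P_def field_simps)
    ultimately show False using that bd[of x] bd[of P] by (simp add: algebra_simps)
  qed
  have right: "bs \<noteq> []" if "v x - k * x \<le> v Q - k * Q"
  proof
    assume e: "bs = []"
    then have "r = 0" using ok by (simp add: chain_ok_def final_sign_append)
    then have "k = \<kappa>" using rs by (simp add: k_def)
    moreover have "\<kappa> * Q = \<kappa> * x + (2 * B + 1)" using lam e by (simp add: Q_def field_simps)
    ultimately show False using that bd[of x] bd[of Q] by (simp add: algebra_simps)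
  qed
  consider (L) "as \<noteq> []" "v x - k * x \<le> v P - k * P" | (R) "bs \<noteq> []" "v x - k * x \<le> v Q - k * Q"
    | (Z) z where "P \<le> z" "z \<le> Q" "v x - k * x \<le> U z - k * z"
    using K[OF Px xQ, of k] left right by blast
  then show ?thesis
  proof cases
    case L
    obtain as' p t b where as: "as = as' @ [(p, t, b)]"
      using L by (metis append_butlast_last_id prod_cases3)
    have t: "t = s" by (simp add: s_def as final_sign_append)
    have P: "P = p" by (simp add: P_def as)
    define s' where "s' = final_sign 0 as'"
    have th: "b \<Longrightarrow> s < s'"
      using ok by (simp add: chain_ok_def as tags_high_append s'_def t)
    have g1: "jump \<kappa> s' s p (if b then U p else v p) \<le> jump \<kappa> s' s p (v p)"
      using th vU[of p] by (auto simp: jump_def intro!: mult_left_mono)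
    have g2: "jump \<kappa> s r x (v x) \<le> jump \<kappa> s r p (v p)"
      using L rs by (simp add: J P)
    show ?thesis
    proof (rule that[of "as' @ (p, r, False) # bs"])
      show "chain_ok (as' @ (p, r, False) # bs)"
        using ok sorted by (auto simp: chain_ok_def as tags_high_append final_sign_append sorted_append)
      show "gain \<kappa> v U 0 (as @ (x, r, False) # bs) \<le> gain \<kappa> v U 0 (as' @ (p, r, False) # bs)"
        using g1 g2 jump_add[of \<kappa> s' s p "v p" r]
        by (simp add: as gain_append final_sign_append t s'_def[symmetric])
    qed (simp add: as)
  next
    case R
    obtain q t b bs' where bs: "bs = (q, t, b) # bs'"
      using R by (metis list.exhaust prod_cases3)
    have Q: "Q = q" by (simp add: Q_def bs)
    have th: "b \<Longrightarrow> t < r"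
      using ok by (simp add: chain_ok_def bs tags_high_append)
    have g1: "jump \<kappa> r t q (if b then U q else v q) \<le> jump \<kappa> r t q (v q)"
      using th vU[of q] by (auto simp: jump_def intro!: mult_left_mono)
    have g2: "jump \<kappa> s r x (v x) \<le> jump \<kappa> s r q (v q)"
      using R rs by (simp add: J Q)
    show ?thesis
    proof (rule that[of "as @ (q, t, False) # bs'"])
      show "chain_ok (as @ (q, t, False) # bs')"
        using ok sorted by (auto simp: chain_ok_def bs tags_high_append final_sign_append sorted_append)
      show "gain \<kappa> v U 0 (as @ (x, r, False) # bs) \<le> gain \<kappa> v U 0 (as @ (q, t, False) # bs')"
        using g1 g2 jump_add[of \<kappa> s r q "v q" t]
        by (simp add: bs gain_append final_sign_append s_def[symmetric])
    qed (simp add: bs)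
  next
    case Z
    show ?thesis
    proof (rule that[of "as @ (z, r, True) # bs"])
      have l: "\<forall>y\<in>set as. fst y \<le> z"
      proof (cases "as = []")
        case False
        then have "P = fst (last as)" by (simp add: P_def)
        moreover have "\<forall>y\<in>set as. fst y \<le> fst (last as)"
          using sorted False
          by (induction as) (auto simp: sorted_append)
        ultimately show ?thesis using Z by force
      qed simp
      have rr: "\<forall>y\<in>set bs. z \<le> fst y"
      proof (cases bs)
        case (Cons c bs')
        then have "Q = fst c" by (simp add: Q_def)
        then show ?thesis using Z sorted Cons by (force simp: sorted_append)
      qed simp
      show "chain_ok (as @ (z, r, True) # bs)"
        using ok sorted l rr rs
        by (auto simp: chain_ok_def tags_high_append final_sign_append sorted_append s_def)
      show "gain \<kappa> v U 0 (as @ (x, r, False) # bs) \<le> gain \<kappa> v U 0 (as @ (z, r, True) # bs)"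
        using Z rs by (simp add: gain_append s_def[symmetric] J)
    qed simp
  qed
qed

lemma chain_reduce:
  assumes vU: "\<And>x. U x \<le> v x" and bd: "\<And>x. \<bar>v x\<bar> \<le> B" and lam: "\<kappa> > 0"
    and K: "\<And>p x q k. p \<le> x \<Longrightarrow> x \<le> q \<Longrightarrow> v x - k * x \<le> v p - k * p \<or> v x - k * x \<le> v q - k * q \<or>
        (\<exists>z. p \<le> z \<and> z \<le> q \<and> v x - k * x \<le> U z - k * z)"
    and ok: "chain_ok cs"
  shows "\<exists>cs'. chain_ok cs' \<and> high_tagged 0 cs' \<and> gain \<kappa> v U 0 cs \<le> gain \<kappa> v U 0 cs'"
  using ok
proof (induction cs rule: measure_induct_rule[where f = "\<lambda>cs. length cs + length (filter (\<lambda>(x, r, b). \<not> b) cs)"])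
  case (less cs)
  show ?case
  proof (cases "high_tagged 0 cs")
    case False
    then obtain as x r bs where cs: "cs = as @ (x, r, False) # bs" "r < final_sign 0 as"
      by (rule not_high_taggedE)
    obtain ds where ds: "chain_ok ds" "gain \<kappa> v U 0 cs \<le> gain \<kappa> v U 0 ds"
      "length ds + length (filter (\<lambda>(x, r, b). \<not> b) ds) < length cs + length (filter (\<lambda>(x, r, b). \<not> b) cs)"
      using chain_step[OF vU bd lam K less.prems[unfolded cs(1)] cs(2)] unfolding cs(1) by blast
    show ?thesis using less.IH[OF ds(3) ds(1)] ds(2) by force
  qed (use less.prems in auto)
qed

lemma gain_high_tagged_le:
  assumes "\<And>x. U x \<le> v x" "high_tagged s cs"
  shows "gain \<kappa> v U s cs \<le> gain \<kappa> U U s cs"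
  using assms(2)
proof (induction s cs rule: high_tagged.induct)
  case (2 s x r b cs)
  have "jump \<kappa> s r x (if b then U x else v x) \<le> jump \<kappa> s r x (U x)"
    using 2(2) assms(1)[of x] by (auto simp: jump_def intro!: mult_left_mono_neg)
  then show ?case using 2 by force
qed simp

text \<open>Here Abel summation is undone: an interval with sign \<open>r\<close> contributes at
  most \<bar>r\<bar> times its signed excess, and \<bar>r\<bar> \<le> 1.\<close>

lemma gain_le_excess:
  assumes "\<bar>r\<bar> \<le> 1" "sorted (x # map fst cs)" "\<forall>(x, r, b) \<in> set cs. \<bar>r\<bar> \<le> 1" "final_sign r cs = 0"
  shows "jump \<kappa> 0 r x (U x) + gain \<kappa> U U r cs \<le> excess \<kappa> U (x # map fst cs)"
  using assms
proof (induction cs arbitrary: x r)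
  case Nil
  then show ?case by (simp add: jump_def)
next
  case (Cons c cs)
  obtain y t b where c: "c = (y, t, b)" by (cases c)
  have IH: "jump \<kappa> 0 t y (U y) + gain \<kappa> U U t cs \<le> excess \<kappa> U (y # map fst cs)"
    using Cons by (intro Cons.IH) (auto simp: c)
  have a: "r * a \<le> \<bar>r\<bar> * \<bar>a\<bar>" for a
    by (metis abs_ge_self abs_mult)
  have "jump \<kappa> 0 r x (U x) + jump \<kappa> r 0 y (U y) = r * (U y - U x) - \<kappa> * \<bar>r\<bar> * (y - x)"
    by (simp add: jump_def algebra_simps)
  also have "\<dots> \<le> \<bar>r\<bar> * (\<bar>U y - U x\<bar> - \<kappa> * (y - x))"
    using a[of "U y - U x"] by (simp add: algebra_simps)
  also have "\<dots> \<le> \<bar>r\<bar> * max 0 (\<bar>U y - U x\<bar> - \<kappa> * (y - x))"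
    by (intro mult_left_mono) auto
  also have "\<dots> \<le> 1 * max 0 (\<bar>U y - U x\<bar> - \<kappa> * (y - x))"
    using Cons.prems by (intro mult_right_mono) auto
  finally show ?case
    using IH jump_add[of \<kappa> r 0 y "U y" t] by (simp add: c)
qed

lemma excess_eq_gain:
  assumes "sorted (x # xs)"
  shows "\<exists>r cs. \<bar>r\<bar> \<le> 1 \<and> map fst cs = xs \<and> (\<forall>(x, r, b) \<in> set cs. \<bar>r\<bar> \<le> 1 \<and> \<not> b) \<and> final_sign r cs = 0 \<and>
     tags_high r cs \<and> excess \<kappa> v (x # xs) = jump \<kappa> 0 r x (v x) + gain \<kappa> v U r cs"
  using assms
proof (induction xs arbitrary: x)
  case Nil
  show ?case by (intro exI[of _ 0] exI[of _ "[]"]) (simp add: jump_def)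
next
  case (Cons y xs)
  then obtain t cs where IH: "\<bar>t\<bar> \<le> 1" "map fst cs = xs" "\<forall>(x, r, b) \<in> set cs. \<bar>r\<bar> \<le> 1 \<and> \<not> b" "final_sign t cs = 0"
     "tags_high t cs" "excess \<kappa> v (y # xs) = jump \<kappa> 0 t y (v y) + gain \<kappa> v U t cs"
    by (metis sorted_simps(2))
  \<comment> \<open>The optimal sign is that of the increment; an interval no steeper than
    \<open>\<kappa>\<close> gets sign 0 and contributes nothing.\<close>
  define r :: real where "r = (if \<bar>v y - v x\<bar> > \<kappa> * (y - x) then if v x \<le> v y then 1 else - 1 else 0)"
  have "jump \<kappa> 0 r x (v x) + jump \<kappa> r 0 y (v y) = r * (v y - v x) - \<kappa> * \<bar>r\<bar> * (y - x)"
    by (simp add: jump_def algebra_simps)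
  also have "\<dots> = max 0 (\<bar>v y - v x\<bar> - \<kappa> * (y - x))"
    by (auto simp: r_def max_def)
  finally have "excess \<kappa> v (x # y # xs) = jump \<kappa> 0 r x (v x) + gain \<kappa> v U r ((y, t, False) # cs)"
    using IH jump_add[of \<kappa> r 0 y "v y" t] by simp
  moreover have "\<bar>r\<bar> \<le> 1" by (simp add: r_def)
  ultimately show ?case using IH
    by (intro exI[of _ r] exI[of _ "(y, t, False) # cs"]) auto
qed

text \<open>The combinatorial core, free of analysis: all that is used of \<open>v\<close> and
  \<open>U\<close> is the touching property \<open>K\<close>. Since the reduction moves the points
  of the partition, the bound on \<open>U\<close> is required for all partitions and not for
  \<open>xs\<close> alone.\<close>

lemma excess_majorant_le:
  assumes vU: "\<And>x. U x \<le> v x" and bd: "\<And>x. \<bar>v x\<bar> \<le> B" and lam: "\<kappa> > 0"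
    and K: "\<And>p x q k. p \<le> x \<Longrightarrow> x \<le> q \<Longrightarrow> v x - k * x \<le> v p - k * p \<or> v x - k * x \<le> v q - k * q \<or>
        (\<exists>z. p \<le> z \<and> z \<le> q \<and> v x - k * x \<le> U z - k * z)"
    and E: "\<And>ys. sorted ys \<Longrightarrow> excess \<kappa> U ys \<le> E"
    and xs: "sorted xs"
  shows "excess \<kappa> v xs \<le> E"
proof (cases xs)
  case Nil
  then show ?thesis using E[of "[]"] by simp
next
  case (Cons x ys)
  obtain r cs where cs: "\<bar>r\<bar> \<le> 1" "map fst cs = ys" "\<forall>(x, r, b) \<in> set cs. \<bar>r\<bar> \<le> 1 \<and> \<not> b" "final_sign r cs = 0"
     "tags_high r cs" "excess \<kappa> v (x # ys) = jump \<kappa> 0 r x (v x) + gain \<kappa> v U r cs"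
    using excess_eq_gain xs unfolding Cons by meson
  have "chain_ok ((x, r, False) # cs)"
    using cs xs by (fastforce simp: chain_ok_def Cons)
  then obtain ds where ds: "chain_ok ds" "high_tagged 0 ds"
    "gain \<kappa> v U 0 ((x, r, False) # cs) \<le> gain \<kappa> v U 0 ds"
    using chain_reduce[OF vU bd lam K] by meson
  have "excess \<kappa> v xs = gain \<kappa> v U 0 ((x, r, False) # cs)"
    using cs by (simp add: Cons)
  also have "\<dots> \<le> gain \<kappa> v U 0 ds" by fact
  also have "\<dots> \<le> gain \<kappa> U U 0 ds" by (rule gain_high_tagged_le[OF vU ds(2)])
  also have "\<dots> \<le> excess \<kappa> U (map fst ds)"
  proof (cases ds)
    case (Cons d ds')
    obtain y t b where d: "d = (y, t, b)" by (cases d)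
    show ?thesis using ds(1) gain_le_excess[of t y ds' \<kappa> U]
      by (auto simp: Cons d chain_ok_def)
  qed simp
  also have "\<dots> \<le> E" using ds(1) by (intro E) (simp add: chain_ok_def)
  finally show ?thesis .
qed

section \<open>Poisson extension and maximum principle\<close>

lemma poisson_nonneg: "0 < t \<Longrightarrow> 0 \<le> poisson x t"
  by (simp add: poisson_def)

lemma poisson_measurable [measurable]: "(\<lambda>z. poisson (y - z) t) \<in> borel_measurable borel"
  unfolding poisson_def by measurable

lemma poisson_le: "0 < t \<Longrightarrow> poisson x t \<le> 1 / (pi * t)"
  by (simp add: poisson_def frac_le_eq power2_eq_square add_nonneg_pos divide_simps) 

text \<open>The constant comes from \<open>(x - z)\<^sup>2 \<le> 2 * (y - x)\<^sup>2 + 2 * (y -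
  z)\<^sup>2\<close>. The estimate serves twice: as a domination for continuity in \<open>y\<close>,
  and to replace a point of the cone over \<open>x\<close> by the point vertically above
  \<open>x\<close>.\<close>

lemma poisson_harnack:
  assumes "0 < t" "\<bar>y - x\<bar> \<le> a * t"
  shows "poisson (y - z) t \<le> (2 * a\<^sup>2 + 2) * poisson (x - z) t"
proof -
  have "(y - x)\<^sup>2 \<le> (a * t)\<^sup>2"
    using assms by (metis abs_ge_zero power2_abs power_mono)
  moreover have "(x - z)\<^sup>2 \<le> 2 * (y - x)\<^sup>2 + 2 * (y - z)\<^sup>2"
    using zero_le_power2[of "(y - x) + (y - z)"] by (simp add: power2_eq_square algebra_simps)
  ultimately have "(x - z)\<^sup>2 + t\<^sup>2 \<le> 2 * a\<^sup>2 * t\<^sup>2 + 2 * (y - z)\<^sup>2 + t\<^sup>2"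
    by (simp add: power_mult_distrib)
  also have "\<dots> \<le> (2 * a\<^sup>2 + 2) * ((y - z)\<^sup>2 + t\<^sup>2)"
    by (simp add: algebra_simps)
  finally have "(x - z)\<^sup>2 + t\<^sup>2 \<le> (2 * a\<^sup>2 + 2) * ((y - z)\<^sup>2 + t\<^sup>2)" .
  moreover have "(x - z)\<^sup>2 + t\<^sup>2 > 0" "(y - z)\<^sup>2 + t\<^sup>2 > 0"
    using assms by (auto intro: add_nonneg_pos)
  ultimately have "t / ((y - z)\<^sup>2 + t\<^sup>2) \<le> (2 * a\<^sup>2 + 2) * (t / ((x - z)\<^sup>2 + t\<^sup>2))"
    using mult_left_mono[of "(x - z)\<^sup>2 + t\<^sup>2" "(2 * a\<^sup>2 + 2) * ((y - z)\<^sup>2 + t\<^sup>2)" t] assms(1)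
    by (simp add: divide_le_eq le_divide_eq mult_ac)
  then show ?thesis
    using divide_right_mono[of "t / ((y - z)\<^sup>2 + t\<^sup>2)" "(2 * a\<^sup>2 + 2) * (t / ((x - z)\<^sup>2 + t\<^sup>2))" pi]
    by (simp add: poisson_def mult_ac)
qed

lemma
  assumes "0 < t"
  shows integrable_poisson: "integrable lborel (\<lambda>z. poisson (y - z) t)"
    and integral_poisson: "(LINT z|lborel. poisson (y - z) t) = 1"
proof -
  have eq: "poisson (y - z) t = (1 / (pi * t)) * inverse (1 + (y / t + (- 1 / t) * z)\<^sup>2)" for z
  proof -
    have "y / t + (- 1 / t) * z = (y - z) / t" using assms by (simp add: field_simps)
    moreover have "(y - z)\<^sup>2 + t\<^sup>2 > 0" using assms by (auto intro: add_nonneg_pos)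
    ultimately show ?thesis using assms
      by (simp add: poisson_def field_simps power2_eq_square)
  qed
  have i: "integrable lborel (\<lambda>x::real. inverse (1 + x\<^sup>2))"
    using integrable_inverse_1_plus_square by (simp add: set_integrable_def)
  have v: "(LINT x|lborel. inverse (1 + x\<^sup>2)) = pi"
    using LBINT_inverse_1_plus_square by (simp add: interval_lebesgue_integral_def set_lebesgue_integral_def)
  show "integrable lborel (\<lambda>z. poisson (y - z) t)"
    unfolding eq using assms by (intro integrable_mult_right lborel_integrable_real_affine i) auto
  have "pi = \<bar>- 1 / t\<bar> *\<^sub>R (LINT z|lborel. inverse (1 + (y / t + (- 1 / t) * z)\<^sup>2))"
    unfolding v[symmetric] using assms by (intro lborel_integral_real_affine) auto
  then show "(LINT z|lborel. poisson (y - z) t) = 1"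
    unfolding eq integral_mult_right_zero using assms
    by (subst (asm) eq_commute) (simp add: divide_eq_eq)
qed

lemma integrable_poisson_mult:
  assumes "0 < t" "h \<in> borel_measurable borel" "\<And>x. \<bar>h x\<bar> \<le> B"
  shows "integrable lborel (\<lambda>z. poisson (y - z) t * h z)"
proof (rule Bochner_Integration.integrable_bound)
  show "integrable lborel (\<lambda>z. B * poisson (y - z) t)"
    using integrable_poisson[OF assms(1)] by simp
  show "AE z in lborel. norm (poisson (y - z) t * h z) \<le> norm (B * poisson (y - z) t)"
    using assms poisson_nonneg[OF assms(1)]
    by (intro AE_I2) (auto simp: abs_mult mult.commute[of B] intro!: mult_left_mono order_trans[OF assms(3)])
qed (use assms in measurable)

lemma poisson_ext_nonneg: "0 < t \<Longrightarrow> 0 \<le> poisson_ext f y t"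
  unfolding poisson_ext_def by (intro Bochner_Integration.integral_nonneg mult_nonneg_nonneg poisson_nonneg) auto

lemma poisson_ext_le:
  assumes "0 < t" "f \<in> borel_measurable borel" "\<And>x. \<bar>f x\<bar> \<le> B"
  shows "poisson_ext f y t \<le> B"
proof -
  have "poisson_ext f y t \<le> (LINT z|lborel. B * poisson (y - z) t)"
    unfolding poisson_ext_def
    using assms poisson_nonneg[OF assms(1)] integrable_poisson[OF assms(1)] integrable_poisson_mult[OF assms(1), of "\<lambda>x. \<bar>f x\<bar>" B]
    by (intro integral_mono) (auto simp: mult.commute[of B] intro!: mult_left_mono)
  also have "\<dots> = B" using integral_poisson[OF assms(1)] by simp
  finally show ?thesis .
qed

lemma continuous_poisson_ext:
  assumes "0 < t" "f \<in> borel_measurable borel" "\<And>x. \<bar>f x\<bar> \<le> B"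
  shows "continuous_on A (\<lambda>y. poisson_ext f y t)"
proof -
  note [measurable] = assms(2)
  have "isCont (\<lambda>y. poisson_ext f y t) y" for y
    unfolding isCont_def tendsto_at_iff_sequentially comp_def
  proof safe
    fix X assume X: "X \<longlonglongrightarrow> y"
    then obtain N where N: "\<And>n. n \<ge> N \<Longrightarrow> \<bar>X n - y\<bar> \<le> 1 * t"
      using assms(1) unfolding LIMSEQ_def dist_real_def by (metis less_imp_le mult_1)
    have "(\<lambda>n. poisson_ext f (X (n + N)) t) \<longlonglongrightarrow> poisson_ext f y t"
      unfolding poisson_ext_def
    proof (rule integral_dominated_convergence)
      let ?P = "\<lambda>n z. poisson (X (n + N) - z) t * \<bar>f z\<bar>"
      \<comment> \<open>The factor 4 is \<open>2 * 1\<^sup>2 + 2\<close>, the Harnack constant for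
        displacements of at most \<open>t\<close>.\<close>
      show "integrable lborel (\<lambda>z. 4 * (poisson (y - z) t * \<bar>f z\<bar>))"
        using integrable_poisson_mult[OF assms(1), of "\<lambda>x. \<bar>f x\<bar>" B] assms by simp
      show "AE z in lborel. norm (?P n z) \<le> 4 * (poisson (y - z) t * \<bar>f z\<bar>)" for n
      proof (rule AE_I2)
        fix z
        have "?P n z \<le> (2 * 1\<^sup>2 + 2) * poisson (y - z) t * \<bar>f z\<bar>"
          by (intro mult_right_mono poisson_harnack[OF assms(1) N]) auto
        then show "norm (?P n z) \<le> 4 * (poisson (y - z) t * \<bar>f z\<bar>)"
          using poisson_nonneg[OF assms(1)] by (simp add: abs_mult)
      qed
      show "AE z in lborel. (\<lambda>n. ?P n z) \<longlonglongrightarrow> poisson (y - z) t * \<bar>f z\<bar>"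
      proof (rule AE_I2)
        fix z
        have "(y - z)\<^sup>2 + t\<^sup>2 \<noteq> 0" using assms(1) by (simp add: add_nonneg_eq_0_iff)
        then show "(\<lambda>n. ?P n z) \<longlonglongrightarrow> poisson (y - z) t * \<bar>f z\<bar>"
          unfolding poisson_def by (intro tendsto_intros LIMSEQ_ignore_initial_segment X)
      qed
    qed measurable
    then show "(\<lambda>n. poisson_ext f (X n) t) \<longlonglongrightarrow> poisson_ext f y t"
      by (rule LIMSEQ_offset)
  qed
  then show ?thesis by (simp add: continuous_at_imp_continuous_on)
qed

lemma poisson_ext_shift_tendsto:
  assumes "0 < t" "f \<in> borel_measurable borel" "\<And>x. \<bar>f x\<bar> \<le> B"
  shows "(\<lambda>n. poisson_ext f y (t + inverse (real (Suc n)))) \<longlonglongrightarrow> poisson_ext f y t"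
  unfolding poisson_ext_def
proof (rule integral_dominated_convergence)
  let ?s = "\<lambda>n. inverse (real (Suc n))"
  note [measurable] = assms(2)
  show "integrable lborel (\<lambda>z. ((t + 1) / t) * (poisson (y - z) t * \<bar>f z\<bar>))"
    using integrable_poisson_mult[OF assms(1), of "\<lambda>x. \<bar>f x\<bar>" B] assms by simp
  show "AE z in lborel. (\<lambda>n. poisson (y - z) (t + ?s n) * \<bar>f z\<bar>) \<longlonglongrightarrow> poisson (y - z) t * \<bar>f z\<bar>"
  proof (rule AE_I2)
    fix z
    have "(y - z)\<^sup>2 + (t + 0)\<^sup>2 \<noteq> 0" using assms(1) by (simp add: add_nonneg_eq_0_iff)
    then have "(\<lambda>n. poisson (y - z) (t + ?s n) * \<bar>f z\<bar>) \<longlonglongrightarrow> poisson (y - z) (t + 0) * \<bar>f z\<bar>"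
      unfolding poisson_def by (intro tendsto_intros LIMSEQ_inverse_real_of_nat)
    then show "(\<lambda>n. poisson (y - z) (t + ?s n) * \<bar>f z\<bar>) \<longlonglongrightarrow> poisson (y - z) t * \<bar>f z\<bar>"
      by simp
  qed
  show "AE z in lborel. norm (poisson (y - z) (t + ?s n) * \<bar>f z\<bar>) \<le> ((t + 1) / t) * (poisson (y - z) t * \<bar>f z\<bar>)" for n
  proof (rule AE_I2)
    fix z
    define s where "s = ?s n"
    have s: "0 < s" "s \<le> 1" by (auto simp: s_def inverse_le_1_iff)
    have "(t + s) / ((y - z)\<^sup>2 + (t + s)\<^sup>2) \<le> (t + 1) / ((y - z)\<^sup>2 + t\<^sup>2)"
      using assms(1) s by (intro frac_le add_left_mono power_mono add_nonneg_pos) auto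
    then have "poisson (y - z) (t + s) \<le> ((t + 1) / t) * poisson (y - z) t"
      using assms(1) divide_right_mono[of "(t + s) / ((y - z)\<^sup>2 + (t + s)\<^sup>2)" "(t + 1) / ((y - z)\<^sup>2 + t\<^sup>2)" pi]
      by (simp add: poisson_def mult.commute)
    then have "poisson (y - z) (t + s) * \<bar>f z\<bar> \<le> ((t + 1) / t) * poisson (y - z) t * \<bar>f z\<bar>"
      by (intro mult_right_mono) auto
    then show "norm (poisson (y - z) (t + ?s n) * \<bar>f z\<bar>) \<le> ((t + 1) / t) * (poisson (y - z) t * \<bar>f z\<bar>)"
      using poisson_nonneg[of "t + s"] assms(1) s unfolding s_def[symmetric] by (simp add: abs_mult)
  qed
qed (use assms(2) in measurable)

section \<open>Harmonicity through the Cauchy transform\<close>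

definition cauchy_transform :: "(real \<Rightarrow> real) \<Rightarrow> complex \<Rightarrow> complex" where
  "cauchy_transform h \<zeta> = (LINT z|lborel. of_real (h z) / (of_real z - \<zeta>))"

lemma norm_inverse_diff_le: "0 < Im \<zeta> \<Longrightarrow> norm (1 / (of_real z - \<zeta>)) \<le> 1 / Im \<zeta>"
  using abs_Im_le_cmod[of "of_real z - \<zeta>"] by (simp add: norm_divide divide_simps)

lemma integrable_cauchy_kernel:
  assumes h: "integrable lborel h" and "0 < Im \<zeta>"
  shows "integrable lborel (\<lambda>z. of_real (h z) / (of_real z - \<zeta>) ^ k)"
proof (rule Bochner_Integration.integrable_bound)
  show "integrable lborel (\<lambda>z. (1 / Im \<zeta>) ^ k * \<bar>h z\<bar>)" using h by simp
  show "(\<lambda>z. of_real (h z) / (of_real z - \<zeta>) ^ k) \<in> borel_measurable lborel"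
    using borel_measurable_integrable[OF h] by measurable
  have "norm (of_real (h z) / (of_real z - \<zeta>) ^ k) \<le> (1 / Im \<zeta>) ^ k * \<bar>h z\<bar>" for z
  proof -
    have "norm (of_real (h z) / (of_real z - \<zeta>) ^ k) = norm (1 / (of_real z - \<zeta>)) ^ k * \<bar>h z\<bar>"
      by (simp add: norm_divide norm_power power_divide)
    also have "\<dots> \<le> (1 / Im \<zeta>) ^ k * \<bar>h z\<bar>"
      by (intro mult_right_mono power_mono norm_inverse_diff_le assms) auto
    finally show ?thesis .
  qed
  then show "AE z in lborel. norm (of_real (h z) / (of_real z - \<zeta>) ^ k) \<le> norm ((1 / Im \<zeta>) ^ k * \<bar>h z\<bar>)"
    by (intro AE_I2) (auto intro: order_trans[OF _ abs_ge_self])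
qed

text \<open>The kernel \<open>poisson\<close> at \<zeta> is the imaginary part of
  \<open>1 / (z - \<zeta>)\<close> divided by pi. The Poisson integral thus becomes the real part of
  a holomorphic function, to which the complex maximum principle applies.\<close>

lemma Re_cauchy_transform:
  assumes h: "integrable lborel h" and "0 < Im \<zeta>"
  shows "Re (cauchy_transform h \<zeta> / (of_real pi * \<i>)) = (LINT z|lborel. poisson (Re \<zeta> - z) (Im \<zeta>) * h z)"
proof -
  have eq: "poisson (Re \<zeta> - z) (Im \<zeta>) * h z = Im (of_real (h z) / (of_real z - \<zeta>)) / pi" for z
    by (simp add: poisson_def Im_divide cmod_def power2_eq_square algebra_simps)
  have "Re (cauchy_transform h \<zeta> / (of_real pi * \<i>)) = Im (cauchy_transform h \<zeta>) / pi"
    by (simp add: Re_divide power2_eq_square)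
  also have "\<dots> = (LINT z|lborel. Im (of_real (h z) / (of_real z - \<zeta>))) / pi"
    unfolding cauchy_transform_def using integral_Im[OF integrable_cauchy_kernel[OF assms, of 1]] by simp
  finally show ?thesis by (simp add: eq)
qed

text \<open>The difference quotient minus the candidate derivative is the integral of
  \<open>h z * (v - w) / ((z - v) * (z - w)\<^sup>2)\<close>. Half the height of \<open>w\<close>
  bounds all three denominators from below for \<open>v\<close> near \<open>w\<close>, so the error
  is of order \<bar>v - w\<bar>.\<close>

lemma cauchy_transform_holomorphic:
  assumes h: "integrable lborel h"
  shows "cauchy_transform h holomorphic_on {\<zeta>. 0 < Im \<zeta>}"
proof -
  have "\<exists>D. (cauchy_transform h has_field_derivative D) (at w)" if w: "0 < Im w" for w
  proof -
    define D where "D = (LINT z|lborel. of_real (h z) / (of_real z - w)\<^sup>2)"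
    define H where "H = (LINT z|lborel. \<bar>h z\<bar>)"
    define r where "r = Im w / 2"
    have r: "r > 0" using w by (simp add: r_def)
    have bound: "norm ((cauchy_transform h v - cauchy_transform h w) / (v - w) - D) \<le> norm (v - w) * (1 / r ^ 3 * H)"
      if v: "v \<noteq> w" "norm (v - w) < r" for v
    proof -
      have Imv: "r < Im v" using abs_Im_le_cmod[of "v - w"] v(2) by (simp add: r_def)
      have Imw: "r < Im w" using w by (simp add: r_def)
      define q where "q z = (of_real (h z) / (of_real z - v) - of_real (h z) / (of_real z - w)) / (v - w)
          - of_real (h z) / (of_real z - w)\<^sup>2" for z
      note ik = integrable_cauchy_kernel[OF h, of v 1] integrable_cauchy_kernel[OF h, of w 1] integrable_cauchy_kernel[OF h, of w 2]
      have q: "integrable lborel q" "(cauchy_transform h v - cauchy_transform h w) / (v - w) - D = (LINT z|lborel. q z)"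
        unfolding q_def cauchy_transform_def D_def using ik Imv Imw r v(1) by simp_all
      have "norm (q z) \<le> norm (v - w) * (1 / r ^ 3 * \<bar>h z\<bar>)" for z
      proof -
        let ?a = "1 / (of_real z - v)" and ?b = "1 / (of_real z - w)"
        have "of_real z - v \<noteq> 0" "of_real z - w \<noteq> 0"
          using Imv Imw r by (auto simp: complex_eq_iff)
        then have ab: "?a - ?b = (v - w) * (?a * ?b)"
          by (simp add: field_simps)
        have "q z = of_real (h z) * (?a - ?b) / (v - w) - of_real (h z) * ?b * ?b"
          by (simp add: q_def right_diff_distrib power2_eq_square)
        also have "\<dots> = of_real (h z) * ?b * (?a - ?b)"
        proof -
          have "H * ((v - w) * (A * B)) / (v - w) - H * B * B = H * B * (A - B)" for H A B
          proof -
            have "H * ((v - w) * (A * B)) / (v - w) = H * (A * B)" using v(1) by simp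
            then show ?thesis by (simp only:) (simp add: algebra_simps)
          qed
          from this[of "of_real (h z)" ?a ?b] show ?thesis unfolding ab .
        qed
        finally have "norm (q z) = norm (v - w) * (norm ?b * (norm ?a * norm ?b) * \<bar>h z\<bar>)"
          by (simp add: ab norm_mult norm_divide)
        also have "\<dots> \<le> norm (v - w) * (1 / r * (1 / r * (1 / r)) * \<bar>h z\<bar>)"
        proof -
          have "1 / Im \<zeta> \<le> 1 / r" if "r < Im \<zeta>" for \<zeta>
            using that r by (intro divide_left_mono) auto
          then have "norm ?a \<le> 1 / r" "norm ?b \<le> 1 / r"
            using norm_inverse_diff_le[of v z] norm_inverse_diff_le[of w z] Imv Imw r by (meson order_trans less_trans)+
          then show ?thesis
            using r by (intro mult_left_mono mult_right_mono mult_mono mult_nonneg_nonneg) auto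
        qed
        finally show ?thesis by (simp add: power3_eq_cube)
      qed
      then have "norm (LINT z|lborel. q z) \<le> (LINT z|lborel. norm (v - w) * (1 / r ^ 3 * \<bar>h z\<bar>))"
        using h by (intro Bochner_Integration.integral_norm_bound_integral q) auto
      then show ?thesis by (simp add: q(2) H_def)
    qed
    have "((\<lambda>v. (cauchy_transform h v - cauchy_transform h w) / (v - w) - D) \<longlongrightarrow> 0) (at w)"
    proof (rule Lim_null_comparison)
      show "\<forall>\<^sub>F v in at w. norm ((cauchy_transform h v - cauchy_transform h w) / (v - w) - D) \<le> norm (v - w) * (1 / r ^ 3 * H)"
        unfolding eventually_at using bound r by (auto simp: dist_norm intro!: exI[of _ r])
      show "((\<lambda>v. norm (v - w) * (1 / r ^ 3 * H)) \<longlongrightarrow> 0) (at w)"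
        using r by (auto intro!: tendsto_eq_intros)
    qed
    then have "(cauchy_transform h has_field_derivative D) (at w)"
      unfolding has_field_derivative_iff by (simp add: LIM_zero_iff)
    then show ?thesis by blast
  qed
  then show ?thesis
    unfolding holomorphic_on_def field_differentiable_def
    by (auto intro: has_field_derivative_at_within)
qed

lemma poisson_ext_truncate_tendsto:
  assumes "0 < t" "f \<in> borel_measurable borel" "\<And>x. \<bar>f x\<bar> \<le> B"
  shows "(\<lambda>N. LINT z|lborel. poisson (y - z) t * (indicator {- real N..real N} z * \<bar>f z\<bar>)) \<longlonglongrightarrow> poisson_ext f y t"
  unfolding poisson_ext_def
proof (rule integral_dominated_convergence)
  let ?F = "\<lambda>N z. poisson (y - z) t * (indicator {- real N..real N} z * \<bar>f z\<bar>)"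
  note [measurable] = assms(2)
  show "integrable lborel (\<lambda>z. poisson (y - z) t * \<bar>f z\<bar>)"
    using integrable_poisson_mult[OF assms(1), of "\<lambda>x. \<bar>f x\<bar>" B] assms by simp
  show "AE z in lborel. (\<lambda>N. ?F N z) \<longlonglongrightarrow> poisson (y - z) t * \<bar>f z\<bar>"
  proof (rule AE_I2)
    fix z
    obtain N0 where "\<bar>z\<bar> \<le> real N0" using real_arch_simple by blast
    then have "\<forall>\<^sub>F N in sequentially. ?F N z = poisson (y - z) t * \<bar>f z\<bar>"
      by (intro eventually_sequentiallyI[of N0]) (auto simp: indicator_def)
    then show "(\<lambda>N. ?F N z) \<longlonglongrightarrow> poisson (y - z) t * \<bar>f z\<bar>"
      by (rule tendsto_eventually)
  qed
qed (use assms(2) poisson_nonneg[OF assms(1)] in \<open>auto simp: abs_mult indicator_def\<close>)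

text \<open>
  The aperture enters through the shear \<open>y = x + c t\<close>: the affine function \<open>k (y - c t)\<close> is harmonic, so
  the maximum principle applies on sheared strips. The datum is truncated to a bounded interval
  to make its extension decay as \<open>t \<rightarrow> \<infinity>\<close>.
\<close>

lemma poisson_ext_max_principle:
  assumes f: "f \<in> borel_measurable borel" "\<And>x. \<bar>f x\<bar> \<le> B" and s: "0 < s" and x: "p \<le> x" "x \<le> q" and t: "0 \<le> t"
    and P: "\<And>t. 0 \<le> t \<Longrightarrow> poisson_ext f (p + c * t) (t + s) - k * p \<le> m"
    and Q: "\<And>t. 0 \<le> t \<Longrightarrow> poisson_ext f (q + c * t) (t + s) - k * q \<le> m"
    and bot: "\<And>y. p \<le> y \<Longrightarrow> y \<le> q \<Longrightarrow> poisson_ext f y s - k * y \<le> m"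
  shows "poisson_ext f (x + c * t) (t + s) - k * x \<le> m"
proof -
  note [measurable] = f(1)
  \<comment> \<open>This serves the upper edge of the truncated strip, where the extension is
    smaller than \<open>e\<close> and only the affine part is left to compare with
    \<open>m\<close>.\<close>
  have km: "- k * y \<le> m" if "p \<le> y" "y \<le> q" for y
    using bot[OF that] poisson_ext_nonneg[OF s, of f y] by simp
  have "(LINT z|lborel. poisson (x + c * t - z) (t + s) * (indicator {- real N..real N} z * \<bar>f z\<bar>)) - k * x \<le> m + e"
    if e: "e > 0" for N e
  proof -
    define h where "h = (\<lambda>z. indicator {- real N..real N} z * \<bar>f z\<bar>)"
    have hm [measurable]: "h \<in> borel_measurable borel" unfolding h_def by measurable
    have h0: "0 \<le> h z" "h z \<le> \<bar>f z\<bar>" "\<bar>h z\<bar> \<le> B" for z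
      using f(2)[of z] by (auto simp: h_def indicator_def)
    have hi: "integrable lborel h"
    proof (rule Bochner_Integration.integrable_bound)
      show "integrable lborel (\<lambda>z. indicator {- real N..real N} z * B)"
        by (simp add: integrable_mult_left)
      show "AE z in lborel. norm (h z) \<le> norm (indicator {- real N..real N} z * B)"
        using f(2) by (intro AE_I2) (auto simp: h_def indicator_def intro: order_trans[OF f(2) abs_ge_self])
    qed simp
    define H where "H = (LINT z|lborel. h z)"
    define E where "E y \<tau> = (LINT z|lborel. poisson (y - z) \<tau> * h z)" for y \<tau>
    \<comment> \<open>Truncating the datum only lowers its extension, so the assumed bounds on the
      sides and the bottom carry over.\<close>
    have E_ext: "E y \<tau> \<le> poisson_ext f y \<tau>" if "0 < \<tau>" for y \<tau>
      unfolding E_def poisson_ext_def using that h0 f(2)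
      by (intro integral_mono integrable_poisson_mult[where B = B] mult_left_mono poisson_nonneg) auto
    have E_H: "E y \<tau> \<le> H / (pi * \<tau>)" if "0 < \<tau>" for y \<tau>
    proof -
      have "E y \<tau> \<le> (LINT z|lborel. 1 / (pi * \<tau>) * h z)"
        unfolding E_def using that h0 hi
        by (intro integral_mono integrable_poisson_mult[where B = B] mult_right_mono poisson_le) auto
      then show ?thesis by (simp add: H_def)
    qed
    have "((\<lambda>\<tau>. H / (pi * (\<tau> + s))) \<longlongrightarrow> 0) at_top" by real_asymp
    then have "\<forall>\<^sub>F \<tau> in at_top. H / (pi * (\<tau> + s)) < e \<and> t \<le> \<tau>"
      using e by (intro eventually_conj eventually_ge_at_top) (auto simp: order_tendsto_iff)
    then obtain T where T: "H / (pi * (T + s)) < e" "t \<le> T"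
      by (auto dest: eventually_happens)
    \<comment> \<open>The real part of \<open>\<zeta> + \<i> * c * \<zeta>\<close> is
      \<open>Re \<zeta> - c * Im \<zeta>\<close>, the coordinate that is constant along the shear.
      The shift by \<open>\<i> * s\<close> puts the closed strip inside the domain where the Cauchy
      transform is holomorphic.\<close>
    define F where "F \<zeta> = cauchy_transform h (\<zeta> + \<i> * of_real s) / (of_real pi * \<i>) - of_real k * (\<zeta> + \<i> * of_real c * \<zeta>)" for \<zeta>
    have ReF: "Re (F \<zeta>) = E (Re \<zeta>) (Im \<zeta> + s) - k * (Re \<zeta> - c * Im \<zeta>)" if "0 \<le> Im \<zeta>" for \<zeta>
      using Re_cauchy_transform[OF hi, of "\<zeta> + \<i> * of_real s"] that s
      by (simp add: F_def E_def)
    have holF: "F holomorphic_on {\<zeta>. - s < Im \<zeta>}"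
    proof -
      have "(cauchy_transform h \<circ> (\<lambda>\<zeta>. \<zeta> + \<i> * of_real s)) holomorphic_on {\<zeta>. - s < Im \<zeta>}"
        by (rule holomorphic_on_compose_gen[OF _ cauchy_transform_holomorphic[OF hi]]) (auto intro!: holomorphic_intros)
      then show ?thesis
        unfolding F_def comp_def by (auto intro!: holomorphic_intros)
    qed
    define S where "S = {\<zeta>. p \<le> Re \<zeta> - c * Im \<zeta> \<and> Re \<zeta> - c * Im \<zeta> \<le> q \<and> 0 \<le> Im \<zeta> \<and> Im \<zeta> \<le> T}"
    define S' where "S' = {\<zeta>. p < Re \<zeta> - c * Im \<zeta> \<and> Re \<zeta> - c * Im \<zeta> < q \<and> 0 < Im \<zeta> \<and> Im \<zeta> < T}"
    have "closed S"
      unfolding S_def by (intro closed_Collect_conj closed_Collect_le continuous_intros)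
    have "open S'"
      unfolding S'_def by (intro open_Collect_conj open_Collect_less continuous_intros)
    then have int: "S' \<subseteq> interior S"
      by (intro interior_maximal) (auto simp: S_def S'_def)
    have bS: "bounded S"
    proof -
      have "norm \<zeta> \<le> \<bar>p\<bar> + \<bar>q\<bar> + \<bar>c\<bar> * T + T" if "\<zeta> \<in> S" for \<zeta>
      proof -
        have z: "p \<le> Re \<zeta> - c * Im \<zeta>" "Re \<zeta> - c * Im \<zeta> \<le> q" "0 \<le> Im \<zeta>" "Im \<zeta> \<le> T"
          using that by (auto simp: S_def)
        have "\<bar>c * Im \<zeta>\<bar> \<le> \<bar>c\<bar> * T" using z by (auto simp: abs_mult intro: mult_left_mono)
        then show ?thesis using z cmod_le[of \<zeta>] by linarith
      qed
      then show ?thesis by (auto simp: bounded_iff)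
    qed
    have sub: "S \<subseteq> {\<zeta>. - s < Im \<zeta>}" using s by (auto simp: S_def)
    define \<xi> where "\<xi> = Complex (x + c * t) t"
    have "Re (F \<xi>) \<le> m + e"
    proof (rule maximum_real_frontier[of F S])
      show "F holomorphic_on interior S"
        using holF sub interior_subset by (blast intro: holomorphic_on_subset)
      show "continuous_on (closure S) F"
        using holF sub \<open>closed S\<close> by (auto intro: holomorphic_on_imp_continuous_on holomorphic_on_subset)
      show "\<xi> \<in> S" using x t T by (simp add: S_def \<xi>_def)
      fix \<zeta> assume "\<zeta> \<in> frontier S"
      then have "\<zeta> \<in> S" "\<zeta> \<notin> S'"
        using int \<open>closed S\<close> by (auto simp: frontier_def)
      then consider "\<zeta> \<in> S" "Re \<zeta> = p + c * Im \<zeta>" | "\<zeta> \<in> S" "Re \<zeta> = q + c * Im \<zeta>" | "\<zeta> \<in> S" "Im \<zeta> = 0" | "\<zeta> \<in> S" "Im \<zeta> = T"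
        by (auto simp: S_def S'_def)
      then show "Re (F \<zeta>) \<le> m + e"
      proof cases
        case 1
        then have i: "0 \<le> Im \<zeta>" by (simp add: S_def)
        show ?thesis
          using P[OF i] E_ext[of "Im \<zeta> + s" "Re \<zeta>"] s i e by (simp add: ReF[OF i] 1)
      next
        case 2
        then have i: "0 \<le> Im \<zeta>" by (simp add: S_def)
        show ?thesis
          using Q[OF i] E_ext[of "Im \<zeta> + s" "Re \<zeta>"] s i e by (simp add: ReF[OF i] 2)
      next
        case 3
        then show ?thesis
          using bot[of "Re \<zeta>"] E_ext[of s "Re \<zeta>"] s e by (simp add: ReF S_def)
      next
        case 4
        then have i: "0 \<le> Im \<zeta>" by (simp add: S_def)
        have "E (Re \<zeta>) (T + s) \<le> e" using E_H[of "T + s" "Re \<zeta>"] T t s by simp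
        moreover have "- k * (Re \<zeta> - c * Im \<zeta>) \<le> m" using 4 by (intro km) (auto simp: S_def)
        ultimately show ?thesis by (simp add: ReF[OF i] 4)
      qed
    qed (rule bS)
    then show ?thesis
      using ReF[of \<xi>] t by (simp add: E_def h_def \<xi>_def)
  qed
  then have N: "(LINT z|lborel. poisson (x + c * t - z) (t + s) * (indicator {- real N..real N} z * \<bar>f z\<bar>)) - k * x \<le> m" for N
    by (rule field_le_epsilon)
  show ?thesis
    using t s
    by (intro LIMSEQ_le_const2[OF tendsto_diff[OF poisson_ext_truncate_tendsto[OF _ f] tendsto_const]]) (use N in auto)
qed

text \<open>
  Starting at height \<open>s > 0\<close> makes the boundary values continuous, so that no boundary behaviour of
  the Poisson extension is needed.
\<close>

definition shifted_max :: "real \<Rightarrow> (real \<Rightarrow> real) \<Rightarrow> real \<Rightarrow> real \<Rightarrow> real" where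
  "shifted_max \<alpha> f s x = (SUP yt \<in> {(y, t). t \<ge> 0 \<and> \<bar>y - x\<bar> \<le> \<alpha> * t}. poisson_ext f (fst yt) (snd yt + s))"

context
  fixes f :: "real \<Rightarrow> real" and B \<alpha> :: real
  assumes f: "f \<in> borel_measurable borel" "\<And>x. \<bar>f x\<bar> \<le> B" and alpha: "0 \<le> \<alpha>"
begin

lemma shifted_max_upper:
  assumes "0 < s" "0 \<le> t" "\<bar>y - x\<bar> \<le> \<alpha> * t"
  shows "poisson_ext f y (t + s) \<le> shifted_max \<alpha> f s x"
proof -
  have "bdd_above ((\<lambda>yt. poisson_ext f (fst yt) (snd yt + s)) ` {(y, t). t \<ge> 0 \<and> \<bar>y - x\<bar> \<le> \<alpha> * t})"
    using poisson_ext_le[OF _ f] assms(1) by (intro bdd_aboveI[of _ B]) auto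
  then show ?thesis
    unfolding shifted_max_def using assms by (intro cSUP_upper2[of _ _ "(y, t)"]) auto
qed

lemma shifted_max_least:
  assumes "\<And>y t. 0 \<le> t \<Longrightarrow> \<bar>y - x\<bar> \<le> \<alpha> * t \<Longrightarrow> poisson_ext f y (t + s) \<le> m"
  shows "shifted_max \<alpha> f s x \<le> m"
  unfolding shifted_max_def
proof (rule cSUP_least)
  have "(x, 0) \<in> {(y, t). t \<ge> 0 \<and> \<bar>y - x\<bar> \<le> \<alpha> * t}" by simp
  then show "{(y, t). t \<ge> 0 \<and> \<bar>y - x\<bar> \<le> \<alpha> * t} \<noteq> {}" by blast
qed (use assms in auto)

lemma nt_max_upper:
  assumes "0 < t" "\<bar>y - x\<bar> \<le> \<alpha> * t"
  shows "poisson_ext f y t \<le> nt_max \<alpha> f x"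
proof -
  have "bdd_above ((\<lambda>yt. poisson_ext f (fst yt) (snd yt)) ` {(y, t). t > 0 \<and> \<bar>y - x\<bar> \<le> \<alpha> * t})"
    using poisson_ext_le[OF _ f] by (intro bdd_aboveI[of _ B]) auto
  then show ?thesis
    unfolding nt_max_def using assms by (intro cSUP_upper2[of _ _ "(y, t)"]) auto
qed

lemma nt_cone_nonempty: "{(y, t). t > 0 \<and> \<bar>y - x\<bar> \<le> \<alpha> * t} \<noteq> {}"
proof -
  have "(x, 1) \<in> {(y, t). t > 0 \<and> \<bar>y - x\<bar> \<le> \<alpha> * t}" using alpha by simp
  then show ?thesis by blast
qed

lemma nt_max_least:
  assumes "\<And>y t. 0 < t \<Longrightarrow> \<bar>y - x\<bar> \<le> \<alpha> * t \<Longrightarrow> poisson_ext f y t \<le> m"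
  shows "nt_max \<alpha> f x \<le> m"
  unfolding nt_max_def using assms by (intro cSUP_least nt_cone_nonempty) auto

lemma nt_max_bounds: "0 \<le> nt_max \<alpha> f x" "nt_max \<alpha> f x \<le> B"
  using nt_max_upper[of 1 x x] poisson_ext_nonneg[of 1 f x] nt_max_least[of x B] poisson_ext_le[OF _ f] alpha
  by auto

lemma shifted_max_bounds: "0 < s \<Longrightarrow> 0 \<le> shifted_max \<alpha> f s x" "0 < s \<Longrightarrow> shifted_max \<alpha> f s x \<le> B"
  using shifted_max_upper[of s 0 x x] poisson_ext_nonneg[of s f x] shifted_max_least[of x s B] poisson_ext_le[OF _ f]
  by auto

text \<open>Raising a point keeps it in the cone, so the shifted functions stay below the maximal
  function. Conversely each value on the cone is the limit of the values just above it, and these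
  compete in the shifted suprema.\<close>

lemma shifted_max_tendsto:
  "(\<lambda>n. shifted_max \<alpha> f (inverse (real (Suc n))) x) \<longlonglongrightarrow> nt_max \<alpha> f x"
proof (rule order_tendstoI)
  let ?s = "\<lambda>n. inverse (real (Suc n))"
  fix a assume "nt_max \<alpha> f x < a"
  have "shifted_max \<alpha> f (?s n) x \<le> nt_max \<alpha> f x" for n
  proof (rule shifted_max_least)
    fix y t assume "0 \<le> t" "\<bar>y - x\<bar> \<le> \<alpha> * t"
    then show "poisson_ext f y (t + ?s n) \<le> nt_max \<alpha> f x"
      using alpha by (intro nt_max_upper) (auto intro: add_nonneg_pos order_trans simp: distrib_left)
  qed
  with \<open>nt_max \<alpha> f x < a\<close> show "\<forall>\<^sub>F n in sequentially. shifted_max \<alpha> f (?s n) x < a"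
    by (intro always_eventually allI) (meson le_less_trans)
next
  let ?s = "\<lambda>n. inverse (real (Suc n))"
  fix a assume "a < nt_max \<alpha> f x"
  then obtain y t where yt: "0 < t" "\<bar>y - x\<bar> \<le> \<alpha> * t" "a < poisson_ext f y t"
    using nt_max_least[of x a] by (meson not_le)
  have "\<forall>\<^sub>F n in sequentially. a < poisson_ext f y (t + ?s n)"
    using poisson_ext_shift_tendsto[OF yt(1) f] yt(3) by (auto simp: order_tendsto_iff)
  then show "\<forall>\<^sub>F n in sequentially. a < shifted_max \<alpha> f (?s n) x"
  proof (rule eventually_mono)
    fix n assume "a < poisson_ext f y (t + ?s n)"
    also have "\<dots> \<le> shifted_max \<alpha> f (?s n) x"
      using yt by (intro shifted_max_upper) auto
    finally show "a < shifted_max \<alpha> f (?s n) x" .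
  qed
qed

text \<open>This provides the touching property for the shifted maximal function. A point of the
  cone over \<open>x\<close> is \<open>x + c * t\<close> with \<bar>c\<bar> \<le> \<alpha>; the
  parallel rays from \<open>p\<close> and \<open>q\<close> stay in the cones over \<open>p\<close>
  and \<open>q\<close>, so the values on the sides of the sheared strip are controlled by the
  maximal function at its end points. The bottom is controlled by a maximum point \<open>z\<close>
  of the continuous function \<open>poisson_ext f y s - k * y\<close>.\<close>

lemma shifted_max_touches:
  assumes s: "0 < s" and x: "p \<le> x" "x \<le> q"
  shows "shifted_max \<alpha> f s x - k * x \<le> shifted_max \<alpha> f s p - k * p \<or>
    shifted_max \<alpha> f s x - k * x \<le> shifted_max \<alpha> f s q - k * q \<or>
    (\<exists>z. p \<le> z \<and> z \<le> q \<and> shifted_max \<alpha> f s x - k * x \<le> poisson_ext f z s - k * z)"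
proof -
  have "\<exists>z\<in>{p..q}. \<forall>y\<in>{p..q}. poisson_ext f y s - k * y \<le> poisson_ext f z s - k * z"
    using x by (intro continuous_attains_sup continuous_intros continuous_poisson_ext[OF s f]) auto
  then obtain z where z: "p \<le> z" "z \<le> q" "\<And>y. p \<le> y \<Longrightarrow> y \<le> q \<Longrightarrow> poisson_ext f y s - k * y \<le> poisson_ext f z s - k * z"
    by auto
  define m where "m = max (max (shifted_max \<alpha> f s p - k * p) (shifted_max \<alpha> f s q - k * q)) (poisson_ext f z s - k * z)"
  have "shifted_max \<alpha> f s x \<le> m + k * x"
  proof (rule shifted_max_least)
    fix y t assume t: "0 \<le> t" and y: "\<bar>y - x\<bar> \<le> \<alpha> * t"
    \<comment> \<open>For \<open>t = 0\<close> the cone forces \<open>y = x\<close>, and division by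
      zero gives the fitting value \<open>c = 0\<close>.\<close>
    define c where "c = (y - x) / t"
    have yc: "y = x + c * t" using t y by (cases "t = 0") (auto simp: c_def)
    have c: "\<bar>c\<bar> \<le> \<alpha>" using t y alpha by (cases "t = 0") (auto simp: c_def divide_le_eq)
    have cone: "poisson_ext f (w + c * \<tau>) (\<tau> + s) \<le> shifted_max \<alpha> f s w" if "0 \<le> \<tau>" for w \<tau>
      using c that by (intro shifted_max_upper s) (auto simp: abs_mult intro: mult_right_mono)
    have "poisson_ext f (x + c * t) (t + s) - k * x \<le> m"
      using cone[of _ p] cone[of _ q] z(3)
      by (intro poisson_ext_max_principle[OF f s x t]) (fastforce simp: m_def max_def)+
    then show "poisson_ext f y (t + s) \<le> m + k * x" by (simp add: yc)
  qed
  then show ?thesis using z(1,2) by (auto simp: m_def max_def split: if_splits)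
qed

text \<open>The extension at height \<open>s\<close> is an average of translates of \<bar>f\<bar>
  with weights of total mass 1, and the excess of an interval is a convex function of the increment;
  this is Jensen's inequality interval by interval. Integrability is carried along because the
  induction adds integrals.\<close>

lemma excess_poisson_ext_le_average:
  assumes s: "0 < s" and k: "0 \<le> \<kappa>"
  shows "integrable lborel (\<lambda>z. poisson (0 - z) s * excess \<kappa> (\<lambda>x. \<bar>f (x + z)\<bar>) xs) \<and>
    excess \<kappa> (\<lambda>x. poisson_ext f x s) xs \<le> (LINT z|lborel. poisson (0 - z) s * excess \<kappa> (\<lambda>x. \<bar>f (x + z)\<bar>) xs)"
proof (induction \<kappa> "\<lambda>x. poisson_ext f x s" xs rule: excess.induct)
  case (1 \<kappa> x y xs)
  note [measurable] = f(1)
  have ext: "poisson_ext f w s = (LINT z|lborel. poisson (0 - z) s * \<bar>f (w + z)\<bar>)" for w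
    using lborel_integral_real_affine[of 1 "\<lambda>z. poisson (w - z) s * \<bar>f z\<bar>" w]
    by (simp add: poisson_ext_def)
  have i: "integrable lborel (\<lambda>z. poisson (0 - z) s * \<bar>f (w + z)\<bar>)" for w
    using f by (intro integrable_poisson_mult[OF s, where B = B]) auto
  define d where "d z = \<bar>f (y + z)\<bar> - \<bar>f (x + z)\<bar>" for z
  have dm [measurable]: "d \<in> borel_measurable borel" unfolding d_def by measurable
  have db: "\<bar>d z\<bar> \<le> 2 * B" for z
    using f(2)[of "y + z"] f(2)[of "x + z"] by (auto simp: d_def)
  let ?r = "\<kappa> * (y - x)"
  have im: "integrable lborel (\<lambda>z. poisson (0 - z) s * max 0 (\<bar>d z\<bar> - ?r))"
  proof (rule integrable_poisson_mult[OF s, where B = "2 * B + \<bar>?r\<bar>"])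
    show "\<bar>max 0 (\<bar>d z\<bar> - ?r)\<bar> \<le> 2 * B + \<bar>?r\<bar>" for z
      using db[of z] by (auto simp: max_def)
  qed measurable
  have D: "poisson_ext f y s - poisson_ext f x s = (LINT z|lborel. poisson (0 - z) s * d z)"
    unfolding ext d_def using i[of x] i[of y]
    by (subst Bochner_Integration.integral_diff[symmetric]) (simp_all add: algebra_simps)
  have "\<bar>LINT z|lborel. poisson (0 - z) s * d z\<bar> \<le> (LINT z|lborel. \<bar>poisson (0 - z) s * d z\<bar>)"
    by (rule integral_abs_bound)
  also have "\<dots> \<le> (LINT z|lborel. poisson (0 - z) s * max 0 (\<bar>d z\<bar> - ?r) + ?r * poisson (0 - z) s)"
  proof (rule integral_mono)
    show "integrable lborel (\<lambda>z. \<bar>poisson (0 - z) s * d z\<bar>)"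
      using db by (intro integrable_abs integrable_poisson_mult[OF s, where B = "2 * B"]) auto
    show "integrable lborel (\<lambda>z. poisson (0 - z) s * max 0 (\<bar>d z\<bar> - ?r) + ?r * poisson (0 - z) s)"
      using im integrable_poisson[OF s, of 0] by auto
    fix z
    have "poisson (0 - z) s * \<bar>d z\<bar> \<le> poisson (0 - z) s * (max 0 (\<bar>d z\<bar> - ?r) + ?r)"
      by (intro mult_left_mono poisson_nonneg s) auto
    then show "\<bar>poisson (0 - z) s * d z\<bar> \<le> poisson (0 - z) s * max 0 (\<bar>d z\<bar> - ?r) + ?r * poisson (0 - z) s"
      using poisson_nonneg[OF s, of "0 - z"] by (simp add: abs_mult algebra_simps)
  qed
  also have "\<dots> = (LINT z|lborel. poisson (0 - z) s * max 0 (\<bar>d z\<bar> - ?r)) + ?r"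
    using im integrable_poisson[OF s, of 0] integral_poisson[OF s, of 0]
    by (subst Bochner_Integration.integral_add) auto
  finally have M: "max 0 (\<bar>poisson_ext f y s - poisson_ext f x s\<bar> - ?r) \<le> (LINT z|lborel. poisson (0 - z) s * max 0 (\<bar>d z\<bar> - ?r))"
    unfolding D using poisson_nonneg[OF s]
    by (auto intro!: Bochner_Integration.integral_nonneg)
  then show ?case
    using 1 im add_mono[OF M conjunct2[OF 1]] by (simp add: distrib_left d_def)
qed (auto)

lemma excess_translate: "excess \<kappa> (\<lambda>x. h (x + z)) xs = excess \<kappa> h (map (\<lambda>x. x + z) xs)"
  by (induction \<kappa> h xs rule: excess.induct) auto

lemma excess_abs_le: "excess \<kappa> (\<lambda>x. \<bar>h x\<bar>) xs \<le> excess \<kappa> h xs"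
  by (induction \<kappa> h xs rule: excess.induct) (auto intro!: add_mono)

text \<open>A translate of a partition is again a partition, so \<open>E\<close> bounds every term
  of the average and hence the excess of the extension at each height. For a fixed list the excess
  depends continuously on finitely many values, so pointwise convergence of the shifted functions
  suffices to reach the maximal function.\<close>

lemma excess_nt_max_le:
  assumes k: "0 < \<kappa>" and E: "\<And>ys. sorted ys \<Longrightarrow> excess \<kappa> f ys \<le> E" and xs: "sorted xs"
  shows "excess \<kappa> (nt_max \<alpha> f) xs \<le> E"
proof -
  have U: "excess \<kappa> (\<lambda>x. poisson_ext f x s) ys \<le> E" if s: "0 < s" and ys: "sorted ys" for s ys
  proof -
    have "excess \<kappa> (\<lambda>x. poisson_ext f x s) ys \<le> (LINT z|lborel. poisson (0 - z) s * excess \<kappa> (\<lambda>x. \<bar>f (x + z)\<bar>) ys)"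
      using excess_poisson_ext_le_average[OF s, of \<kappa> ys] k by simp
    also have "\<dots> \<le> (LINT z|lborel. E * poisson (0 - z) s)"
    proof (rule integral_mono)
      show "integrable lborel (\<lambda>z. poisson (0 - z) s * excess \<kappa> (\<lambda>x. \<bar>f (x + z)\<bar>) ys)"
        using excess_poisson_ext_le_average[OF s, of \<kappa> ys] k by simp
      show "integrable lborel (\<lambda>z. E * poisson (0 - z) s)"
        using integrable_poisson[OF s, of 0] by auto
      fix z
      have "excess \<kappa> (\<lambda>x. \<bar>f (x + z)\<bar>) ys \<le> excess \<kappa> f (map (\<lambda>x. x + z) ys)"
        using excess_translate[of \<kappa> "\<lambda>x. \<bar>f x\<bar>" z ys] excess_abs_le by metis
      also have "\<dots> \<le> E"
        using ys by (intro E) (auto simp: sorted_map intro: sorted_wrt_mono_rel)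
      finally show "poisson (0 - z) s * excess \<kappa> (\<lambda>x. \<bar>f (x + z)\<bar>) ys \<le> E * poisson (0 - z) s"
        using poisson_nonneg[OF s, of "0 - z"] by (metis mult.commute mult_left_mono)
    qed
    also have "\<dots> = E" using integral_poisson[OF s, of 0] by simp
    finally show ?thesis .
  qed
  have S: "excess \<kappa> (shifted_max \<alpha> f s) xs \<le> E" if s: "0 < s" for s
  proof (rule excess_majorant_le[where U = "\<lambda>x. poisson_ext f x s" and B = B])
    show "poisson_ext f x s \<le> shifted_max \<alpha> f s x" for x
      using shifted_max_upper[of s 0 x x] s by simp
    show "\<bar>shifted_max \<alpha> f s x\<bar> \<le> B" for x using shifted_max_bounds[OF s, of x] by simp
  qed (use k xs s U shifted_max_touches in auto)
  have "(\<lambda>n. excess \<kappa> (shifted_max \<alpha> f (inverse (real (Suc n)))) xs) \<longlonglongrightarrow> excess \<kappa> (nt_max \<alpha> f) xs"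
    by (induction \<kappa> "nt_max \<alpha> f" xs rule: excess.induct) (auto intro!: tendsto_intros shifted_max_tendsto simp del: of_nat_Suc)
  then show ?thesis
    by (rule LIMSEQ_le_const2) (intro exI[of _ 0] allI impI S, simp)
qed

end

section \<open>Densities from small excess\<close>

lemma excess_append: "excess \<kappa> f (as @ x # bs) = excess \<kappa> f (as @ [x]) + excess \<kappa> f (x # bs)"
  by (induction \<kappa> f as rule: excess.induct) (auto simp: neq_Nil_conv)

lemma excess_insert: "excess \<kappa> f (as @ bs) \<le> excess \<kappa> f (as @ x # bs)"
proof (induction as)
  case Nil
  show ?case by (cases bs) auto
next
  case (Cons a as)
  show ?case
  proof (cases as)
    case Nil
    show ?thesis
    proof (cases bs)
      case (Cons b bs')
      have "max 0 (\<bar>f b - f a\<bar> - \<kappa> * (b - a)) \<le> max 0 (\<bar>f x - f a\<bar> - \<kappa> * (x - a)) + max 0 (\<bar>f b - f x\<bar> - \<kappa> * (b - x))"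
        by (auto simp: max_def algebra_simps)
      then show ?thesis by (simp add: Nil Cons)
    qed (simp add: Nil)
  qed (use Cons in simp)
qed

lemma excess_snoc: "excess \<kappa> f as \<le> excess \<kappa> f (as @ [x])"
  using excess_insert[of \<kappa> f as "[]" x] by simp

text \<open>Each interval gains at most \<open>\<mu> - \<kappa>\<close> times its length, and the
  lengths telescope. This one estimate yields both the limit of vanishing slope and absolute
  continuity.\<close>

lemma excess_change_slope:
  assumes "\<kappa> \<le> \<mu>" "sorted (x # xs)"
  shows "excess \<kappa> f (x # xs) \<le> excess \<mu> f (x # xs) + (\<mu> - \<kappa>) * (last (x # xs) - x)"
  using assms(2)
proof (induction xs arbitrary: x)
  case (Cons y xs)
  then have IH: "excess \<kappa> f (y # xs) \<le> excess \<mu> f (y # xs) + (\<mu> - \<kappa>) * (last (y # xs) - y)" by auto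
  have "0 \<le> (\<mu> - \<kappa>) * (y - x)" using assms(1) Cons.prems by simp
  then have "max 0 (\<bar>f y - f x\<bar> - \<kappa> * (y - x)) \<le> max 0 (\<bar>f y - f x\<bar> - \<mu> * (y - x)) + (\<mu> - \<kappa>) * (y - x)"
    by (auto simp: max_def algebra_simps)
  then show ?case using IH by (simp add: algebra_simps split: if_splits)
qed simp

lemma excess_antimono: "\<kappa> \<le> \<mu> \<Longrightarrow> sorted xs \<Longrightarrow> excess \<mu> f xs \<le> excess \<kappa> f xs"
  by (induction \<kappa> f xs rule: excess.induct) (auto intro!: add_mono max.mono diff_left_mono mult_right_mono)

text \<open>The counterpart of the variation function of a function of bounded variation: the excess
  carried by the half-line up to \<open>x\<close>.\<close>

definition excess_upto :: "real \<Rightarrow> (real \<Rightarrow> real) \<Rightarrow> real \<Rightarrow> real" where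
  "excess_upto \<kappa> f x = (SUP xs \<in> {xs. sorted xs \<and> (\<forall>y \<in> set xs. y \<le> x)}. excess \<kappa> f xs)"

lemma excess_le_upto:
  assumes "\<And>ys. sorted ys \<Longrightarrow> excess \<kappa> f ys \<le> E" "sorted xs" "\<And>y. y \<in> set xs \<Longrightarrow> y \<le> x"
  shows "excess \<kappa> f xs \<le> excess_upto \<kappa> f x"
  unfolding excess_upto_def using assms by (intro cSUP_upper bdd_aboveI[of _ E]) auto

lemma excess_upto_least:
  assumes "\<And>ys. sorted ys \<Longrightarrow> (\<And>y. y \<in> set ys \<Longrightarrow> y \<le> x) \<Longrightarrow> excess \<kappa> f ys \<le> m"
  shows "excess_upto \<kappa> f x \<le> m"
proof -
  have "[] \<in> {xs. sorted xs \<and> (\<forall>y \<in> set xs. y \<le> x)}" by simp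
  then show ?thesis unfolding excess_upto_def using assms by (intro cSUP_least) blast+
qed

lemma excess_upto_bounds:
  assumes "\<And>ys. sorted ys \<Longrightarrow> excess \<kappa> f ys \<le> E"
  shows "0 \<le> excess_upto \<kappa> f x" "excess_upto \<kappa> f x \<le> E"
  using excess_le_upto[OF assms, of "[]" x] excess_upto_least[of x \<kappa> f E] assms by auto

lemma excess_upto_increment:
  assumes E: "\<And>ys. sorted ys \<Longrightarrow> excess \<kappa> f ys \<le> E" and xy: "x \<le> y"
  shows "excess_upto \<kappa> f x + max 0 (\<bar>f y - f x\<bar> - \<kappa> * (y - x)) \<le> excess_upto \<kappa> f y"
proof -
  let ?T = "excess_upto \<kappa> f" and ?M = "max 0 (\<bar>f y - f x\<bar> - \<kappa> * (y - x))"
  have "?T x \<le> ?T y - ?M"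
  proof (rule excess_upto_least)
    fix ys assume ys: "sorted ys" "\<And>z. z \<in> set ys \<Longrightarrow> z \<le> x"
    have "excess \<kappa> f (ys @ [x, y]) \<le> ?T y"
    proof (rule excess_le_upto[OF E])
      show "sorted (ys @ [x, y])" using ys xy by (auto simp: sorted_append intro: order_trans)
      show "z \<le> y" if "z \<in> set (ys @ [x, y])" for z using that ys(2)[of z] xy by auto
    qed
    then show "excess \<kappa> f ys \<le> ?T y - ?M"
      using excess_append[of \<kappa> f ys x "[y]"] excess_snoc[of \<kappa> f ys x] by simp
  qed
  then show ?thesis by simp
qed

lemma excess_upto_mono:
  assumes "\<And>ys. sorted ys \<Longrightarrow> excess \<kappa> f ys \<le> E" "x \<le> y"
  shows "excess_upto \<kappa> f x \<le> excess_upto \<kappa> f y"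
  using excess_upto_increment[OF assms] by simp

text \<open>Cutting a partition at \<open>x\<close> leaves a left part counted by
  \<open>excess_upto \<kappa> f x\<close> and a right part inside the interval from \<open>x\<close>
  to \<open>y\<close>, to which the change of slope applies. Its use is that the right-hand side
  splits into an increment of a function of small total increase and a Lipschitz term.\<close>

lemma excess_upto_change_slope:
  assumes E: "\<And>ys. sorted ys \<Longrightarrow> excess \<kappa> f ys \<le> E" and E': "\<And>ys. sorted ys \<Longrightarrow> excess \<mu> f ys \<le> E'"
    and k: "\<kappa> \<le> \<mu>" and xy: "x \<le> y"
  shows "excess_upto \<kappa> f y - excess_upto \<kappa> f x \<le> excess_upto \<mu> f y - excess_upto \<mu> f x + (\<mu> - \<kappa>) * (y - x)"
proof -
  let ?T = "excess_upto \<kappa> f" and ?T' = "excess_upto \<mu> f"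
  have "?T y \<le> ?T x + (?T' y - ?T' x + (\<mu> - \<kappa>) * (y - x))"
  proof (rule excess_upto_least)
    fix xs assume xs: "sorted xs" "\<And>z. z \<in> set xs \<Longrightarrow> z \<le> y"
    define as where "as = takeWhile (\<lambda>z. z \<le> x) xs"
    define bs where "bs = dropWhile (\<lambda>z. z \<le> x) xs"
    have eq: "xs = as @ bs" by (simp add: as_def bs_def)
    have "sorted as" and sb: "sorted bs" using xs(1) unfolding eq sorted_append by auto
    moreover have "z \<le> x" if "z \<in> set as" for z using that set_takeWhileD unfolding as_def by fast
    ultimately have as: "sorted as" "\<And>z. z \<in> set as \<Longrightarrow> z \<le> x" by auto
    have bs: "z > x" if "z \<in> set bs" for z
    proof (cases bs)
      case (Cons b bs')
      then have "\<not> b \<le> x" by (metis bs_def hd_dropWhile list.distinct(1) list.sel(1))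
      then show ?thesis using sb that Cons by auto
    qed (use that in simp)
    have bsy: "z \<le> y" if "z \<in> set bs" for z using that xs(2) eq by simp
    have sxb: "sorted (x # bs)" using sb bs by (auto intro: less_imp_le)
    have "excess \<kappa> f xs \<le> excess \<kappa> f (as @ [x]) + excess \<kappa> f (x # bs)"
      using excess_insert[of \<kappa> f as bs x] excess_append[of \<kappa> f as x bs] by (simp add: eq)
    also have "excess \<kappa> f (as @ [x]) \<le> ?T x"
      using as by (intro excess_le_upto[OF E]) (auto simp: sorted_append)
    also have "excess \<kappa> f (x # bs) \<le> excess \<mu> f (x # bs) + (\<mu> - \<kappa>) * (last (x # bs) - x)"
      by (rule excess_change_slope[OF k sxb])
    also have "(\<mu> - \<kappa>) * (last (x # bs) - x) \<le> (\<mu> - \<kappa>) * (y - x)"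
      using k xy bsy by (intro mult_left_mono) (auto dest: last_in_set)
    also have "excess \<mu> f (x # bs) \<le> ?T' y - ?T' x"
    proof -
      have "?T' x \<le> ?T' y - excess \<mu> f (x # bs)"
      proof (rule excess_upto_least)
        fix cs assume cs: "sorted cs" "\<And>z. z \<in> set cs \<Longrightarrow> z \<le> x"
        have "excess \<mu> f (cs @ x # bs) \<le> ?T' y"
        proof (rule excess_le_upto[OF E'])
          show "sorted (cs @ x # bs)" using cs sxb by (auto simp: sorted_append intro: order_trans)
          show "z \<le> y" if "z \<in> set (cs @ x # bs)" for z using that cs(2)[of z] bsy[of z] xy by auto
        qed
        then show "excess \<mu> f cs \<le> ?T' y - excess \<mu> f (x # bs)"
          using excess_append[of \<mu> f cs x bs] excess_snoc[of \<mu> f cs x] by simp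
      qed
      then show ?thesis by simp
    qed
    finally show "excess \<kappa> f xs \<le> ?T x + (?T' y - ?T' x + (\<mu> - \<kappa>) * (y - x))"
      by simp
  qed
  then show ?thesis by simp
qed

section \<open>Measures determined by half-open intervals\<close>

lemma UN_Ioc_eq_UNIV: "(\<Union>n. {- real n<..real n}) = UNIV"
proof -
  have "\<exists>n. x \<in> {- real n<..real n}" for x
  proof -
    obtain n where "\<bar>x\<bar> < real n" using reals_Archimedean2 by blast
    then show ?thesis by (intro exI[of _ n]) auto
  qed
  then show ?thesis by blast
qed

lemma Ioc_measure_eqI:
  fixes M N :: "real measure"
  assumes "sets M = sets borel" "sets N = sets borel"
    and eq: "\<And>a b. a \<le> b \<Longrightarrow> emeasure M {a<..b} = emeasure N {a<..b}"
    and fin: "\<And>a b. a \<le> b \<Longrightarrow> emeasure M {a<..b} \<noteq> \<infinity>"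
  shows "M = N"
proof (rule measure_eqI_generator_eq[where E = "range (\<lambda>(a, b). {a<..b::real})" and A = "\<lambda>i. {- real i<..real i}" and \<Omega> = UNIV])
  show "Int_stable (range (\<lambda>(a, b). {a<..b::real}))"
  proof (rule Int_stableI)
    fix A B assume "A \<in> range (\<lambda>(a, b). {a<..b::real})" "B \<in> range (\<lambda>(a, b). {a<..b::real})"
    then obtain a b c d where "A = {a<..b}" "B = {c<..d}" by auto
    then have "A \<inter> B = (\<lambda>(a, b). {a<..b}) (max a c, min b d)" by auto
    then show "A \<inter> B \<in> range (\<lambda>(a, b). {a<..b::real})" by (rule range_eqI)
  qed
  have "sets (borel :: real measure) = sigma_sets UNIV (range (\<lambda>(a, b). {a<..b}))"
    by (subst borel_sigma_sets_Ioc) (simp add: sets_measure_of)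
  then show "sets M = sigma_sets UNIV (range (\<lambda>(a, b). {a<..b}))" "sets N = sigma_sets UNIV (range (\<lambda>(a, b). {a<..b}))"
    using assms(1,2) by simp_all
  show "emeasure M X = emeasure N X" if X: "X \<in> range (\<lambda>(a, b). {a<..b})" for X
  proof -
    obtain a b where X: "X = {a<..b}" using X by auto
    show ?thesis using eq[of a b] by (cases "a \<le> b") (auto simp: X)
  qed
  show "(\<Union>i. {- real i<..real i}) = UNIV" by (rule UN_Ioc_eq_UNIV)
qed (use fin in auto)

text \<open>Comparisons of measures are made by writing the larger one as a sum, which avoids
  subtraction. The sum is built as a measure of its own so that uniqueness on half-open intervals
  applies.\<close>

lemma emeasure_sum_eqI:
  fixes L M N :: "real measure"
  assumes sets: "sets L = sets borel" "sets M = sets borel" "sets N = sets borel"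
    and eq: "\<And>a b. a \<le> b \<Longrightarrow> emeasure L {a<..b} = emeasure M {a<..b} + emeasure N {a<..b}"
    and fin: "\<And>a b. a \<le> b \<Longrightarrow> emeasure L {a<..b} \<noteq> \<infinity>"
    and A: "A \<in> sets borel"
  shows "emeasure L A = emeasure M A + emeasure N A"
proof -
  define S where "S = measure_of UNIV (sets borel) (\<lambda>A. emeasure M A + emeasure N A)"
  have sS: "sets S = sets borel"
    using sets.sigma_sets_eq[of "borel :: real measure"] by (simp add: S_def)
  have eS: "emeasure S X = emeasure M X + emeasure N X" if "X \<in> sets borel" for X
    unfolding S_def
  proof (rule emeasure_measure_of_sigma)
    show "sigma_algebra UNIV (sets (borel :: real measure))"
      using sets.sigma_algebra_axioms[of "borel :: real measure"] by simp
    show "countably_additive (sets borel) (\<lambda>A. emeasure M A + emeasure N A)"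
    proof (rule countably_additiveI)
      fix X :: "nat \<Rightarrow> real set" assume X: "range X \<subseteq> sets borel" "disjoint_family X"
      show "(\<Sum>i. emeasure M (X i) + emeasure N (X i)) = emeasure M (\<Union> (range X)) + emeasure N (\<Union> (range X))"
        using X sets by (subst suminf_add[symmetric]) (auto simp: suminf_emeasure)
    qed
  qed (use that in \<open>auto simp: positive_def\<close>)
  have "L = S"
  proof (rule Ioc_measure_eqI)
    show "emeasure L {a<..b} \<noteq> \<infinity>" if "a \<le> b" for a b using fin[OF that] .
    show "emeasure L {a<..b} = emeasure S {a<..b}" if "a \<le> b" for a b using eq[OF that] eS by simp
  qed (simp_all add: sS sets)
  then show ?thesis using eS[OF A] by simp
qed

lemma emeasure_interval_measure:
  fixes F :: "real \<Rightarrow> real"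
  assumes "\<And>x y. x \<le> y \<Longrightarrow> F x \<le> F y" "\<And>x. isCont F x" "a \<le> b"
  shows "emeasure (interval_measure F) {a<..b} = ennreal (F b - F a)"
  using assms by (intro emeasure_interval_measure_Ioc) (auto intro: continuous_at_imp_continuous_at_within)

text \<open>Local absolute continuity in integrated form. Half-open intervals are chosen to match
  \<open>interval_measure\<close> and to be additive without overlap.\<close>

definition primitive_of :: "(real \<Rightarrow> real) \<Rightarrow> (real \<Rightarrow> real) \<Rightarrow> bool" where
  "primitive_of g G \<longleftrightarrow> g \<in> borel_measurable borel \<and>
     (\<forall>x y. x \<le> y \<longrightarrow> set_integrable lborel {x<..y} g \<and> (LINT z:{x<..y}|lborel. g z) = G y - G x)"

lemma primitive_ofD:
  assumes "primitive_of g G"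
  shows "g \<in> borel_measurable borel" "x \<le> y \<Longrightarrow> set_integrable lborel {x<..y} g"
    "x \<le> y \<Longrightarrow> (LINT z:{x<..y}|lborel. g z) = G y - G x"
  using assms by (auto simp: primitive_of_def)

lemma integrable_indicator_Ioc [simp]: "integrable lborel (indicator {a<..b} :: real \<Rightarrow> real)" for a b :: real
  by (cases "a \<le> b") (auto intro!: integrable_real_indicator)

lemma primitive_of_const: "primitive_of (\<lambda>_. c) (\<lambda>x. c * x)"
  by (auto simp: primitive_of_def set_integrable_def set_lebesgue_integral_def algebra_simps)

lemma primitive_of_add:
  assumes "primitive_of g G" "primitive_of h H"
  shows "primitive_of (\<lambda>x. g x + h x) (\<lambda>x. G x + H x)"
  using assms by (auto simp: primitive_of_def set_integral_add)

lemma primitive_of_cmult: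
  assumes "primitive_of g G"
  shows "primitive_of (\<lambda>x. c * g x) (\<lambda>x. c * G x)"
  using assms by (auto simp: primitive_of_def simp flip: right_diff_distrib)

text \<open>\<open>ennreal\<close> cuts off negative values, so \<open>P\<close> and
  \<open>N\<close> are the measures of the positive and the negative part of \<open>h\<close>. On
  intervals, hence on all Borel sets, \<open>P\<close> is the sum of \<open>N\<close> and the
  measure of the increasing \<open>F\<close>. On the set where \<open>h\<close> is negative
  \<open>P\<close> vanishes, so \<open>N\<close> does too.\<close>

lemma AE_nonneg_of_mono_primitive:
  fixes F h :: "real \<Rightarrow> real"
  assumes F: "\<And>x y. x \<le> y \<Longrightarrow> F x \<le> F y" "\<And>x. isCont F x"
    and h: "primitive_of h F"
  shows "AE x in lborel. 0 \<le> h x"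
proof -
  let ?I = "\<lambda>s x y. LINT z|lborel. max 0 (s * h z) * indicator {x<..y} z"
  note [measurable] = primitive_ofD(1)[OF h]
  define P where "P = density lborel (\<lambda>x. ennreal (h x))"
  define N where "N = density lborel (\<lambda>x. ennreal (- h x))"
  have i: "integrable lborel (\<lambda>z. max 0 (s * h z) * indicator {x<..y} z)" if "x \<le> y" "s \<in> {1, - 1}" for x y s
  proof (rule Bochner_Integration.integrable_bound)
    show "integrable lborel (\<lambda>z. indicator {x<..y} z * h z)"
      using primitive_ofD(2)[OF h that(1)] by (simp add: set_integrable_def)
    show "AE z in lborel. norm (max 0 (s * h z) * indicator {x<..y} z) \<le> norm (indicator {x<..y} z * h z)"
      using that(2) by (intro AE_I2) (auto simp: indicator_def)
  qed measurable
  have e: "(\<integral>\<^sup>+z. ennreal (s * h z) * indicator {x<..y} z \<partial>lborel) = ennreal (?I s x y)"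
    if "x \<le> y" "s \<in> {1, - 1}" for x y s
  proof -
    have "(\<integral>\<^sup>+z. ennreal (s * h z) * indicator {x<..y} z \<partial>lborel) = (\<integral>\<^sup>+z. ennreal (max 0 (s * h z) * indicator {x<..y} z) \<partial>lborel)"
      by (intro nn_integral_cong) (auto simp: indicator_def max_def ennreal_neg)
    also have "\<dots> = ennreal (?I s x y)"
      using i[OF that] by (intro nn_integral_eq_integral) auto
    finally show ?thesis .
  qed
  have eP: "emeasure P {x<..y} = ennreal (?I 1 x y)" if "x \<le> y" for x y
    unfolding P_def using e[OF that, of 1] by (subst emeasure_density) auto
  have eN: "emeasure N {x<..y} = ennreal (?I (- 1) x y)" if "x \<le> y" for x y
    unfolding N_def using e[OF that, of "- 1"] by (subst emeasure_density) auto
  have d: "?I 1 x y - ?I (- 1) x y = F y - F x"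
    if "x \<le> y" for x y
  proof -
    have "?I 1 x y - ?I (- 1) x y
       = (LINT z:{x<..y}|lborel. h z)"
      unfolding set_lebesgue_integral_def using i[OF that, of 1] i[OF that, of "- 1"]
      apply (subst Bochner_Integration.integral_diff[symmetric], simp, simp)
      by (intro Bochner_Integration.integral_cong) (auto simp: indicator_def)
    then show ?thesis by (simp add: primitive_ofD(3)[OF h that])
  qed
  have "emeasure P {x. h x < 0} = emeasure N {x. h x < 0} + emeasure (interval_measure F) {x. h x < 0}"
  proof (rule emeasure_sum_eqI)
    fix a b :: real assume ab: "a \<le> b"
    have "0 \<le> ?I (- 1) a b" by simp
    moreover have "emeasure (interval_measure F) {a<..b} = ennreal (F b - F a)"
      using F ab by (rule emeasure_interval_measure)
    moreover have "?I 1 a b = ?I (- 1) a b + (F b - F a)"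
      using d[OF ab] by simp
    ultimately show "emeasure P {a<..b} = emeasure N {a<..b} + emeasure (interval_measure F) {a<..b}"
      using F(1)[OF ab] unfolding eP[OF ab] eN[OF ab] by (simp only: ennreal_plus diff_ge_0_iff_ge)
    show "emeasure P {a<..b} \<noteq> \<infinity>" using eP[OF ab] by simp
  qed (auto simp: P_def N_def)
  then have "emeasure N {x. h x < 0} \<le> emeasure P {x. h x < 0}" by simp
  also have "\<dots> = 0"
    unfolding P_def by (subst emeasure_density) (auto simp: nn_integral_0_iff_AE indicator_def ennreal_neg)
  finally have "(\<integral>\<^sup>+z. ennreal (- h z) * indicator {x. h x < 0} z \<partial>lborel) = 0"
    unfolding N_def by (subst (asm) emeasure_density) auto
  then have "AE z in lborel. ennreal (- h z) * indicator {x. h x < 0} z = 0"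
    by (subst (asm) nn_integral_0_iff_AE) auto
  then show ?thesis
    by eventually_elim (auto simp: indicator_def ennreal_eq_0_iff split: if_splits)
qed

lemma isCont_of_increment_bound:
  fixes F :: "real \<Rightarrow> real"
  assumes dom: "\<And>e. 0 < e \<Longrightarrow> \<exists>L\<ge>0. \<forall>x y. x \<le> y \<longrightarrow> \<bar>F y - F x\<bar> \<le> e + L * (y - x)"
  shows "isCont F x"
  unfolding continuous_at_eps_delta
proof (intro allI impI)
  fix e :: real assume e: "0 < e"
  then obtain L where L: "0 \<le> L" "\<And>x y. x \<le> y \<Longrightarrow> \<bar>F y - F x\<bar> \<le> e / 2 + L * (y - x)"
    using dom[of "e / 2"] by auto
  define d where "d = e / (2 * (L + 1))"
  have *: "\<bar>F y - F x\<bar> < e" if "\<bar>y - x\<bar> < d" for y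
  proof -
    have "\<bar>F y - F x\<bar> \<le> e / 2 + L * \<bar>y - x\<bar>"
      using L(2)[of x y] L(2)[of y x] by (cases "x \<le> y") auto
    also have "L * \<bar>y - x\<bar> \<le> L * d"
      using that L(1) by (intro mult_left_mono) auto
    also have "\<dots> < e / 2"
      using L(1) e by (simp add: d_def field_simps)
    finally show ?thesis by simp
  qed
  have "0 < d" using L(1) e by (simp add: d_def)
  then show "\<exists>d>0. \<forall>x'. dist x' x < d \<longrightarrow> dist (F x') (F x) < e"
    by (intro exI[of _ d]) (simp add: dist_real_def *)
qed

text \<open>Because of the truncation in \<open>ennreal\<close> this is the integral of the positive
  part of \<open>\<bar>g\<bar> - t\<close>.\<close>

abbreviation tail_integral :: "(real \<Rightarrow> real) \<Rightarrow> real \<Rightarrow> ennreal" where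
  "tail_integral g t \<equiv> \<integral>\<^sup>+x. ennreal (\<bar>g x\<bar> - t) \<partial>lborel"

text \<open>
  The hypothesis bounds the measure of \<open>F\<close> by \<open>e\<close> plus a multiple of Lebesgue measure for every \<open>e\<close>,
  which makes it absolutely continuous.
\<close>

lemma absolutely_continuous_density:
  fixes F :: "real \<Rightarrow> real"
  assumes mono: "\<And>x y. x \<le> y \<Longrightarrow> F x \<le> F y"
    and dom: "\<And>e. 0 < e \<Longrightarrow> \<exists>G L. (\<forall>x y. x \<le> y \<longrightarrow> G x \<le> G y \<and> G y - G x \<le> e) \<and> (\<forall>x. isCont G x) \<and> 0 \<le> L \<and>
      (\<forall>x y. x \<le> y \<longrightarrow> F y - F x \<le> G y - G x + L * (y - x))"
  obtains h where "primitive_of h F" "\<And>x. 0 \<le> h x"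
proof -
  have contF: "isCont F x" for x
  proof (rule isCont_of_increment_bound)
    fix e :: real assume e: "0 < e"
    obtain G L where GL: "\<forall>x y. x \<le> y \<longrightarrow> G x \<le> G y \<and> G y - G x \<le> e" "\<forall>x. isCont G x" "0 \<le> L"
      "\<forall>x y. x \<le> y \<longrightarrow> F y - F x \<le> G y - G x + L * (y - x)"
      using dom[OF e] by (elim exE conjE) (rule that)
    have "\<bar>F y - F x\<bar> \<le> e + L * (y - x)" if "x \<le> y" for x y
      using GL(1)[rule_format, OF that] GL(4)[rule_format, OF that] mono[OF that] by simp
    then show "\<exists>L\<ge>0. \<forall>x y. x \<le> y \<longrightarrow> \<bar>F y - F x\<bar> \<le> e + L * (y - x)"
      using GL(3) by (intro exI[of _ L]) simp
  qed
  let ?N = "interval_measure F"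
  have eF: "emeasure ?N {a<..b} = ennreal (F b - F a)" if "a \<le> b" for a b
    using mono contF that by (rule emeasure_interval_measure)
  have "emeasure ?N A = 0" if A: "A \<in> null_sets lborel" for A
  proof -
    have Ab: "A \<in> sets borel" "emeasure lborel A = 0" using A by auto
    have small: "emeasure ?N A \<le> ennreal e" if e: "0 < e" for e
    proof -
      obtain G L where GL0: "\<forall>x y. x \<le> y \<longrightarrow> G x \<le> G y \<and> G y - G x \<le> e" "\<forall>x. isCont G x" "0 \<le> L"
        "\<forall>x y. x \<le> y \<longrightarrow> F y - F x \<le> G y - G x + L * (y - x)"
        using dom[OF e] by (elim exE conjE) (rule that)
      have GL: "\<And>x y. x \<le> y \<Longrightarrow> G x \<le> G y" "\<And>x y. x \<le> y \<Longrightarrow> G y - G x \<le> e" "\<And>x. isCont G x" "0 \<le> L"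
        "\<And>x y. x \<le> y \<Longrightarrow> F y - F x \<le> G y - G x + L * (y - x)"
        using GL0 by simp_all
      \<comment> \<open>The domination hypothesis says exactly that \<open>D\<close> is increasing.
        The measure of \<open>F + D = G + L * x\<close> is computed in two ways: on the null set
        \<open>A\<close> the Lebesgue term vanishes, which leaves the measure of \<open>G\<close>,
        of total mass at most \<open>e\<close>.\<close>
      define D where "D x = G x + L * x - F x" for x
      have D: "\<And>x y. x \<le> y \<Longrightarrow> D x \<le> D y" using GL(5) by (fastforce simp: D_def algebra_simps)
      have contD: "isCont D x" for x unfolding D_def by (intro continuous_intros GL contF)
      define S where "S x = G x + L * x" for x
      have S: "\<And>x y. x \<le> y \<Longrightarrow> S x \<le> S y" using GL(1,4) by (auto simp: S_def intro!: add_mono mult_left_mono)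
      have contS: "isCont S x" for x unfolding S_def by (intro continuous_intros GL)
      have eS: "emeasure (interval_measure S) {a<..b} = ennreal (S b - S a)" if "a \<le> b" for a b
        using S contS that by (rule emeasure_interval_measure)
      have eD: "emeasure (interval_measure D) {a<..b} = ennreal (D b - D a)" if "a \<le> b" for a b
        using D contD that by (rule emeasure_interval_measure)
      have eG: "emeasure (interval_measure G) {a<..b} = ennreal (G b - G a)" if "a \<le> b" for a b
        using GL(1,3) that by (rule emeasure_interval_measure)
      have 1: "emeasure (interval_measure S) A = emeasure ?N A + emeasure (interval_measure D) A"
      proof (rule emeasure_sum_eqI)
        fix a b :: real assume ab: "a \<le> b"
        have "S b - S a = (F b - F a) + (D b - D a)" by (simp add: S_def D_def)
        then show "emeasure (interval_measure S) {a<..b} = emeasure ?N {a<..b} + emeasure (interval_measure D) {a<..b}"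
          unfolding eS[OF ab] eF[OF ab] eD[OF ab]
          using mono[OF ab] D[OF ab] by (simp only: ennreal_plus diff_ge_0_iff_ge)
        show "emeasure (interval_measure S) {a<..b} \<noteq> \<infinity>"
          unfolding eS[OF ab] by simp
      qed (use Ab in auto)
      have 2: "emeasure (interval_measure S) A = emeasure (interval_measure G) A + emeasure (density lborel (\<lambda>_. ennreal L)) A"
      proof (rule emeasure_sum_eqI)
        fix a b :: real assume ab: "a \<le> b"
        have "S b - S a = (G b - G a) + L * (b - a)" by (simp add: S_def algebra_simps)
        moreover have "emeasure (density lborel (\<lambda>_. ennreal L)) {a<..b} = ennreal (L * (b - a))"
          using ab GL(4) by (subst emeasure_density) (auto simp: nn_integral_cmult_indicator ennreal_mult)
        ultimately show "emeasure (interval_measure S) {a<..b} = emeasure (interval_measure G) {a<..b} + emeasure (density lborel (\<lambda>_. ennreal L)) {a<..b}"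
          unfolding eS[OF ab] eG[OF ab]
          using GL(1)[OF ab] GL(4) ab by (simp only: ennreal_plus diff_ge_0_iff_ge mult_nonneg_nonneg)
        show "emeasure (interval_measure S) {a<..b} \<noteq> \<infinity>"
          unfolding eS[OF ab] by simp
      qed (use Ab in auto)
      have 3: "emeasure (density lborel (\<lambda>_. ennreal L)) A = 0"
        using Ab by (subst emeasure_density) (auto simp: nn_integral_cmult_indicator)
      have "emeasure ?N A \<le> emeasure (interval_measure G) A" using 1 2 3 by simp
      also have "\<dots> \<le> emeasure (interval_measure G) (\<Union>n. {- real n<..real n})"
        using UN_Ioc_eq_UNIV by (intro emeasure_mono) auto
      also have "\<dots> = (SUP n. emeasure (interval_measure G) {- real n<..real n})"
        by (rule SUP_emeasure_incseq[symmetric]) (auto simp: incseq_def)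
      also have "\<dots> \<le> ennreal e"
      proof (rule SUP_least)
        fix n show "emeasure (interval_measure G) {- real n<..real n} \<le> ennreal e"
          using eG[of "- real n" "real n"] GL(2)[of "- real n" "real n"]
          by (simp add: ennreal_leI)
      qed
      finally show ?thesis .
    qed
    have "emeasure ?N A \<le> 0"
    proof (rule ennreal_le_epsilon)
      show "emeasure ?N A \<le> 0 + ennreal e" if "0 < e" for e using small[OF that] by simp
    qed
    then show ?thesis by simp
  qed
  then have ac: "absolutely_continuous lborel ?N"
    unfolding absolutely_continuous_def by (auto simp: null_sets_def)
  then obtain d where d: "d \<in> borel_measurable lborel" "density lborel d = ?N"
    using sigma_finite_measure.Radon_Nikodym[OF sigma_finite_lborel ac] by auto
  \<comment> \<open>The Radon-Nikodym density is extended-valued; sigma-finiteness makes it finite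
    almost everywhere, so passing to reals loses only a null set.\<close>
  have fin: "AE x in lborel. d x \<noteq> \<infinity>"
  proof -
    have "sigma_finite_measure ?N"
      by (rule sigma_finite_interval_measure) (auto intro: mono continuous_at_imp_continuous_at_within contF)
    then show ?thesis
      using sigma_finite_measure.sigma_finite_iff_density_finite[OF sigma_finite_lborel d(1)] d(2) by simp
  qed
  define h where "h x = enn2real (d x)" for x
  have hm [measurable]: "h \<in> borel_measurable borel" unfolding h_def using d(1) by measurable
  have nn: "(\<integral>\<^sup>+z. ennreal (indicator {x<..y} z * h z) \<partial>lborel) = ennreal (F y - F x)" if "x \<le> y" for x y
  proof -
    have "(\<integral>\<^sup>+z. ennreal (indicator {x<..y} z * h z) \<partial>lborel) = (\<integral>\<^sup>+z. d z * indicator {x<..y} z \<partial>lborel)"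
    proof (rule nn_integral_cong_AE)
      show "AE z in lborel. ennreal (indicator {x<..y} z * h z) = d z * indicator {x<..y} z"
        using fin by eventually_elim (auto simp: h_def indicator_def less_top)
    qed
    also have "\<dots> = emeasure ?N {x<..y}"
      using d by (simp add: emeasure_density d(2)[symmetric])
    finally show ?thesis by (simp add: eF[OF that])
  qed
  have hb: "has_bochner_integral lborel (\<lambda>z. indicator {x<..y} z * h z) (F y - F x)" if "x \<le> y" for x y
  proof (rule has_bochner_integral_nn_integral)
    show "(\<lambda>z. indicator {x<..y} z * h z) \<in> borel_measurable lborel" by measurable
    show "AE z in lborel. 0 \<le> indicator {x<..y} z * h z" by (auto simp: h_def indicator_def)
  qed (use nn[OF that] mono[OF that] in auto)
  show ?thesis
  proof (rule that[of h])
    show "primitive_of h F"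
      using hb unfolding primitive_of_def set_integrable_def set_lebesgue_integral_def
      by (auto simp: has_bochner_integral_iff)
  qed (simp add: h_def)
qed

section \<open>Densities of the excess function and of the function itself\<close>

context
  fixes v :: "real \<Rightarrow> real"
  assumes small: "\<And>e. 0 < e \<Longrightarrow> \<exists>\<mu>\<ge>0. \<forall>ys. sorted ys \<longrightarrow> excess \<mu> v ys \<le> e"
begin

lemma excess_eventually_small:
  assumes "0 < e"
  obtains \<mu> where "\<kappa> \<le> \<mu>" "0 \<le> \<mu>" "\<And>ys. sorted ys \<Longrightarrow> excess \<mu> v ys \<le> e"
proof -
  obtain \<mu> where m: "0 \<le> \<mu>" "\<And>ys. sorted ys \<Longrightarrow> excess \<mu> v ys \<le> e" using small[OF assms] by auto
  show ?thesis
  proof (rule that[of "max \<kappa> \<mu>"])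
    show "excess (max \<kappa> \<mu>) v ys \<le> e" if "sorted ys" for ys
      using excess_antimono[of \<mu> "max \<kappa> \<mu>" ys v] m(2)[OF that] that by simp
  qed (use m in auto)
qed

lemma isCont_excess_upto:
  assumes E: "\<And>ys. sorted ys \<Longrightarrow> excess \<kappa> v ys \<le> E"
  shows "isCont (excess_upto \<kappa> v) x"
proof (rule isCont_of_increment_bound)
  let ?T = "excess_upto \<kappa> v"
  fix e :: real assume e: "0 < e"
  obtain \<mu> where m: "\<kappa> \<le> \<mu>" "0 \<le> \<mu>" "\<And>ys. sorted ys \<Longrightarrow> excess \<mu> v ys \<le> e"
    using excess_eventually_small[OF e] by blast
  have "\<bar>?T y - ?T x\<bar> \<le> e + (\<mu> - \<kappa>) * (y - x)" if "x \<le> y" for x y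
    using excess_upto_mono[OF E that] excess_upto_change_slope[OF E m(3,1) that] excess_upto_bounds[OF m(3), of x] excess_upto_bounds[OF m(3), of y] by simp
  then show "\<exists>L\<ge>0. \<forall>x y. x \<le> y \<longrightarrow> \<bar>?T y - ?T x\<bar> \<le> e + L * (y - x)"
    using m(1) by (intro exI[of _ "\<mu> - \<kappa>"]) auto
qed

text \<open>Absolute continuity is tested with the excess function of a steeper slope
  \<open>\<mu>\<close>, whose total increase is at most \<open>e\<close>, and with Lipschitz
  constant \<open>\<mu> - \<kappa>\<close>.\<close>

lemma excess_upto_density:
  assumes E: "\<And>ys. sorted ys \<Longrightarrow> excess \<kappa> v ys \<le> E"
  obtains h where "primitive_of h (excess_upto \<kappa> v)" "\<And>x. 0 \<le> h x"
proof (rule absolutely_continuous_density[of "excess_upto \<kappa> v"])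
  show "excess_upto \<kappa> v x \<le> excess_upto \<kappa> v y" if "x \<le> y" for x y
    using excess_upto_mono[OF E that] .
  fix e :: real assume e: "0 < e"
  obtain \<mu> where m: "\<kappa> \<le> \<mu>" "0 \<le> \<mu>" "\<And>ys. sorted ys \<Longrightarrow> excess \<mu> v ys \<le> e"
    using excess_eventually_small[OF e] by blast
  have "excess_upto \<mu> v y - excess_upto \<mu> v x \<le> e" for x y
    using excess_upto_bounds[OF m(3), of x] excess_upto_bounds[OF m(3), of y] by simp
  then show "\<exists>G L. (\<forall>x y. x \<le> y \<longrightarrow> G x \<le> G y \<and> G y - G x \<le> e) \<and> (\<forall>x. isCont G x) \<and> 0 \<le> L \<and>
      (\<forall>x y. x \<le> y \<longrightarrow> excess_upto \<kappa> v y - excess_upto \<kappa> v x \<le> G y - G x + L * (y - x))"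
    using m(1) excess_upto_mono[OF m(3)] isCont_excess_upto[OF m(3)] excess_upto_change_slope[OF E m(3,1)]
    by (intro exI[of _ "excess_upto \<mu> v"] exI[of _ "\<mu> - \<kappa>"]) auto
qed (use that in blast)

text \<open>Increments of \<open>v\<close> are bounded by those of \<open>?T + \<kappa> * x\<close>,
  so adding this function to \<open>v\<close> gives an increasing one. Its density exists, and
  subtracting the density of the added function leaves one for \<open>v\<close>.\<close>

lemma small_excess_density:
  obtains g where "primitive_of g v"
proof -
  obtain \<kappa> where k: "0 \<le> \<kappa>" and E: "\<And>ys. sorted ys \<Longrightarrow> excess \<kappa> v ys \<le> 1"
    using small[of 1] by auto
  let ?T = "excess_upto \<kappa> v"
  have inc: "\<bar>v y - v x\<bar> \<le> ?T y - ?T x + \<kappa> * (y - x)" if "x \<le> y" for x y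
    using excess_upto_increment[OF E that] by (auto simp: max_def split: if_splits)
  obtain a where a: "primitive_of a (\<lambda>x. ?T x + \<kappa> * x + v x)" "\<And>x. 0 \<le> a x"
  proof (rule absolutely_continuous_density[of "\<lambda>x. ?T x + \<kappa> * x + v x"])
    show "?T x + \<kappa> * x + v x \<le> ?T y + \<kappa> * y + v y" if "x \<le> y" for x y
      using inc[OF that] by (simp add: algebra_simps)
    fix e :: real assume e: "0 < e"
    \<comment> \<open>Half of \<open>e\<close>, because the sum increases at most twice as fast as
      \<open>?T + \<kappa> * x\<close>.\<close>
    obtain \<mu> where m: "\<kappa> \<le> \<mu>" "0 \<le> \<mu>" "\<And>ys. sorted ys \<Longrightarrow> excess \<mu> v ys \<le> e / 2"
      using excess_eventually_small[of "e / 2" \<kappa>] e by auto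
    have 1: "2 * excess_upto \<mu> v y - 2 * excess_upto \<mu> v x \<le> e" for x y
      using excess_upto_bounds[OF m(3), of x] excess_upto_bounds[OF m(3), of y] by simp
    have 2: "(?T y + \<kappa> * y + v y) - (?T x + \<kappa> * x + v x) \<le> 2 * excess_upto \<mu> v y - 2 * excess_upto \<mu> v x + (2 * \<mu>) * (y - x)"
      if "x \<le> y" for x y
      using inc[OF that] excess_upto_change_slope[OF E m(3,1) that] by (simp add: algebra_simps)
    show "\<exists>G L. (\<forall>x y. x \<le> y \<longrightarrow> G x \<le> G y \<and> G y - G x \<le> e) \<and> (\<forall>x. isCont G x) \<and> 0 \<le> L \<and>
      (\<forall>x y. x \<le> y \<longrightarrow> (?T y + \<kappa> * y + v y) - (?T x + \<kappa> * x + v x) \<le> G y - G x + L * (y - x))"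
      using m(2) excess_upto_mono[OF m(3)] isCont_excess_upto[OF m(3)] 1 2
      by (intro exI[of _ "\<lambda>x. 2 * excess_upto \<mu> v x"] exI[of _ "2 * \<mu>"]) (auto intro!: continuous_intros)
  qed (rule that)
  obtain b where b: "primitive_of b ?T" "\<And>x. 0 \<le> b x"
    by (rule excess_upto_density[OF E], assumption, rule that, assumption+)
  have "primitive_of (\<lambda>x. a x + - 1 * (b x + \<kappa>)) (\<lambda>x. ?T x + \<kappa> * x + v x + - 1 * (?T x + \<kappa> * x))"
    by (intro primitive_of_add primitive_of_cmult primitive_of_const a b)
  then show ?thesis by (intro that) simp
qed

text \<open>Both functions \<open>?T + \<kappa> * x - v\<close> and
  \<open>?T + \<kappa> * x + v\<close> increase, so \<bar>g\<bar> \<le> h + \<kappa> almost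
  everywhere for the density \<open>h\<close> of \<open>?T\<close>. The total mass of
  \<open>h\<close> is the total increase of \<open>?T\<close>, at most \<open>E\<close>.\<close>

lemma excess_density_bound:
  assumes g: "primitive_of g v"
    and E: "\<And>ys. sorted ys \<Longrightarrow> excess \<kappa> v ys \<le> E"
  shows "tail_integral g \<kappa> \<le> ennreal E"
proof -
  let ?T = "excess_upto \<kappa> v"
  obtain h where h: "primitive_of h ?T" and h0: "\<And>x. 0 \<le> h x"
    by (rule excess_upto_density[OF E], assumption, rule that, assumption+)
  note [measurable] = primitive_ofD(1)[OF g] primitive_ofD(1)[OF h]
  have inc: "\<bar>v y - v x\<bar> \<le> ?T y - ?T x + \<kappa> * (y - x)" if "x \<le> y" for x y
    using excess_upto_increment[OF E that] by (auto simp: max_def split: if_splits)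
  have contv: "isCont v x" for x
  proof (rule isCont_of_increment_bound)
    fix e :: real assume "0 < e"
    then obtain \<mu> where m: "0 \<le> \<mu>" "\<And>ys. sorted ys \<Longrightarrow> excess \<mu> v ys \<le> e" using small by blast
    have "\<bar>v y - v x\<bar> \<le> e + \<mu> * (y - x)" if "x \<le> y" for x y
      using m(2)[of "[x, y]"] that by simp
    then show "\<exists>L\<ge>0. \<forall>x y. x \<le> y \<longrightarrow> \<bar>v y - v x\<bar> \<le> e + L * (y - x)" using m(1) by blast
  qed
  have AE: "AE x in lborel. 0 \<le> h x + \<kappa> + - s * g x" if s: "s = 1 \<or> s = - 1" for s :: real
  proof (rule AE_nonneg_of_mono_primitive)
    show "primitive_of (\<lambda>x. h x + \<kappa> + - s * g x) (\<lambda>x. ?T x + \<kappa> * x + - s * v x)"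
      by (intro primitive_of_add primitive_of_cmult primitive_of_const g h)
    show "?T x + \<kappa> * x + - s * v x \<le> ?T y + \<kappa> * y + - s * v y" if "x \<le> y" for x y
      using inc[OF that] s by (auto simp: algebra_simps)
    show "isCont (\<lambda>x. ?T x + \<kappa> * x + - s * v x) x" for x
      by (intro continuous_intros isCont_excess_upto[OF E] contv)
  qed
  have "AE x in lborel. ennreal (\<bar>g x\<bar> - \<kappa>) \<le> ennreal (h x)"
    using AE[of 1, simplified] AE[of "- 1", simplified] by eventually_elim (auto intro: ennreal_leI)
  then have "tail_integral g \<kappa> \<le> (\<integral>\<^sup>+x. ennreal (h x) \<partial>lborel)"
    by (rule nn_integral_mono_AE)
  also have "\<dots> = (\<integral>\<^sup>+x. (SUP n. ennreal (indicator {- real n<..real n} x * h x)) \<partial>lborel)"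
  proof (rule nn_integral_cong)
    fix x
    obtain n where n: "\<bar>x\<bar> < real n" using reals_Archimedean2 by blast
    show "ennreal (h x) = (SUP n. ennreal (indicator {- real n<..real n} x * h x))"
    proof (rule antisym)
      show "ennreal (h x) \<le> (SUP n. ennreal (indicator {- real n<..real n} x * h x))"
        using n by (intro SUP_upper2[of n]) (auto simp: indicator_def abs_less_iff)
    qed (auto intro!: SUP_least simp: indicator_def h0)
  qed
  also have "\<dots> = (SUP n. \<integral>\<^sup>+x. ennreal (indicator {- real n<..real n} x * h x) \<partial>lborel)"
    by (rule nn_integral_monotone_convergence_SUP) (auto simp: incseq_def le_fun_def indicator_def h0)
  also have "\<dots> \<le> ennreal E"
  proof (rule SUP_least)
    fix n
    have "(\<integral>\<^sup>+x. ennreal (indicator {- real n<..real n} x * h x) \<partial>lborel) = ennreal (?T (real n) - ?T (- real n))"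
      using primitive_ofD(2,3)[OF h, of "- real n" "real n"] h0
      by (subst nn_integral_eq_integral) (auto simp: set_integrable_def set_lebesgue_integral_def)
    also have "\<dots> \<le> ennreal E"
      using excess_upto_bounds[OF E, of "real n"] excess_upto_bounds[OF E, of "- real n"] by (intro ennreal_leI) simp
    finally show "(\<integral>\<^sup>+x. ennreal (indicator {- real n<..real n} x * h x) \<partial>lborel) \<le> ennreal E" .
  qed
  finally show ?thesis .
qed

end

section \<open>Weak derivatives and primitives\<close>

definition derivative_chain :: "(nat \<Rightarrow> real \<Rightarrow> real) \<Rightarrow> bool" where
  "derivative_chain d \<longleftrightarrow> (\<forall>k x. (d k has_real_derivative d (Suc k) x) (at x))"

text \<open>With an explicit sequence of derivatives, closure under the operations below only
  requires the new sequence, without computing iterates of \<open>deriv\<close>.\<close>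

definition smooth :: "(real \<Rightarrow> real) \<Rightarrow> bool" where
  "smooth f \<longleftrightarrow> (\<exists>d. d 0 = f \<and> derivative_chain d)"

lemma smooth_iterated_deriv:
  assumes "smooth f"
  shows "(deriv ^^ k) f differentiable_on UNIV"
proof -
  obtain d where d: "d 0 = f" "\<And>k x. (d k has_real_derivative d (Suc k) x) (at x)"
    using assms unfolding smooth_def derivative_chain_def by blast
  have "(deriv ^^ k) f = d k"
  proof (induction k)
    case (Suc k)
    then show ?case using d(2) by (auto intro!: ext DERIV_imp_deriv)
  qed (simp add: d)
  then show ?thesis
    using d(2)[of k] by (auto simp: differentiable_on_def intro: real_differentiable_def[THEN iffD2])
qed

lemma smooth_add: "smooth f \<Longrightarrow> smooth g \<Longrightarrow> smooth (\<lambda>x. f x + g x)"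
  unfolding smooth_def derivative_chain_def
proof (elim exE conjE)
  fix d e assume "d 0 = f" "\<forall>k x. (d k has_real_derivative d (Suc k) x) (at x)" "e 0 = g" "\<forall>k x. (e k has_real_derivative e (Suc k) x) (at x)"
  then show "\<exists>d. d 0 = (\<lambda>x. f x + g x) \<and> (\<forall>k x. (d k has_real_derivative d (Suc k) x) (at x))"
    by (intro exI[of _ "\<lambda>k x. d k x + e k x"]) (auto intro!: derivative_intros)
qed

lemma smooth_cmult: "smooth f \<Longrightarrow> smooth (\<lambda>x. c * f x)"
  unfolding smooth_def derivative_chain_def
proof (elim exE conjE)
  fix d assume "d 0 = f" "\<forall>k x. (d k has_real_derivative d (Suc k) x) (at x)"
  then show "\<exists>d. d 0 = (\<lambda>x. c * f x) \<and> (\<forall>k x. (d k has_real_derivative d (Suc k) x) (at x))"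
    by (intro exI[of _ "\<lambda>k x. c * d k x"]) (auto intro!: DERIV_cmult)
qed

lemma smooth_affine: "smooth f \<Longrightarrow> smooth (\<lambda>x. f (c * (x - a)))"
  unfolding smooth_def derivative_chain_def
proof (elim exE conjE)
  fix d assume d: "d 0 = f" "\<forall>k x. (d k has_real_derivative d (Suc k) x) (at x)"
  have "((\<lambda>x. c ^ k * d k (c * (x - a))) has_real_derivative c ^ Suc k * d (Suc k) (c * (x - a))) (at x)" for k x
  proof -
    have "((\<lambda>x. d k (c * (x - a))) has_real_derivative d (Suc k) (c * (x - a)) * c) (at x)"
      by (rule DERIV_chain2[OF d(2)[rule_format]]) (auto intro!: derivative_eq_intros)
    from DERIV_cmult[OF this, of "c ^ k"] show ?thesis by (simp add: mult_ac)
  qed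
  with d(1) show "\<exists>d. d 0 = (\<lambda>x. f (c * (x - a))) \<and> (\<forall>k x. (d k has_real_derivative d (Suc k) x) (at x))"
    by (intro exI[of _ "\<lambda>k x. c ^ k * d k (c * (x - a))"]) auto
qed

lemma smooth_primitive:
  assumes "smooth f" "\<And>x. (F has_real_derivative f x) (at x)"
  shows "smooth F"
proof -
  obtain d where d: "d 0 = f" "\<And>k x. (d k has_real_derivative d (Suc k) x) (at x)"
    using assms unfolding smooth_def derivative_chain_def by blast
  have "((\<lambda>k. case k of 0 \<Rightarrow> F | Suc k \<Rightarrow> d k) k has_real_derivative (\<lambda>k. case k of 0 \<Rightarrow> F | Suc k \<Rightarrow> d k) (Suc k) x) (at x)" for k x
    using assms(2) d by (cases k) auto
  then show ?thesis
    unfolding smooth_def derivative_chain_def by (intro exI[of _ "\<lambda>k. case k of 0 \<Rightarrow> F | Suc k \<Rightarrow> d k"]) auto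
qed

definition flat_exp :: "real poly \<Rightarrow> real \<Rightarrow> real" where
  "flat_exp p x = (if x > 0 then poly p (1 / x) * exp (- (1 / x)) else 0)"

text \<open>In the variable y = 1/x the derivative of \<open>p(y) * exp (- y)\<close> with respect
  to x is \<open>y\<^sup>2 * (p(y) - p'(y)) * exp (- y)\<close>, so these functions are closed under
  differentiation.\<close>

definition flat_exp_deriv :: "real poly \<Rightarrow> real poly" where
  "flat_exp_deriv p = [:0, 0, 1:] * (p - pderiv p)"

lemma poly_times_exp_tendsto_0: "((\<lambda>y. poly p y * exp (- y)) \<longlongrightarrow> 0) at_top" for p :: "real poly"
proof -
  have "((\<lambda>y. \<Sum>i\<le>degree p. coeff p i * (y ^ i / exp y)) \<longlongrightarrow> (\<Sum>i\<le>degree p. coeff p i * 0)) at_top"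
    by (intro tendsto_intros tendsto_power_div_exp_0)
  moreover have "poly p y * exp (- y) = (\<Sum>i\<le>degree p. coeff p i * (y ^ i / exp y))" for y
    by (simp add: poly_altdef sum_distrib_right exp_minus divide_inverse mult.assoc)
  ultimately show ?thesis by simp
qed

lemma flat_exp_has_derivative: "(flat_exp p has_real_derivative flat_exp (flat_exp_deriv p) x) (at x)"
proof (cases x "0 :: real" rule: linorder_cases)
  case greater
  have "((\<lambda>x. poly p (1 / x) * exp (- (1 / x))) has_real_derivative flat_exp (flat_exp_deriv p) x) (at x)"
    using greater
    by (auto intro!: derivative_eq_intros DERIV_chain2[OF poly_DERIV]
        simp: flat_exp_def flat_exp_deriv_def algebra_simps power2_eq_square divide_inverse)
  then show ?thesis
    by (rule has_field_derivative_transform_within[where d = x]) (use greater in \<open>auto simp: flat_exp_def dist_real_def\<close>)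
next
  case less
  have "((\<lambda>x. 0) has_real_derivative flat_exp (flat_exp_deriv p) x) (at x)"
    using less by (simp add: flat_exp_def)
  then show ?thesis
    by (rule has_field_derivative_transform_within[where d = "- x"]) (use less in \<open>auto simp: flat_exp_def dist_real_def\<close>)
next
  case equal
  have "((\<lambda>h. flat_exp p h / h) \<longlongrightarrow> 0) (at 0)"
  proof (rule filterlim_split_at)
    have "\<forall>\<^sub>F h in at_left 0. 0 = flat_exp p h / h"
      unfolding eventually_at_left_field by (intro exI[of _ "- 1"]) (auto simp: flat_exp_def)
    then show "((\<lambda>h. flat_exp p h / h) \<longlongrightarrow> 0) (at_left 0)"
      by (rule Lim_transform_eventually[OF tendsto_const])
    \<comment> \<open>Dividing by \<open>h\<close> multiplies the polynomial in \<open>1 / h\<close>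
      by its variable, so the difference quotient at 0 is again of the flat form and tends to
      0.\<close>
    have "((\<lambda>h. poly (pCons 0 p) (inverse h) * exp (- (inverse h))) \<longlongrightarrow> 0) (at_right 0)"
      by (rule filterlim_compose[OF poly_times_exp_tendsto_0 filterlim_inverse_at_top_right])
    moreover have "\<forall>\<^sub>F h in at_right 0. poly (pCons 0 p) (inverse h) * exp (- (inverse h)) = flat_exp p h / h"
      unfolding eventually_at_right_field by (intro exI[of _ 1]) (auto simp: flat_exp_def field_simps)
    ultimately show "((\<lambda>h. flat_exp p h / h) \<longlongrightarrow> 0) (at_right 0)"
      by (rule Lim_transform_eventually)
  qed
  then show ?thesis
    by (simp add: equal has_field_derivative_iff flat_exp_def)
qed

text \<open>A class of functions closed under differentiation consists of smooth functions.\<close>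

inductive_set bump_products :: "(real \<Rightarrow> real) set" where
  "(\<lambda>x. flat_exp p x * flat_exp q (1 - x)) \<in> bump_products"
| "f \<in> bump_products \<Longrightarrow> g \<in> bump_products \<Longrightarrow> (\<lambda>x. f x + g x) \<in> bump_products"

lemma bump_products_derivative:
  "f \<in> bump_products \<Longrightarrow> \<exists>g\<in>bump_products. \<forall>x. (f has_real_derivative g x) (at x)"
proof (induction rule: bump_products.induct)
  case (1 p q)
  \<comment> \<open>The inner derivative of \<open>1 - x\<close> gives a minus sign; it is stored in
    the polynomial, as the class is generated by sums without scalar multiples.\<close>
  let ?g = "\<lambda>x. flat_exp (flat_exp_deriv p) x * flat_exp q (1 - x) + flat_exp p x * flat_exp (- flat_exp_deriv q) (1 - x)"
  have "?g \<in> bump_products" by (intro bump_products.intros)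
  moreover have "((\<lambda>x. flat_exp p x * flat_exp q (1 - x)) has_real_derivative ?g x) (at x)" for x
  proof -
    have 1: "((\<lambda>x. flat_exp q (1 - x)) has_real_derivative flat_exp (flat_exp_deriv q) (1 - x) * (- 1)) (at x)"
      by (rule DERIV_chain2[OF flat_exp_has_derivative]) (auto intro!: derivative_eq_intros)
    have "flat_exp (- flat_exp_deriv q) y = - flat_exp (flat_exp_deriv q) y" for y
      by (simp add: flat_exp_def)
    then show ?thesis
      using DERIV_mult[OF flat_exp_has_derivative[of p x] 1] by (simp add: mult_ac)
  qed
  ultimately show ?case by (intro bexI[of _ ?g] allI)
next
  case (2 f g)
  then obtain f' g' where "f' \<in> bump_products" "g' \<in> bump_products"
    "\<forall>x. (f has_real_derivative f' x) (at x)" "\<forall>x. (g has_real_derivative g' x) (at x)" by blast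
  then show ?case
    by (intro bexI[of _ "\<lambda>x. f' x + g' x"]) (auto intro!: derivative_intros bump_products.intros)
qed

lemma smooth_bump_products:
  assumes "f \<in> bump_products"
  shows "smooth f"
proof -
  obtain D where D: "\<And>f. f \<in> bump_products \<Longrightarrow> D f \<in> bump_products"
    "\<And>f x. f \<in> bump_products \<Longrightarrow> (f has_real_derivative D f x) (at x)"
    using bump_products_derivative by metis
  have mem: "(D ^^ k) f \<in> bump_products" for k
    by (induction k) (auto intro: assms D)
  show ?thesis
    unfolding smooth_def derivative_chain_def
    by (intro exI[of _ "\<lambda>k. (D ^^ k) f"]) (auto intro: D mem)
qed

text \<open>\<open>S\<close> is the normalised primitive of a bump on the unit interval and
  \<open>R\<close> a primitive of \<open>S\<close>. Differences of rescaled copies of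
  \<open>R\<close> have differences of steps as derivatives, which approximate indicators of
  intervals. The value \<open>R 1\<close> may stay unknown because it cancels in such
  differences.\<close>

lemma smooth_step_exists:
  obtains R S :: "real \<Rightarrow> real" where "smooth R" "smooth S" "\<And>x. (R has_real_derivative S x) (at x)"
    "\<And>x. 0 \<le> S x" "\<And>x. S x \<le> 1" "\<And>x. x \<le> 0 \<Longrightarrow> S x = 0" "\<And>x. 1 \<le> x \<Longrightarrow> S x = 1"
    "\<And>x. x \<le> 0 \<Longrightarrow> R x = 0" "\<And>x. 1 \<le> x \<Longrightarrow> R x = R 1 + (x - 1)"
proof -
  define B where "B x = flat_exp 1 x * flat_exp 1 (1 - x)" for x
  have sB: "smooth B" unfolding B_def by (intro smooth_bump_products bump_products.intros)
  have B0: "0 \<le> B x" for x by (simp add: B_def flat_exp_def)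
  have Bpos: "0 < x \<Longrightarrow> x < 1 \<Longrightarrow> 0 < B x" for x by (simp add: B_def flat_exp_def)
  have Bz: "x \<le> 0 \<or> 1 \<le> x \<Longrightarrow> B x = 0" for x by (auto simp: B_def flat_exp_def)
  have primitive: "\<exists>F. \<forall>x. (F has_real_derivative f x) (at x)" if "smooth f" for f
  proof -
    have "isCont f x" for x
      using that unfolding smooth_def derivative_chain_def by (metis DERIV_isCont)
    then have "\<exists>F. \<forall>x::real. -\<infinity> < ereal x \<longrightarrow> ereal x < \<infinity> \<longrightarrow> (F has_vector_derivative f x) (at x)"
      by (intro einterval_antiderivative) auto
    then show ?thesis by (auto simp: has_real_derivative_iff_has_vector_derivative)
  qed
  obtain S0 where S0: "\<And>x. (S0 has_real_derivative B x) (at x)" using primitive[OF sB] by blast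
  have S0mono: "S0 x \<le> S0 y" if "x \<le> y" for x y
    using that by (rule DERIV_nonneg_imp_nondecreasing) (use S0 B0 in blast)
  have S0const0: "S0 x = S0 0" if "x \<le> 0" for x
  proof -
    have "S0 0 \<le> S0 x"
      using that by (rule DERIV_nonpos_imp_nonincreasing) (use S0 Bz in \<open>metis order_refl\<close>)
    then show ?thesis using S0mono[OF that] by (rule antisym[rotated])
  qed
  have S0const1: "S0 x = S0 1" if "1 \<le> x" for x
  proof -
    have "S0 x \<le> S0 1"
      using that by (rule DERIV_nonpos_imp_nonincreasing) (use S0 Bz in \<open>metis order_refl\<close>)
    then show ?thesis using S0mono[OF that] by (rule antisym)
  qed
  have lt: "S0 0 < S0 1"
  proof -
    have "continuous_on {0..1} S0"
      using S0 by (meson DERIV_isCont continuous_at_imp_continuous_on)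
    then show ?thesis
      using S0 Bpos by (intro DERIV_pos_imp_increasing_open[of 0 1 S0]) auto
  qed
  define S where "S x = 1 / (S0 1 - S0 0) * (S0 x - S0 0)" for x
  have S': "(S has_real_derivative 1 / (S0 1 - S0 0) * B x) (at x)" for x
    unfolding S_def using lt by (auto intro!: derivative_eq_intros S0)
  have "smooth (\<lambda>x. 1 / (S0 1 - S0 0) * B x)" by (rule smooth_cmult[OF sB])
  then have sS: "smooth S" using S' by (rule smooth_primitive)
  have S01: "0 \<le> S x" "S x \<le> 1" for x
  proof -
    have "S0 0 \<le> S0 x" using S0mono[of 0 x] S0const0[of x] by linarith
    moreover have "S0 x \<le> S0 1" using S0mono[of x 1] S0const1[of x] by linarith
    ultimately show "0 \<le> S x" "S x \<le> 1" using lt by (auto simp: S_def divide_le_eq)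
  qed
  have Sl: "x \<le> 0 \<Longrightarrow> S x = 0" for x using S0const0[of x] by (simp add: S_def)
  have Sr: "1 \<le> x \<Longrightarrow> S x = 1" for x using S0const1[of x] lt by (simp add: S_def)
  obtain R0 where R0: "\<And>x. (R0 has_real_derivative S x) (at x)" using primitive[OF sS] by blast
  define R where "R x = R0 x - R0 0" for x
  have R': "(R has_real_derivative S x) (at x)" for x
    unfolding R_def by (auto intro!: derivative_eq_intros R0)
  have Rl: "R x = 0" if "x \<le> 0" for x
  proof (rule antisym)
    show "R x \<le> 0"
      using DERIV_nonneg_imp_nondecreasing[OF that, of R] R' S01 by (auto simp: R_def)
    have "R 0 \<le> R x"
      using that by (rule DERIV_nonpos_imp_nonincreasing) (use R' Sl in \<open>metis order_refl\<close>)
    then show "0 \<le> R x" by (simp add: R_def)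
  qed
  have Rr: "R x = R 1 + (x - 1)" if "1 \<le> x" for x
  proof -
    have d: "((\<lambda>x. R x - x) has_real_derivative S y - 1) (at y)" for y
      by (auto intro!: derivative_eq_intros R')
    have "R x - x \<le> R 1 - 1"
      using that by (rule DERIV_nonpos_imp_nonincreasing) (use d S01 in \<open>metis diff_le_0_iff_le\<close>)
    moreover have "R 1 - 1 \<le> R x - x"
      using that by (rule DERIV_nonneg_imp_nondecreasing) (use d Sr in \<open>metis diff_self order_refl\<close>)
    ultimately show ?thesis by simp
  qed
  show ?thesis
  proof (rule that[of R S])
    show "smooth R" using sS R' by (rule smooth_primitive)
  qed (fact sS R' S01 Sl Sr Rl Rr)+
qed

section \<open>Integration by parts against test functions\<close>

lemma test_fun_derivative:
  assumes "test_fun \<phi>"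
  shows "(\<phi> has_real_derivative deriv \<phi> x) (at x)" "isCont (deriv \<phi>) x"
proof -
  have "(deriv ^^ 0) \<phi> differentiable_on UNIV" "(deriv ^^ 1) \<phi> differentiable_on UNIV"
    using assms unfolding test_fun_def by blast+
  then have d: "\<phi> differentiable (at x)" "deriv \<phi> differentiable (at x)"
    by (auto simp: differentiable_on_def)
  show "(\<phi> has_real_derivative deriv \<phi> x) (at x)"
    using d(1) DERIV_deriv_iff_real_differentiable by blast
  show "isCont (deriv \<phi>) x" using d(2) differentiable_imp_continuous_within by blast
qed

lemma test_fun_supportE:
  assumes "test_fun \<phi>"
  obtains r where "0 < r" "\<And>x. r \<le> \<bar>x\<bar> \<Longrightarrow> \<phi> x = 0" "\<And>x. r \<le> \<bar>x\<bar> \<Longrightarrow> deriv \<phi> x = 0"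
proof -
  have "bounded {x. \<phi> x \<noteq> 0}"
    using assms closure_subset bounded_subset compact_imp_bounded unfolding test_fun_def by metis
  then obtain b where b: "\<And>x. \<phi> x \<noteq> 0 \<Longrightarrow> \<bar>x\<bar> \<le> b" by (auto simp: bounded_iff)
  have z: "\<phi> x = 0" if "b < \<bar>x\<bar>" for x using b[of x] that by auto
  show ?thesis
  proof (rule that[of "\<bar>b\<bar> + 1"])
    show "\<phi> x = 0" if "\<bar>b\<bar> + 1 \<le> \<bar>x\<bar>" for x using z[of x] that by linarith
    show "deriv \<phi> x = 0" if "\<bar>b\<bar> + 1 \<le> \<bar>x\<bar>" for x
    proof (rule DERIV_imp_deriv)
      have "((\<lambda>x. 0) has_real_derivative 0) (at x)" by simp
      then show "(\<phi> has_real_derivative 0) (at x)"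
        by (rule has_field_derivative_transform_within[where d = 1])
          (use that z in \<open>auto simp: dist_real_def\<close>)
    qed
  qed auto
qed

lemma test_funI:
  assumes "smooth \<phi>" "\<And>x. r \<le> \<bar>x\<bar> \<Longrightarrow> \<phi> x = 0"
  shows "test_fun \<phi>"
  unfolding test_fun_def
proof (intro conjI allI smooth_iterated_deriv assms(1))
  have "\<bar>x\<bar> \<le> r" if "\<phi> x \<noteq> 0" for x using that assms(2)[of x] by linarith
  then have "bounded {x. \<phi> x \<noteq> 0}" by (auto simp: bounded_iff)
  then show "compact (closure {x. \<phi> x \<noteq> 0})" by simp
qed

text \<open>Measurability is read off from a parameter integral: the integrand is jointly measurable
  in \<open>z\<close> and the upper limit \<open>x\<close>.\<close>

lemma primitive_of_tail_measurable:
  assumes "primitive_of g G"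
  shows "(\<lambda>x. indicator {a<..b} x * (G x - G a)) \<in> borel_measurable borel"
proof -
  note [measurable] = primitive_ofD(1)[OF assms]
  have "indicator {a<..b} x * (G x - G a) = indicator {a<..b} x * (LINT z|lborel. (if a < z \<and> z \<le> x then g z else 0))" for x
  proof (cases "a < x")
    case True
    then have "G x - G a = (LINT z:{a<..x}|lborel. g z)" using primitive_ofD(3)[OF assms, of a x] by simp
    also have "\<dots> = (LINT z|lborel. (if a < z \<and> z \<le> x then g z else 0))"
      unfolding set_lebesgue_integral_def by (intro Bochner_Integration.integral_cong) auto
    finally show ?thesis by simp
  qed auto
  then have eq: "(\<lambda>x. indicator {a<..b} x * (G x - G a)) =
      (\<lambda>x. indicator {a<..b} x * (LINT z|lborel. (if a < z \<and> z \<le> x then g z else 0)))" by (intro ext)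
  show ?thesis unfolding eq by measurable
qed

lemma primitive_of_measurable:
  assumes "primitive_of g G"
  shows "G \<in> borel_measurable borel"
proof (rule borel_measurable_LIMSEQ_real)
  fix x :: real
  obtain N :: nat where N: "\<bar>x\<bar> < real N" using reals_Archimedean2 by blast
  then have "\<forall>\<^sub>F n in sequentially. indicator {- real n<..real n} x * (G x - G (- real n)) + G (- real n) = G x"
    by (intro eventually_sequentiallyI[of N]) (auto simp: indicator_def)
  then show "(\<lambda>n. indicator {- real n<..real n} x * (G x - G (- real n)) + G (- real n)) \<longlonglongrightarrow> G x"
    by (rule tendsto_eventually)
qed (use primitive_of_tail_measurable[OF assms] in measurable)

lemma primitive_of_bounded:
  assumes "primitive_of g G" "a < x" "x \<le> b"
  shows "\<bar>G x - G a\<bar> \<le> (LINT z:{a<..b}|lborel. \<bar>g z\<bar>)"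
proof -
  have "\<bar>G x - G a\<bar> = \<bar>LINT z:{a<..x}|lborel. g z\<bar>" using primitive_ofD(3)[OF assms(1), of a x] assms by simp
  also have "\<dots> \<le> (LINT z:{a<..x}|lborel. \<bar>g z\<bar>)"
    using set_integral_norm_bound[OF primitive_ofD(2)[OF assms(1), of a x]] assms(2) by simp
  also have "\<dots> \<le> (LINT z:{a<..b}|lborel. \<bar>g z\<bar>)"
    unfolding set_lebesgue_integral_def
  proof (rule integral_mono)
    show "integrable lborel (\<lambda>z. indicator {a<..x} z *\<^sub>R \<bar>g z\<bar>)" "integrable lborel (\<lambda>z. indicator {a<..b} z *\<^sub>R \<bar>g z\<bar>)"
      using set_integrable_abs[OF primitive_ofD(2)[OF assms(1), of a x]] set_integrable_abs[OF primitive_ofD(2)[OF assms(1), of a b]] assms(2,3)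
      by (auto simp: set_integrable_def)
  qed (use assms(3) in \<open>auto simp: indicator_def\<close>)
  finally show ?thesis .
qed

lemma primitive_of_integrable:
  assumes "primitive_of g G"
  shows "set_integrable lborel {a<..b} G"
proof (cases "a < b")
  case True
  note [measurable] = primitive_of_measurable[OF assms]
  define K where "K = \<bar>G a\<bar> + (LINT z:{a<..b}|lborel. \<bar>g z\<bar>)"
  have K: "\<bar>G x\<bar> \<le> K" if "a < x" "x \<le> b" for x
    using primitive_of_bounded[OF assms that] by (simp add: K_def)
  show ?thesis
    unfolding set_integrable_def
  proof (rule Bochner_Integration.integrable_bound)
    show "integrable lborel (\<lambda>x. indicator {a<..b} x * K)" by (simp add: integrable_mult_left)
    show "AE x in lborel. norm (indicator {a<..b} x *\<^sub>R G x) \<le> norm (indicator {a<..b} x * K)"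
      using K by (intro AE_I2) (auto simp: indicator_def intro: order_trans[OF _ abs_ge_self])
  qed measurable
qed (simp add: set_integrable_def)

lemma locally_integrable_Ioc:
  assumes "\<And>a b. a \<le> b \<Longrightarrow> set_integrable lborel {a<..b} f"
  shows "locally_integrable f"
  unfolding locally_integrable_def
proof (intro allI)
  fix a b :: real
  show "set_integrable lborel {a..b} f"
  proof (cases "a \<le> b")
    case True
    then show ?thesis
      by (intro set_integrable_subset[OF assms[of "a - 1" b]]) auto
  qed (simp add: set_integrable_def)
qed

lemma test_fun_boundsE:
  assumes phi: "test_fun \<phi>"
  obtains r M where "0 < r" "\<And>x. r \<le> \<bar>x\<bar> \<Longrightarrow> \<phi> x = 0" "\<And>x. r \<le> \<bar>x\<bar> \<Longrightarrow> deriv \<phi> x = 0"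
    "deriv \<phi> \<in> borel_measurable borel" "0 \<le> M" "\<And>x. \<bar>deriv \<phi> x\<bar> \<le> M * indicator {- r<..r} x"
proof -
  obtain r where r: "0 < r" "\<And>x. r \<le> \<bar>x\<bar> \<Longrightarrow> \<phi> x = 0" "\<And>x. r \<le> \<bar>x\<bar> \<Longrightarrow> deriv \<phi> x = 0"
    using phi by (rule test_fun_supportE) blast
  have contd: "continuous_on A (deriv \<phi>)" for A
    using test_fun_derivative(2)[OF phi] by (intro continuous_at_imp_continuous_on) auto
  have "bounded (deriv \<phi> ` {- r..r})"
    by (intro compact_imp_bounded compact_continuous_image contd) auto
  then obtain M where M: "\<And>x. \<bar>x\<bar> \<le> r \<Longrightarrow> \<bar>deriv \<phi> x\<bar> \<le> M"
    unfolding bounded_iff by fastforce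
  show ?thesis
  proof (rule that[OF r])
    show "deriv \<phi> \<in> borel_measurable borel" by (rule borel_measurable_continuous_onI[OF contd])
    show "0 \<le> M" using M[of 0] r(1) by simp
    show "\<bar>deriv \<phi> x\<bar> \<le> M * indicator {- r<..r} x" for x
      using M[of x] r(3)[of x] by (cases "r \<le> \<bar>x\<bar>") (auto simp: indicator_def abs_le_iff split: if_splits)
  qed
qed

lemma integrable_mult_deriv_test_fun:
  assumes phi: "test_fun \<phi>" and [measurable]: "h \<in> borel_measurable borel" and h: "\<And>a b. set_integrable lborel {a<..b} h"
  shows "integrable lborel (\<lambda>x. h x * deriv \<phi> x)"
proof -
  obtain r M where rM: "0 < r" "\<And>x. r \<le> \<bar>x\<bar> \<Longrightarrow> \<phi> x = 0" "\<And>x. r \<le> \<bar>x\<bar> \<Longrightarrow> deriv \<phi> x = 0"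
    and dm [measurable]: "deriv \<phi> \<in> borel_measurable borel" and M: "0 \<le> M" "\<And>x. \<bar>deriv \<phi> x\<bar> \<le> M * indicator {- r<..r} x"
    by (rule test_fun_boundsE[OF phi], rule that, assumption+)
  show ?thesis
  proof (rule Bochner_Integration.integrable_bound)
    show "integrable lborel (\<lambda>x. M * (indicator {- r<..r} x * h x))"
      using h[of "- r" r] by (auto simp: set_integrable_def)
    show "AE x in lborel. norm (h x * deriv \<phi> x) \<le> norm (M * (indicator {- r<..r} x * h x))"
      using mult_left_mono[OF M(2) abs_ge_zero, of "h _"] M(1) by (intro AE_I2) (simp add: abs_mult mult_ac)
  qed measurable
qed

text \<open>Fubini on the triangle \<open>- r < z \<le> x \<le> r\<close> for
  \<open>g z * deriv \<phi> x\<close>: integrating over \<open>z\<close> first produces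
  \<open>G x - G (- r)\<close>, integrating over \<open>x\<close> first produces
  \<open>- \<phi> z\<close>. The constant \<open>G (- r)\<close> drops out since
  \<open>deriv \<phi>\<close> has integral 0.\<close>

lemma primitive_of_by_parts:
  assumes G: "primitive_of g G" and phi: "test_fun \<phi>"
  shows "(LINT x|lborel. G x * deriv \<phi> x) = - (LINT x|lborel. g x * \<phi> x)"
proof -
  obtain r M where r: "0 < r" "\<And>x. r \<le> \<bar>x\<bar> \<Longrightarrow> \<phi> x = 0" "\<And>x. r \<le> \<bar>x\<bar> \<Longrightarrow> deriv \<phi> x = 0"
    and dm [measurable]: "deriv \<phi> \<in> borel_measurable borel" and M: "0 \<le> M" "\<And>x. \<bar>deriv \<phi> x\<bar> \<le> M * indicator {- r<..r} x"
    by (rule test_fun_boundsE[OF phi], rule that, assumption+)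
  note [measurable] = primitive_ofD(1)[OF G] primitive_of_measurable[OF G]
  have contd: "continuous_on A (deriv \<phi>)" for A
    using test_fun_derivative(2)[OF phi] by (intro continuous_at_imp_continuous_on) auto
  have FTC: "(LINT x:{z..r}|lborel. deriv \<phi> x) = - \<phi> z" "set_integrable lborel {z..r} (deriv \<phi>)" if "z \<le> r" for z
  proof -
    have "has_bochner_integral lborel (\<lambda>x. indicator {z..r} x *\<^sub>R deriv \<phi> x) (\<phi> r - \<phi> z)"
      using that by (intro has_bochner_integral_FTC_Icc contd)
        (auto simp flip: has_real_derivative_iff_has_vector_derivative intro: has_field_derivative_at_within test_fun_derivative(1)[OF phi])
    then show "(LINT x:{z..r}|lborel. deriv \<phi> x) = - \<phi> z" "set_integrable lborel {z..r} (deriv \<phi>)"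
      using r(2)[of r] r(1) by (auto simp: set_lebesgue_integral_def set_integrable_def has_bochner_integral_iff)
  qed
  define I where "I = (\<lambda>x. indicator {- r<..r} x :: real)"
  have Im [measurable]: "I \<in> borel_measurable borel" unfolding I_def by measurable
  define f where "f = (\<lambda>(x, z). I x * I z * (if z \<le> x then 1 else 0) * (g z * deriv \<phi> x))"
  have fm: "f \<in> borel_measurable (lborel \<Otimes>\<^sub>M lborel)"
    unfolding f_def by measurable
  have gi: "integrable lborel (\<lambda>z. I z * g z)"
    using primitive_ofD(2)[OF G, of "- r" r] r(1) by (simp add: I_def set_integrable_def)
  have f_le: "\<bar>f (x, z)\<bar> \<le> I x * M * \<bar>I z * g z\<bar>" for x z
    using mult_left_mono[OF M(2)[of x] abs_ge_zero, of "g z"] M(1)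
    by (auto simp: f_def I_def abs_mult indicator_def mult_ac)
  have fi: "integrable lborel (\<lambda>z. f (x, z))" for x
  proof (rule Bochner_Integration.integrable_bound)
    show "integrable lborel (\<lambda>z. I x * M * \<bar>I z * g z\<bar>)" using gi by auto
    show "AE z in lborel. norm (f (x, z)) \<le> norm (I x * M * \<bar>I z * g z\<bar>)"
      using f_le by (intro AE_I2) (auto intro: order_trans[OF _ abs_ge_self])
  qed (use fm in measurable)
  have int: "integrable (lborel \<Otimes>\<^sub>M lborel) f"
  proof (rule lborel_pair.Fubini_integrable[OF fm])
    show "AE x in lborel. integrable lborel (\<lambda>y. f (x, y))" using fi by simp
    show "integrable lborel (\<lambda>x. LINT y|lborel. norm (f (x, y)))"
    proof (rule Bochner_Integration.integrable_bound)
      show "integrable lborel (\<lambda>x. I x * (M * (LINT z|lborel. \<bar>I z * g z\<bar>)))"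
        by (auto simp: I_def)
      show "AE x in lborel. norm (LINT y|lborel. norm (f (x, y))) \<le> norm (I x * (M * (LINT z|lborel. \<bar>I z * g z\<bar>)))"
      proof (rule AE_I2)
        fix x
        have "(LINT y|lborel. norm (f (x, y))) \<le> (LINT z|lborel. I x * M * \<bar>I z * g z\<bar>)"
          using f_le gi fi by (intro integral_mono) auto
        then show "norm (LINT y|lborel. norm (f (x, y))) \<le> norm (I x * (M * (LINT z|lborel. \<bar>I z * g z\<bar>)))"
          by (simp add: mult.assoc)
      qed
    qed (use fm in measurable)
  qed
  have inner1: "(LINT z|lborel. f (x, z)) = I x * (G x - G (- r)) * deriv \<phi> x" for x
  proof (cases "- r < x \<and> x \<le> r")
    case True
    have "(LINT z|lborel. f (x, z)) = (LINT z|lborel. (indicator {- r<..x} z * g z) * deriv \<phi> x)"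
      using True by (intro Bochner_Integration.integral_cong) (auto simp: f_def I_def indicator_def)
    also have "\<dots> = (G x - G (- r)) * deriv \<phi> x"
      using primitive_ofD(3)[OF G, of "- r" x] True by (simp add: set_lebesgue_integral_def)
    finally show ?thesis using True by (simp add: I_def)
  qed (auto simp: f_def I_def)
  have inner2: "(LINT x|lborel. f (x, z)) = - (g z * \<phi> z)" for z
  proof (cases "- r < z \<and> z \<le> r")
    case True
    have "(LINT x|lborel. f (x, z)) = (LINT x|lborel. g z * (indicator {z..r} x * deriv \<phi> x))"
      using True by (intro Bochner_Integration.integral_cong) (auto simp: f_def I_def indicator_def)
    also have "\<dots> = g z * (- \<phi> z)"
      using FTC(1)[of z] True by (simp add: set_lebesgue_integral_def)
    finally show ?thesis by simp
  next
    case False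
    then have "\<phi> z = 0" by (intro r(2)) auto
    then show ?thesis using False by (auto simp: f_def I_def)
  qed
  have "(LINT x|lborel. I x * (G x - G (- r)) * deriv \<phi> x) = (LINT z|lborel. - (g z * \<phi> z))"
    using lborel_pair.Fubini_integral[of "\<lambda>x z. f (x, z)"] int by (simp add: inner1 inner2)
  moreover have "(LINT x|lborel. I x * (G x - G (- r)) * deriv \<phi> x) = (LINT x|lborel. G x * deriv \<phi> x)"
  proof -
    have I: "I x * deriv \<phi> x = deriv \<phi> x" "indicator {- r..r} x * deriv \<phi> x = deriv \<phi> x" for x
      using r(3)[of x] by (cases "- r < x \<and> x \<le> r"; force simp: I_def indicator_def)+
    have d: "integrable lborel (deriv \<phi>)" "(LINT x|lborel. deriv \<phi> x) = 0"
      using FTC[of "- r"] r(1) r(2)[of "- r"] by (simp_all add: set_integrable_def set_lebesgue_integral_def I)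
    have "(LINT x|lborel. I x * (G x - G (- r)) * deriv \<phi> x) = (LINT x|lborel. G x * deriv \<phi> x - G (- r) * deriv \<phi> x)"
    proof (intro Bochner_Integration.integral_cong refl)
      show "I x * (G x - G (- r)) * deriv \<phi> x = G x * deriv \<phi> x - G (- r) * deriv \<phi> x" for x
        using arg_cong[OF I(1)[of x], of "\<lambda>w. (G x - G (- r)) * w"] by (simp add: algebra_simps)
    qed
    also have "\<dots> = (LINT x|lborel. G x * deriv \<phi> x)"
      using integrable_mult_deriv_test_fun[OF phi _ primitive_of_integrable[OF G]] d by simp
    finally show ?thesis .
  qed
  ultimately show ?thesis by simp
qed

lemma primitive_of_has_weak_deriv:
  assumes "primitive_of g G"
  shows "has_weak_deriv G g"
  unfolding has_weak_deriv_def
  using primitive_of_by_parts[OF assms] primitive_of_integrable[OF assms] primitive_ofD(2)[OF assms]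
  by (auto intro!: locally_integrable_Ioc)

section \<open>The du Bois-Reymond lemma\<close>

lemma AE_eq_of_linear_primitive:
  assumes "primitive_of h (\<lambda>x. c * x)"
  shows "AE x in lborel. h x = c"
proof -
  have "primitive_of (\<lambda>x. s * (h x + - c)) (\<lambda>x. s * (c * x + - c * x))" for s
    by (intro primitive_of_add primitive_of_cmult primitive_of_const assms)
  then have "AE x in lborel. 0 \<le> s * (h x + - c)" for s
    by (intro AE_nonneg_of_mono_primitive[where F = "\<lambda>_. 0"]) auto
  from this[of 1] this[of "- 1"] show ?thesis by eventually_elim auto
qed

text \<open>Testing with functions whose derivatives approximate, up to a factor, the indicator of
  (p, q] minus \<open>q - p\<close> times that of (0, 1] shows that the integral of \<open>W\<close>
  over (p, q] is \<open>(q - p) * c\<close>. So \<open>W\<close> has a linear primitive and equals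
  \<open>c\<close> almost everywhere.\<close>

lemma du_Bois_Reymond:
  assumes W [measurable]: "W \<in> borel_measurable borel" and int: "\<And>x y. x \<le> y \<Longrightarrow> set_integrable lborel {x<..y} W"
    and orth: "\<And>\<phi>. test_fun \<phi> \<Longrightarrow> (LINT x|lborel. W x * deriv \<phi> x) = 0"
  shows "\<exists>c. AE x in lborel. W x = c"
proof -
  let ?\<xi> = "\<lambda>n a x. real (Suc n) * (x - a)"
  obtain R S :: "real \<Rightarrow> real" where RS: "smooth R" "smooth S" "\<And>x. (R has_real_derivative S x) (at x)"
    "\<And>x. 0 \<le> S x" "\<And>x. S x \<le> 1" "\<And>x. x \<le> 0 \<Longrightarrow> S x = 0" "\<And>x. 1 \<le> x \<Longrightarrow> S x = 1"
    "\<And>x. x \<le> 0 \<Longrightarrow> R x = 0" "\<And>x. 1 \<le> x \<Longrightarrow> R x = R 1 + (x - 1)"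
    by (rule smooth_step_exists) blast
  have [measurable]: "S \<in> borel_measurable borel"
  proof (rule borel_measurable_continuous_onI)
    show "continuous_on UNIV S"
      using smooth_iterated_deriv[OF RS(2), of 0] differentiable_imp_continuous_on by force
  qed
  \<comment> \<open>A ramp that rises from 0 near \<open>p\<close> to a plateau reached after
    \<open>q\<close>; its derivative is \<open>Suc n\<close> times \<sigma>, and \<sigma> tends to
    the indicator of (p, q].\<close>
  define \<psi> where "\<psi> n p q x = (R (?\<xi> n p x) + - 1 * R (?\<xi> n q x))" for n p q x
  define \<sigma> where "\<sigma> n p q x = S (?\<xi> n p x) - S (?\<xi> n q x)" for n p q x
  have \<psi>s: "smooth (\<psi> n p q)" for n p q
    unfolding \<psi>_def by (intro smooth_add smooth_cmult smooth_affine RS)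
  have \<psi>d: "(\<psi> n p q has_real_derivative real (Suc n) * \<sigma> n p q x) (at x)" for n p q x
  proof -
    have a: "((\<lambda>x. R (?\<xi> n a x)) has_real_derivative S (?\<xi> n a x) * real (Suc n)) (at x)" for a
      by (rule DERIV_chain2[OF RS(3)]) (auto intro!: derivative_eq_intros)
    show ?thesis
      unfolding \<psi>_def \<sigma>_def using DERIV_add[OF a[of p] DERIV_cmult[OF a[of q], of "- 1"]] by (simp add: algebra_simps)
  qed
  have \<psi>0: "\<psi> n p q x = 0" if "x \<le> p" "p \<le> q" for n p q x
    using that RS(8) by (simp add: \<psi>_def mult_nonneg_nonpos)
  have \<psi>1: "\<psi> n p q x = real (Suc n) * (q - p)" if "q + 1 \<le> x" "p \<le> q" for n p q x
  proof -
    have "1 * 1 \<le> ?\<xi> n a x" if "a \<le> q" for a using \<open>q + 1 \<le> x\<close> that by (intro mult_mono) auto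
    then have "1 \<le> ?\<xi> n p x" "1 \<le> ?\<xi> n q x" using that by auto
    then show ?thesis using RS(9)[of "?\<xi> n p x"] RS(9)[of "?\<xi> n q x"]
      by (simp add: \<psi>_def algebra_simps)
  qed
  have \<sigma>b: "\<bar>\<sigma> n p q x\<bar> \<le> indicator {p<..q + 1} x" if "p \<le> q" for n p q x
  proof (cases "p < x \<and> x \<le> q + 1")
    case True
    then show ?thesis
      using RS(4)[of "?\<xi> n p x"] RS(5)[of "?\<xi> n p x"]
        RS(4)[of "?\<xi> n q x"] RS(5)[of "?\<xi> n q x"] by (auto simp: \<sigma>_def abs_le_iff)
  next
    case False
    then consider "x \<le> p" | "q + 1 < x" by linarith
    then show ?thesis
    proof cases
      case 1
      then show ?thesis using that RS(6) by (simp add: \<sigma>_def mult_nonneg_nonpos)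
    next
      case 2
      have "1 * 1 \<le> ?\<xi> n a x" if "a \<le> q" for a using 2 that by (intro mult_mono) auto
      then have "1 \<le> ?\<xi> n p x" "1 \<le> ?\<xi> n q x" using that by auto
      then show ?thesis using RS(7) by (simp add: \<sigma>_def)
    qed
  qed
  have Slim: "(\<lambda>n. S (?\<xi> n a x)) \<longlonglongrightarrow> (if a < x then 1 else 0)" for x a
  proof (cases "a < x")
    case True
    obtain N :: nat where N: "1 / (x - a) \<le> real N" using real_arch_simple by blast
    have "S (?\<xi> n a x) = 1" if "n \<ge> N" for n
    proof (rule RS(7))
      have "1 / (x - a) \<le> real (Suc n)" using N that by linarith
      then show "1 \<le> ?\<xi> n a x" using True by (simp add: divide_le_eq)
    qed
    then have "\<forall>\<^sub>F n in sequentially. S (?\<xi> n a x) = (if a < x then 1 else 0)"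
      using True by (auto simp: eventually_sequentially simp del: of_nat_Suc)
    then show ?thesis by (rule tendsto_eventually)
  next
    case False
    then show ?thesis using RS(6) by (simp add: mult_nonneg_nonpos del: of_nat_Suc)
  qed
  have \<sigma>lim: "(\<lambda>n. \<sigma> n p q x) \<longlonglongrightarrow> indicator {p<..q} x" if "p \<le> q" for p q x
    using tendsto_diff[OF Slim[of x p] Slim[of x q]] that unfolding \<sigma>_def by (auto simp: indicator_def split: if_splits)
  have Wi: "integrable lborel (\<lambda>x. indicator {p<..q + 1} x * \<bar>W x\<bar>)" if "p \<le> q" for p q
    using set_integrable_abs[OF int[of p "q + 1"]] that by (simp add: set_integrable_def)
  have lim: "(\<lambda>n. LINT x|lborel. W x * \<sigma> n p q x) \<longlonglongrightarrow> (LINT x:{p<..q}|lborel. W x)" if "p \<le> q" for p q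
    unfolding set_lebesgue_integral_def
  proof (rule integral_dominated_convergence[where w = "\<lambda>x. indicator {p<..q + 1} x * \<bar>W x\<bar>"])
    show "AE x in lborel. norm (W x * \<sigma> n p q x) \<le> indicator {p<..q + 1} x * \<bar>W x\<bar>" for n
      using \<sigma>b[OF that] by (intro AE_I2) (auto simp: abs_mult mult.commute intro: mult_left_mono)
    show "AE x in lborel. (\<lambda>n. W x * \<sigma> n p q x) \<longlonglongrightarrow> indicator {p<..q} x *\<^sub>R W x"
      using tendsto_mult_left[OF \<sigma>lim[OF that]] by (intro AE_I2) (simp add: mult.commute)
  qed (use Wi[OF that] in \<open>auto simp: \<sigma>_def\<close>)
  have \<sigma>i: "integrable lborel (\<lambda>x. W x * \<sigma> n p q x)" if "p \<le> q" for n p q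
  proof (rule Bochner_Integration.integrable_bound[OF Wi[OF that]])
    show "AE x in lborel. norm (W x * \<sigma> n p q x) \<le> norm (indicator {p<..q + 1} x * \<bar>W x\<bar>)"
      using \<sigma>b[OF that] by (intro AE_I2) (auto simp: abs_mult mult.commute intro: mult_left_mono)
  qed (simp add: \<sigma>_def)
  define c where "c = (LINT x:{0<..1}|lborel. W x)"
  have lin: "(LINT x:{p<..q}|lborel. W x) = (q - p) * c" if "p \<le> q" for p q
  proof -
    have "(LINT x|lborel. W x * \<sigma> n p q x) = (q - p) * (LINT x|lborel. W x * \<sigma> n 0 1 x)" for n
    proof -
      \<comment> \<open>The plateaus have heights \<open>Suc n * (q - p)\<close> and
        \<open>Suc n\<close>; this combination cancels them, which makes the support
        compact.\<close>
      define \<phi> where "\<phi> x = \<psi> n p q x + - (q - p) * \<psi> n 0 1 x" for x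
      have "test_fun \<phi>"
      proof (rule test_funI[where r = "\<bar>p\<bar> + \<bar>q\<bar> + 2"])
        show "smooth \<phi>" unfolding \<phi>_def by (intro smooth_add smooth_cmult \<psi>s)
        fix x assume x: "\<bar>p\<bar> + \<bar>q\<bar> + 2 \<le> \<bar>x\<bar>"
        show "\<phi> x = 0"
        proof (cases "0 \<le> x")
          case True
          then have "q + 1 \<le> x" "1 + 1 \<le> x" using x by auto
          then show ?thesis using \<psi>1[of q x p n] \<psi>1[of 1 x 0 n] that by (simp add: \<phi>_def algebra_simps)
        next
          case False
          then have "x \<le> p" "x \<le> 0" using x by auto
          then show ?thesis using \<psi>0[of x p q n] \<psi>0[of x 0 1 n] that by (simp add: \<phi>_def)
        qed
      qed
      moreover have "deriv \<phi> x = real (Suc n) * (\<sigma> n p q x - (q - p) * \<sigma> n 0 1 x)" for x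
      proof (rule DERIV_imp_deriv)
        show "(\<phi> has_real_derivative real (Suc n) * (\<sigma> n p q x - (q - p) * \<sigma> n 0 1 x)) (at x)"
          unfolding \<phi>_def using DERIV_add[OF \<psi>d[of n p q x] DERIV_cmult[OF \<psi>d[of n 0 1 x], of "- (q - p)"]]
          by (simp add: algebra_simps)
      qed
      ultimately have "(LINT x|lborel. W x * (real (Suc n) * (\<sigma> n p q x - (q - p) * \<sigma> n 0 1 x))) = 0"
        using orth[of \<phi>] by simp
      moreover have "(LINT x|lborel. W x * (real (Suc n) * (\<sigma> n p q x - (q - p) * \<sigma> n 0 1 x)))
         = (LINT x|lborel. real (Suc n) * (W x * \<sigma> n p q x - (q - p) * (W x * \<sigma> n 0 1 x)))"
        by (intro Bochner_Integration.integral_cong) (auto simp: algebra_simps)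
      ultimately show ?thesis
        using \<sigma>i[OF that, of n] \<sigma>i[of 0 1 n] by (simp del: of_nat_Suc)
    qed
    then have "(\<lambda>n. LINT x|lborel. W x * \<sigma> n p q x) \<longlonglongrightarrow> (q - p) * c"
      unfolding c_def using tendsto_mult_left[OF lim[of 0 1]] by simp
    then show ?thesis using lim[OF that] LIMSEQ_unique by blast
  qed
  have "primitive_of W (\<lambda>x. c * x)"
    using int lin by (auto simp: primitive_of_def algebra_simps)
  then show ?thesis using AE_eq_of_linear_primitive by blast
qed

lemma has_weak_deriv_primitive:
  assumes "has_weak_deriv u g" and [measurable]: "u \<in> borel_measurable borel" "g \<in> borel_measurable borel"
  obtains G where "primitive_of g G" "AE x in lborel. u x = G x"
proof -
  have loc: "set_integrable lborel {x<..y} h" if "locally_integrable h" for x y :: real and h :: "real \<Rightarrow> real"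
  proof (rule set_integrable_subset)
    show "set_integrable lborel {x..y} h" using that by (simp add: locally_integrable_def)
  qed auto
  have ui: "set_integrable lborel {x<..y} u" and gi: "set_integrable lborel {x<..y} g" for x y
    using assms(1) by (auto simp: has_weak_deriv_def intro: loc)
  define G where "G x = (if 0 \<le> x then (LINT z:{0<..x}|lborel. g z) else - (LINT z:{x<..0}|lborel. g z))" for x
  have add: "(LINT z:{x<..z}|lborel. g z) = (LINT z:{x<..y}|lborel. g z) + (LINT z:{y<..z}|lborel. g z)" if "x \<le> y" "y \<le> z" for x y z
    using that by (subst set_integral_Un[symmetric]) (auto intro: gi simp: ivl_disj_un)
  have G: "primitive_of g G"
    unfolding primitive_of_def
  proof (intro conjI allI impI gi)
    fix x y :: real assume xy: "x \<le> y"
    consider "0 \<le> x" | "x < 0" "0 \<le> y" | "y < 0" using xy by linarith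
    then show "(LINT z:{x<..y}|lborel. g z) = G y - G x"
    proof cases
      case 1 then show ?thesis using add[of 0 x y] xy by (simp add: G_def)
    next
      case 2 then show ?thesis using add[of x 0 y] by (simp add: G_def)
    next
      case 3 then show ?thesis using add[of x y 0] xy by (simp add: G_def)
    qed
  qed measurable
  note [measurable] = primitive_of_measurable[OF G]
  have "\<exists>c. AE x in lborel. u x - G x = c"
  proof (rule du_Bois_Reymond)
    show "set_integrable lborel {x<..y} (\<lambda>x. u x - G x)" for x y
      by (intro set_integral_diff ui primitive_of_integrable[OF G])
    fix \<phi> assume phi: "test_fun \<phi>"
    have "(LINT x|lborel. (u x - G x) * deriv \<phi> x) = (LINT x|lborel. u x * deriv \<phi> x) - (LINT x|lborel. G x * deriv \<phi> x)"
      using integrable_mult_deriv_test_fun[OF phi _ ui] integrable_mult_deriv_test_fun[OF phi _ primitive_of_integrable[OF G]]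
      by (simp add: left_diff_distrib)
    also have "\<dots> = 0"
      using primitive_of_by_parts[OF G phi] assms(1) phi by (simp add: has_weak_deriv_def)
    finally show "(LINT x|lborel. (u x - G x) * deriv \<phi> x) = 0" .
  qed measurable
  then obtain c where c: "AE x in lborel. u x - G x = c" by blast
  show ?thesis
  proof (rule that[of "\<lambda>x. G x + c"])
    show "primitive_of g (\<lambda>x. G x + c)" using G by (simp add: primitive_of_def)
    show "AE x in lborel. u x = G x + c" using c by eventually_elim auto
  qed
qed

section \<open>Integral inequalities\<close>

lemma nn_integral_powr_Ioc:
  assumes a: "0 < a" and r: "0 \<le> r"
  shows "(\<integral>\<^sup>+t. ennreal (a * t powr (a - 1)) * indicator {0..r} t \<partial>lborel) = ennreal (r powr a)"
proof -
  have "((\<lambda>x. a * x powr (a - 1)) has_integral a * (r powr (a - 1 + 1) / (a - 1 + 1))) {0..r}"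
    using a r by (intro has_integral_mult_right has_integral_powr_from_0) auto
  then show ?thesis
    using a by (subst nn_integral_has_integral_lebesgue') auto
qed

text \<open>Taylor's formula for t^p at 0 with integral remainder: the weight is the second
  derivative of t^p. For p < 2 it is singular at 0, and p > 1 keeps it integrable there.\<close>

lemma layer_cake:
  assumes p: "1 < p" and r: "0 \<le> r"
  shows "(\<integral>\<^sup>+t. ennreal (p * (p - 1) * t powr (p - 2)) * indicator {0<..} t * ennreal (r - t) \<partial>lborel) = ennreal (r powr p)" (is "?X = _")
proof -
  let ?a = "\<lambda>t. ennreal (p * (p - 1) * t powr (p - 2)) * indicator {0<..} t * ennreal (r - t)"
  let ?b = "\<lambda>t. ennreal (p - 1) * (ennreal (p * t powr (p - 1)) * indicator {0..r} t)"
  let ?c = "\<lambda>t. ennreal ((p - 1) * t powr (p - 1 - 1)) * indicator {0..r} t"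
  \<comment> \<open>The subtracted part of \<open>r - t\<close> is moved to the other side, so that
    all integrands stay nonnegative; the finite term cancels at the end.\<close>
  have "?X + ennreal ((p - 1) * r powr p) = ?X + (\<integral>\<^sup>+t. ?b t \<partial>lborel)"
  proof -
    have "(\<integral>\<^sup>+t. ?b t \<partial>lborel)
        = ennreal (p - 1) * (\<integral>\<^sup>+t. ennreal (p * t powr (p - 1)) * indicator {0..r} t \<partial>lborel)"
      by (rule nn_integral_cmult) measurable
    also have "\<dots> = ennreal (p - 1) * ennreal (r powr p)"
      using p r by (subst nn_integral_powr_Ioc) auto
    also have "\<dots> = ennreal ((p - 1) * r powr p)"
      using p by (intro ennreal_mult[symmetric]) auto
    finally show ?thesis by simp
  qed
  also have "\<dots> = (\<integral>\<^sup>+t. ?a t + ?b t \<partial>lborel)"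
    by (subst nn_integral_add) auto
  also have "\<dots> = (\<integral>\<^sup>+t. ennreal (p * r) * ?c t \<partial>lborel)"
  proof (rule nn_integral_cong_AE)
    have "AE t in lborel. t \<noteq> (0 :: real)" by (rule AE_lborel_singleton)
    then show "AE t in lborel. ?a t + ?b t = ennreal (p * r) * ?c t"
    proof eventually_elim
      case (elim t)
      show ?case
      proof (cases "0 < t \<and> t \<le> r")
        case True
        then have "t powr (p - 1) = t powr (p - 2) * t"
          using powr_add[of t "p - 2" 1] by simp
        then have "p * (p - 1) * t powr (p - 2) * (r - t) + (p - 1) * (p * t powr (p - 1)) = p * r * ((p - 1) * t powr (p - 2))"
          by (simp add: algebra_simps)
        then show ?thesis
          using True p by (simp add: ennreal_mult[symmetric] ennreal_plus[symmetric] del: ennreal_plus)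
      next
        case False
        then show ?thesis using elim r by (auto simp: indicator_def ennreal_neg)
      qed
    qed
  qed
  also have "\<dots> = ennreal (p * r) * ennreal (r powr (p - 1))"
    using p r nn_integral_powr_Ioc[of "p - 1" r] by (subst nn_integral_cmult) auto
  also have "\<dots> = ennreal (r powr p + (p - 1) * r powr p)"
  proof -
    have "r * r powr (p - 1) = r powr p"
      using r powr_add[of r 1 "p - 1"] by (cases "r = 0") auto
    then show ?thesis using p r by (simp add: ennreal_mult[symmetric] algebra_simps)
  qed
  also have "\<dots> = ennreal (r powr p) + ennreal ((p - 1) * r powr p)"
    using p by (intro ennreal_plus) auto
  finally show ?thesis by simp
qed

lemma nn_integral_powr_layer_cake:
  assumes p: "1 < p" and [measurable]: "g \<in> borel_measurable borel"
  shows "(\<integral>\<^sup>+x. ennreal (\<bar>g x\<bar> powr p) \<partial>lborel) =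
    (\<integral>\<^sup>+t. ennreal (p * (p - 1) * t powr (p - 2)) * indicator {0<..} t * tail_integral g t \<partial>lborel)"
proof -
  let ?w = "\<lambda>t. ennreal (p * (p - 1) * t powr (p - 2)) * indicator {0<..} t"
  have "(\<integral>\<^sup>+x. ennreal (\<bar>g x\<bar> powr p) \<partial>lborel) =
    (\<integral>\<^sup>+x. (\<integral>\<^sup>+t. ?w t * ennreal (\<bar>g x\<bar> - t) \<partial>lborel) \<partial>lborel)"
    using p by (simp add: layer_cake)
  also have "\<dots> = (\<integral>\<^sup>+t. (\<integral>\<^sup>+x. ?w t * ennreal (\<bar>g x\<bar> - t) \<partial>lborel) \<partial>lborel)"
    by (rule lborel_pair.Fubini') measurable
  also have "\<dots> = (\<integral>\<^sup>+t. ?w t * tail_integral g t \<partial>lborel)"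
    by (intro nn_integral_cong nn_integral_cmult) measurable
  finally show ?thesis .
qed

text \<open>For p > 1 both sides are integrals of their tails against the same weight. For p = 1
  that weight vanishes, and the tails converge to the norm as the level decreases to 0.\<close>

lemma nn_integral_powr_majorization:
  assumes p: "1 \<le> p" and [measurable]: "g \<in> borel_measurable borel" "h \<in> borel_measurable borel"
    and le: "\<And>t. 0 < t \<Longrightarrow> tail_integral g t \<le> tail_integral h t"
  shows "(\<integral>\<^sup>+x. ennreal (\<bar>g x\<bar> powr p) \<partial>lborel) \<le> (\<integral>\<^sup>+x. ennreal (\<bar>h x\<bar> powr p) \<partial>lborel)"
proof (cases "p = 1")
  case False
  then have p: "1 < p" using p by simp
  show ?thesis
    unfolding nn_integral_powr_layer_cake[OF p assms(2)] nn_integral_powr_layer_cake[OF p assms(3)]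
    by (intro nn_integral_mono) (auto simp: indicator_def intro!: mult_left_mono le)
next
  case True
  let ?s = "\<lambda>n. inverse (real (Suc n))"
  have lim: "(SUP n. ennreal (\<bar>g x\<bar> - ?s n)) = ennreal \<bar>g x\<bar>" for x
  proof (rule LIMSEQ_unique)
    show "(\<lambda>n. ennreal (\<bar>g x\<bar> - ?s n)) \<longlonglongrightarrow> (SUP n. ennreal (\<bar>g x\<bar> - ?s n))"
      by (rule LIMSEQ_SUP) (auto simp: incseq_def intro!: ennreal_leI diff_left_mono le_imp_inverse_le)
    have "(\<lambda>n. ennreal (\<bar>g x\<bar> - ?s n)) \<longlonglongrightarrow> ennreal (\<bar>g x\<bar> - 0)"
      by (intro tendsto_ennrealI tendsto_intros LIMSEQ_inverse_real_of_nat)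
    then show "(\<lambda>n. ennreal (\<bar>g x\<bar> - ?s n)) \<longlonglongrightarrow> ennreal \<bar>g x\<bar>" by simp
  qed
  have "(\<integral>\<^sup>+x. ennreal \<bar>g x\<bar> \<partial>lborel) = (\<integral>\<^sup>+x. (SUP n. ennreal (\<bar>g x\<bar> - ?s n)) \<partial>lborel)"
    by (simp only: lim)
  also have "\<dots> = (SUP n. tail_integral g (?s n))"
    by (rule nn_integral_monotone_convergence_SUP)
      (auto simp: incseq_def le_fun_def intro!: ennreal_leI diff_left_mono le_imp_inverse_le)
  also have "\<dots> \<le> (\<integral>\<^sup>+x. ennreal \<bar>h x\<bar> \<partial>lborel)"
  proof (rule SUP_least)
    fix n
    have "tail_integral g (?s n) \<le> tail_integral h (?s n)"
      by (rule le) simp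
    also have "\<dots> \<le> (\<integral>\<^sup>+x. ennreal \<bar>h x\<bar> \<partial>lborel)"
      by (intro nn_integral_mono ennreal_leI) simp
    finally show "tail_integral g (?s n) \<le> (\<integral>\<^sup>+x. ennreal \<bar>h x\<bar> \<partial>lborel)" .
  qed
  finally show ?thesis by (simp add: True)
qed

text \<open>Finite total mass bounds the radii, so the Vitali covering lemma selects disjoint balls
  whose fivefold enlargements cover \<open>A\<close>. An enlarged ball has length
  \<open>10 * r = (5 / t) * (2 * r * t)\<close>, less than \<open>5 / t\<close> times the mass of
  the original ball.\<close>

lemma hardy_littlewood_weak_type:
  fixes h :: "real \<Rightarrow> ennreal"
  assumes h [measurable]: "h \<in> borel_measurable borel" and fin: "(\<integral>\<^sup>+z. h z \<partial>lborel) \<noteq> \<infinity>" and t: "0 < t"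
    and A: "A \<in> sets borel"
    and big: "\<And>x. x \<in> A \<Longrightarrow> \<exists>r>0. ennreal (2 * r * t) < (\<integral>\<^sup>+z. h z * indicator (ball x r) z \<partial>lborel)"
  shows "emeasure lborel A \<le> ennreal (5 / t) * (\<integral>\<^sup>+z. h z \<partial>lborel)"
proof -
  let ?I = "\<lambda>A. \<integral>\<^sup>+z. h z * indicator A z \<partial>lborel" and ?h = "\<integral>\<^sup>+z. h z \<partial>lborel"
  obtain H where H: "?h = ennreal H" "0 \<le> H"
    using fin by (cases "\<integral>\<^sup>+z. h z \<partial>lborel") auto
  obtain r where r: "\<And>x. x \<in> A \<Longrightarrow> 0 < r x" "\<And>x. x \<in> A \<Longrightarrow> ennreal (2 * r x * t) < ?I (ball x (r x))"
    using big by metis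
  have rB: "0 < r x \<and> r x \<le> H / (2 * t)" if "x \<in> A" for x
  proof -
    have "ennreal (2 * r x * t) \<le> ?h"
      by (rule order_trans[OF less_imp_le[OF r(2)[OF that]]], rule nn_integral_mono) (auto simp: indicator_def)
    then have "2 * r x * t \<le> H" using H by simp
    then show ?thesis using r(1)[OF that] t by (simp add: field_simps)
  qed
  have "A \<subseteq> (\<Union>x\<in>A. ball x (r x))" using r(1) by auto
  then obtain C where C: "countable C" "C \<subseteq> A" "pairwise (\<lambda>i j. disjnt (ball i (r i)) (ball j (r j))) C"
    "A \<subseteq> (\<Union>i\<in>C. ball i (5 * r i))"
    using rB by (rule Vitali_covering_lemma_balls[where a = "\<lambda>x. x" and r = r]) (auto intro: that)
  \<comment> \<open>The chosen balls indexed by natural numbers, empty where no ball belongs to an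
    index: disjoint for \<open>k = 1\<close>, covering for \<open>k = 5\<close>.\<close>
  define X where "X k n = (if n \<in> to_nat_on C ` C then ball (from_nat_into C n) (k * r (from_nat_into C n)) else {})" for k n
  have Cn: "from_nat_into C n \<in> C" if "n \<in> to_nat_on C ` C" for n
    using that C(1) by auto
  have Xm: "X k n \<in> sets borel" for k n by (simp add: X_def)
  have XC: "(\<Union>i\<in>C. ball i (k * r i)) \<subseteq> (\<Union>n. X k n)" for k
  proof
    fix y assume "y \<in> (\<Union>i\<in>C. ball i (k * r i))"
    then obtain i where i: "i \<in> C" "y \<in> ball i (k * r i)" by blast
    then have "y \<in> X k (to_nat_on C i)" using C(1) by (simp add: X_def)
    then show "y \<in> (\<Union>n. X k n)" by blast
  qed
  have disj: "disjoint_family (X 1)"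
    unfolding disjoint_family_on_def
  proof (intro ballI impI)
    fix m n :: nat assume mn: "m \<noteq> n"
    show "X 1 m \<inter> X 1 n = {}"
    proof (cases "m \<in> to_nat_on C ` C \<and> n \<in> to_nat_on C ` C")
      case True
      then have "from_nat_into C m \<noteq> from_nat_into C n" using mn C(1) by auto
      then show ?thesis using C(3) Cn True by (auto simp: X_def pairwise_def disjnt_def)
    qed (auto simp: X_def)
  qed
  have X5: "emeasure lborel (X 5 n) \<le> ennreal (5 / t) * ?I (X 1 n)" for n
  proof (cases "n \<in> to_nat_on C ` C")
    case True
    define x where "x = from_nat_into C n"
    have x: "x \<in> A" using Cn[OF True] C(2) by (auto simp: x_def)
    have "emeasure lborel (X 5 n) = ennreal (5 / t * (2 * r x * t))"
      using True r(1)[OF x] t by (simp add: X_def x_def[symmetric] ball_eq_greaterThanLessThan)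
    also have "\<dots> = ennreal (5 / t) * ennreal (2 * r x * t)"
      using r(1)[OF x] t by (intro ennreal_mult) auto
    also have "\<dots> \<le> ennreal (5 / t) * ?I (X 1 n)"
      using True r(2)[OF x] by (intro mult_left_mono) (auto simp: X_def x_def[symmetric] less_imp_le)
    finally show ?thesis .
  qed (simp add: X_def)
  have "emeasure lborel A \<le> emeasure lborel (\<Union>n. X 5 n)"
    using C(4) XC[of 5] Xm by (intro emeasure_mono) auto
  also have "\<dots> \<le> (\<Sum>n. emeasure lborel (X 5 n))"
    using Xm by (intro emeasure_subadditive_countably) auto
  also have "\<dots> \<le> (\<Sum>n. ennreal (5 / t) * ?I (X 1 n))"
    by (intro suminf_le X5) auto
  also have "\<dots> = ennreal (5 / t) * (\<Sum>n. emeasure (density lborel h) (X 1 n))"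
    using Xm by (simp add: emeasure_density)
  also have "(\<Sum>n. emeasure (density lborel h) (X 1 n)) = emeasure (density lborel h) (\<Union>n. X 1 n)"
    using Xm disj by (intro suminf_emeasure) auto
  also have "\<dots> \<le> ?h"
    using Xm by (subst emeasure_density) (auto intro!: nn_integral_mono simp: indicator_def)
  finally show ?thesis by (simp add: mult_left_mono)
qed

text \<open>For \<open>2 ^ j * t \<le> \<bar>w\<bar> < 2 ^ (j + 1) * t\<close> the kernel is at most
  \<open>1 / (pi * t * 4 ^ j)\<close>; the factor 4 in the constant accounts for the shift from
  \<open>j\<close> to \<open>j + 1\<close>. A single term of the series suffices.\<close>

lemma poisson_dyadic_le:
  assumes t: "0 < t"
  shows "ennreal (poisson w t) \<le> (\<Sum>k. ennreal (4 / (pi * t) * (1 / 4) ^ k) * indicator {- (2 ^ k * t)<..<2 ^ k * t} w)"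
proof -
  let ?a = "\<lambda>k. ennreal (4 / (pi * t) * (1 / 4) ^ k) * indicator {- (2 ^ k * t)<..<2 ^ k * t} w"
  define P where "P k \<longleftrightarrow> \<bar>w\<bar> < 2 ^ k * t" for k :: nat
  obtain k0 :: nat where "\<bar>w\<bar> / t < 2 ^ k0" using real_arch_pow[of 2 "\<bar>w\<bar> / t"] by auto
  then have "P k0" using t by (simp add: P_def divide_less_eq)
  define k where "k = (LEAST k. P k)"
  have k: "P k" unfolding k_def using \<open>P k0\<close> by (rule LeastI)
  have "poisson w t \<le> 4 / (pi * t) * (1 / 4) ^ k"
  proof (cases k)
    case 0
    have "poisson w t \<le> 1 / (pi * t)" by (rule poisson_le[OF t])
    also have "\<dots> \<le> 4 / (pi * t)" using t by (intro divide_right_mono) auto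
    finally show ?thesis by (simp add: 0)
  next
    case (Suc j)
    have "\<not> P j" using not_less_Least[of j P] Suc by (simp add: k_def)
    then have w: "2 ^ j * t \<le> \<bar>w\<bar>" by (simp add: P_def)
    have "(2 ^ j * t)\<^sup>2 \<le> w\<^sup>2 + t\<^sup>2"
      using power_mono[OF w, of 2] t by (simp add: add_increasing2)
    then have "poisson w t \<le> (1 / pi) * (t / (2 ^ j * t)\<^sup>2)"
      unfolding poisson_def using t by (intro mult_left_mono divide_left_mono mult_pos_pos add_nonneg_pos) auto
    also have "\<dots> = 4 / (pi * t) * (1 / 4) ^ k"
      using t by (simp add: Suc power2_eq_square power_mult_distrib[symmetric] field_simps)
    finally show ?thesis .
  qed
  then have "ennreal (poisson w t) \<le> ?a k"
    using k by (auto simp: P_def abs_less_iff indicator_def intro: ennreal_leI)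
  also have "\<dots> \<le> (\<Sum>k. ?a k)"
  proof -
    have "a k \<le> suminf a" for a :: "nat \<Rightarrow> ennreal" using sum_le_suminf[of a "{k}"] by simp
    then show ?thesis .
  qed
  finally show ?thesis .
qed

text \<open>The ball of radius \<open>2 ^ k * t\<close> contributes at most
  \<open>8 / pi * m * (1 / 2) ^ k\<close>, and the geometric series gives the constant
  \<open>16 / pi\<close>.\<close>

lemma nn_integral_poisson_le_maximal:
  fixes f :: "real \<Rightarrow> ennreal"
  assumes [measurable]: "f \<in> borel_measurable borel" and t: "0 < t" and m: "0 \<le> m"
    and avg: "\<And>r. 0 < r \<Longrightarrow> (\<integral>\<^sup>+z. f z * indicator (ball x r) z \<partial>lborel) \<le> ennreal (2 * r * m)"
  shows "(\<integral>\<^sup>+z. ennreal (poisson (x - z) t) * f z \<partial>lborel) \<le> ennreal (16 / pi * m)"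
proof -
  let ?c = "\<lambda>k. ennreal (4 / (pi * t) * (1 / 4) ^ k)" and ?J = "\<lambda>k. indicator {- (2 ^ k * t)<..<2 ^ k * t}"
  let ?F = "\<lambda>k z. f z * indicator (ball x (2 ^ k * t)) z"
  have [measurable]: "ball x r \<in> sets borel" for r by simp
  have "(\<integral>\<^sup>+z. ennreal (poisson (x - z) t) * f z \<partial>lborel) \<le>
    (\<integral>\<^sup>+z. (\<Sum>k. ?c k * ?F k z) \<partial>lborel)"
  proof (rule nn_integral_mono)
    fix z
    have "ennreal (poisson (x - z) t) * f z \<le> (\<Sum>k. ?c k * ?J k (x - z)) * f z"
      by (intro mult_right_mono poisson_dyadic_le t) auto
    also have "\<dots> = (\<Sum>k. ?c k * ?J k (x - z) * f z)"
      by simp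
    also have "\<dots> = (\<Sum>k. ?c k * ?F k z)"
      by (intro suminf_cong) (auto simp: indicator_def dist_real_def abs_less_iff)
    finally show "ennreal (poisson (x - z) t) * f z \<le> (\<Sum>k. ?c k * ?F k z)" .
  qed
  also have "\<dots> = (\<Sum>k. \<integral>\<^sup>+z. ?c k * ?F k z \<partial>lborel)"
    by (rule nn_integral_suminf) measurable
  also have "\<dots> = (\<Sum>k. ?c k * (\<integral>\<^sup>+z. ?F k z \<partial>lborel))"
    by (intro suminf_cong nn_integral_cmult) measurable
  also have "\<dots> \<le> (\<Sum>k. ennreal (8 / pi * m * (1 / 2) ^ k))"
  proof (intro suminf_le)
    fix k
    have "?c k * (\<integral>\<^sup>+z. ?F k z \<partial>lborel)
      \<le> ?c k * ennreal (2 * (2 ^ k * t) * m)"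
      using t by (intro mult_left_mono avg) auto
    also have "\<dots> = ennreal (4 / (pi * t) * (1 / 4) ^ k * (2 * (2 ^ k * t) * m))"
      using t m by (intro ennreal_mult[symmetric]) auto
    also have "4 / (pi * t) * (1 / 4) ^ k * (2 * (2 ^ k * t) * m) = 8 / pi * m * ((1 / 4) ^ k * 2 ^ k)"
      using t by (simp add: field_simps)
    also have "(1 / 4 :: real) ^ k * 2 ^ k = (1 / 2) ^ k"
      by (simp add: power_mult_distrib[symmetric])
    finally show "?c k * (\<integral>\<^sup>+z. ?F k z \<partial>lborel)
      \<le> ennreal (8 / pi * m * (1 / 2) ^ k)" .
  qed auto
  also have "\<dots> = ennreal (16 / pi * m)"
  proof (rule suminf_ennreal_eq)
    show "0 \<le> 8 / pi * m * (1 / 2) ^ k" for k using m by simp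
    have "(\<lambda>k. 8 / pi * m * (1 / 2) ^ k) sums (8 / pi * m * (1 / (1 - 1 / 2)))"
      by (intro sums_mult geometric_sums) auto
    then show "(\<lambda>k. 8 / pi * m * (1 / 2) ^ k) sums (16 / pi * m)" by simp
  qed
  finally show ?thesis .
qed

text \<open>Marcinkiewicz interpolation between the weak type estimate and the trivial bound: at
  level \<open>t\<close> the part of \<open>f\<close> below \<open>t / 2\<close> accounts for at
  most half of a large average, so the weak estimate applies at level \<open>t / 2\<close> to the
  rest.\<close>

lemma nn_integral_maximal_powr_finite:
  fixes U f :: "real \<Rightarrow> real"
  assumes p: "1 < p" and [measurable]: "U \<in> borel_measurable borel" "f \<in> borel_measurable borel"
    and U0: "\<And>x. 0 \<le> U x" and f0: "\<And>x. 0 \<le> f x"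
    and fp: "(\<integral>\<^sup>+x. ennreal (f x powr p) \<partial>lborel) \<noteq> \<infinity>"
    and dom: "\<And>x m. 0 < m \<Longrightarrow> m < U x \<Longrightarrow> \<exists>r>0. ennreal (2 * r * m) < (\<integral>\<^sup>+z. ennreal (f z) * indicator (ball x r) z \<partial>lborel)"
  shows "(\<integral>\<^sup>+x. ennreal (U x powr p) \<partial>lborel) \<noteq> \<infinity>"
proof -
  let ?v = "\<lambda>t. ennreal (p * t powr (p - 1)) * indicator {0<..} t"
  let ?w = "\<lambda>t. ennreal (10 * p * t powr (p - 2)) * indicator {0<..} t"
  let ?I = "\<lambda>t x. if t < U x then 1 else 0 :: ennreal"
  have [measurable]: "ball x r \<in> sets borel" for x r :: real by simp
  define h where "h t z = ennreal (f z) * (if t / 2 < f z then 1 else 0)" for t z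
  have hm [measurable]: "case_prod h \<in> borel_measurable (borel \<Otimes>\<^sub>M borel)"
    unfolding h_def by measurable
  let ?H = "\<lambda>t x r. \<integral>\<^sup>+z. h t z * indicator (ball x r) z \<partial>lborel"
  have hm1 [measurable]: "h t \<in> borel_measurable borel" for t unfolding h_def by measurable
  have weak: "emeasure lborel {x. t < U x} \<le> ennreal (10 / t) * (\<integral>\<^sup>+z. h t z \<partial>lborel)" if t: "0 < t" for t
  proof -
    \<comment> \<open>Where \<open>f\<close> exceeds \<open>t / 2\<close> it is at most a constant
      times its p-th power; hence the upper part has finite mass, as the covering argument
      requires.\<close>
    have "h t z \<le> ennreal ((t / 2) powr (1 - p)) * ennreal (f z powr p)" for z
    proof (cases "t / 2 < f z")
      case True
      have "f z = f z powr (1 - p) * f z powr p"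
        using True t by (simp add: powr_add[symmetric])
      also have "\<dots> \<le> (t / 2) powr (1 - p) * f z powr p"
        using True t p by (intro mult_right_mono powr_mono2') auto
      finally show ?thesis using True by (simp add: h_def ennreal_mult[symmetric] ennreal_leI)
    qed (simp add: h_def)
    then have "(\<integral>\<^sup>+z. h t z \<partial>lborel) \<le> (\<integral>\<^sup>+z. ennreal ((t / 2) powr (1 - p)) * ennreal (f z powr p) \<partial>lborel)"
      by (intro nn_integral_mono)
    also have "\<dots> = ennreal ((t / 2) powr (1 - p)) * (\<integral>\<^sup>+z. ennreal (f z powr p) \<partial>lborel)"
      by (rule nn_integral_cmult) measurable
    also have "\<dots> < \<infinity>" using fp by (simp add: ennreal_mult_less_top less_top)
    finally have hfin: "(\<integral>\<^sup>+z. h t z \<partial>lborel) \<noteq> \<infinity>" by simp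
    have "emeasure lborel {x. t < U x} \<le> ennreal (5 / (t / 2)) * (\<integral>\<^sup>+z. h t z \<partial>lborel)"
    proof (rule hardy_littlewood_weak_type[OF hm1 hfin])
      fix x assume "x \<in> {x. t < U x}"
      then obtain r where r: "0 < r" "ennreal (2 * r * t) < (\<integral>\<^sup>+z. ennreal (f z) * indicator (ball x r) z \<partial>lborel)"
        using dom[OF t] by auto
      have "\<not> ?H t x r \<le> ennreal (2 * r * (t / 2))"
      proof
        assume le: "?H t x r \<le> ennreal (2 * r * (t / 2))"
        have "(\<integral>\<^sup>+z. ennreal (f z) * indicator (ball x r) z \<partial>lborel) \<le>
          (\<integral>\<^sup>+z. h t z * indicator (ball x r) z + ennreal (t / 2) * indicator (ball x r) z \<partial>lborel)"
          by (intro nn_integral_mono) (auto simp: h_def indicator_def intro: ennreal_leI)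
        also have "\<dots> = ?H t x r + (\<integral>\<^sup>+z. ennreal (t / 2) * indicator (ball x r) z \<partial>lborel)"
          by (rule nn_integral_add) measurable
        also have "(\<integral>\<^sup>+z. ennreal (t / 2) * indicator (ball x r) z \<partial>lborel) = ennreal (t / 2) * ennreal (2 * r)"
          using r(1) by (simp add: nn_integral_cmult_indicator ball_eq_greaterThanLessThan)
        also have "\<dots> = ennreal (r * t)" using r(1) t by (simp add: ennreal_mult[symmetric] mult.commute)
        also have "?H t x r + ennreal (r * t) \<le> ennreal (2 * r * (t / 2)) + ennreal (r * t)"
          using le by (rule add_right_mono)
        also have "\<dots> = ennreal (2 * r * t)"
          using r(1) t by (simp add: ennreal_plus[symmetric] del: ennreal_plus)
        finally show False using r(2) by simp
      qed
      then show "\<exists>r>0. ennreal (2 * r * (t / 2)) < ?H t x r"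
        using r(1) by (auto simp: not_le)
    qed (use t in auto)
    then show ?thesis by simp
  qed
  have "(\<integral>\<^sup>+x. ennreal (U x powr p) \<partial>lborel) = (\<integral>\<^sup>+x. (\<integral>\<^sup>+t. ennreal (p * t powr (p - 1)) * indicator {0..U x} t \<partial>lborel) \<partial>lborel)"
    using p U0 by (simp add: nn_integral_powr_Ioc)
  also have "\<dots> = (\<integral>\<^sup>+x. (\<integral>\<^sup>+t. ?v t * ?I t x \<partial>lborel) \<partial>lborel)"
  proof (rule nn_integral_cong, rule nn_integral_cong_AE)
    fix x
    have "AE t in lborel. t \<noteq> (0::real)" "AE t in lborel. t \<noteq> U x" by (rule AE_lborel_singleton)+
    then show "AE t in lborel. ennreal (p * t powr (p - 1)) * indicator {0..U x} t = ?v t * ?I t x"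
      by eventually_elim (auto simp: indicator_def)
  qed
  also have "\<dots> = (\<integral>\<^sup>+t. (\<integral>\<^sup>+x. ?v t * ?I t x \<partial>lborel) \<partial>lborel)"
    by (rule lborel_pair.Fubini') measurable
  also have "\<dots> = (\<integral>\<^sup>+t. ?v t * emeasure lborel {x. t < U x} \<partial>lborel)"
  proof (rule nn_integral_cong)
    fix t
    have "(\<integral>\<^sup>+x. ?v t * ?I t x \<partial>lborel)
      = (\<integral>\<^sup>+x. ?v t * indicator {x. t < U x} x \<partial>lborel)"
      by (intro nn_integral_cong) (auto simp: indicator_def)
    also have "\<dots> = ?v t * emeasure lborel {x. t < U x}"
      by (rule nn_integral_cmult_indicator) measurable
    finally show "(\<integral>\<^sup>+x. ?v t * ?I t x \<partial>lborel)
      = ?v t * emeasure lborel {x. t < U x}" .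
  qed
  also have "\<dots> \<le> (\<integral>\<^sup>+t. (\<integral>\<^sup>+z. ?w t * h t z \<partial>lborel) \<partial>lborel)"
  proof (rule nn_integral_mono)
    fix t
    have "?v t * emeasure lborel {x. t < U x}
      \<le> ?w t * (\<integral>\<^sup>+z. h t z \<partial>lborel)"
    proof (cases "0 < t")
      case True
      have "t powr (p - 1) = t powr (p - 2) * t" using True powr_add[of t "p - 2" 1] by simp
      then have e: "ennreal (p * t powr (p - 1)) * ennreal (10 / t) = ennreal (10 * p * t powr (p - 2))"
        using True p by (simp add: ennreal_mult[symmetric])
      have "ennreal (p * t powr (p - 1)) * emeasure lborel {x. t < U x} \<le> ennreal (p * t powr (p - 1)) * (ennreal (10 / t) * (\<integral>\<^sup>+z. h t z \<partial>lborel))"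
        by (intro mult_left_mono weak True) auto
      then show ?thesis using True e by (simp add: mult.assoc[symmetric])
    qed simp
    also have "\<dots> = (\<integral>\<^sup>+z. ?w t * h t z \<partial>lborel)"
      by (rule nn_integral_cmult[symmetric]) measurable
    finally show "?v t * emeasure lborel {x. t < U x}
      \<le> (\<integral>\<^sup>+z. ?w t * h t z \<partial>lborel)" .
  qed
  also have "\<dots> = (\<integral>\<^sup>+z. (\<integral>\<^sup>+t. ?w t * h t z \<partial>lborel) \<partial>lborel)"
    by (rule lborel_pair.Fubini') measurable
  also have "\<dots> \<le> (\<integral>\<^sup>+z. ennreal (10 * p / (p - 1) * 2 powr (p - 1)) * ennreal (f z powr p) \<partial>lborel)"
  proof (rule nn_integral_mono)
    fix z
    \<comment> \<open>\<open>h t z\<close> vanishes unless \<open>t < 2 * f z\<close>, so the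
      integral over \<open>t\<close> runs over a bounded interval, where
      \<open>t powr (p - 2)\<close> is integrable because p > 1.\<close>
    have "(\<integral>\<^sup>+t. ?w t * h t z \<partial>lborel)
      \<le> (\<integral>\<^sup>+t. ennreal (10 * p / (p - 1) * f z) * (ennreal ((p - 1) * t powr (p - 1 - 1)) * indicator {0..2 * f z} t) \<partial>lborel)"
    proof (rule nn_integral_mono)
      fix t
      have "10 * p * t powr (p - 2) * f z = 10 * p / (p - 1) * f z * ((p - 1) * t powr (p - 1 - 1))"
        using p by (simp add: field_simps)
      then show "?w t * h t z
        \<le> ennreal (10 * p / (p - 1) * f z) * (ennreal ((p - 1) * t powr (p - 1 - 1)) * indicator {0..2 * f z} t)"
        using p f0[of z] by (auto simp: h_def indicator_def ennreal_mult[symmetric])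
    qed
    also have "\<dots> = ennreal (10 * p / (p - 1) * f z) * ennreal ((2 * f z) powr (p - 1))"
      using p f0[of z] nn_integral_powr_Ioc[of "p - 1" "2 * f z"] by (subst nn_integral_cmult) auto
    also have "\<dots> = ennreal (10 * p / (p - 1) * 2 powr (p - 1)) * ennreal (f z powr p)"
    proof -
      have "f z * f z powr (p - 1) = f z powr p"
        using f0[of z] powr_add[of "f z" 1 "p - 1"] by (cases "f z = 0") auto
      then have "10 * p / (p - 1) * f z * (2 * f z) powr (p - 1) = 10 * p / (p - 1) * 2 powr (p - 1) * f z powr p"
        using f0[of z] by (simp add: powr_mult mult_ac)
      then show ?thesis using p f0[of z] by (simp add: ennreal_mult[symmetric])
    qed
    finally show "(\<integral>\<^sup>+t. ?w t * h t z \<partial>lborel)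
      \<le> ennreal (10 * p / (p - 1) * 2 powr (p - 1)) * ennreal (f z powr p)" .
  qed
  also have "\<dots> = ennreal (10 * p / (p - 1) * 2 powr (p - 1)) * (\<integral>\<^sup>+z. ennreal (f z powr p) \<partial>lborel)"
    by (rule nn_integral_cmult) measurable
  also have "\<dots> < \<infinity>" using fp by (simp add: ennreal_mult_less_top less_top)
  finally show ?thesis by simp
qed

section \<open>Variation and Sobolev bounds\<close>

lemma excess_zero_le_total_var:
  assumes "sorted xs"
  shows "ereal (excess 0 f xs) \<le> total_var f"
  unfolding total_var_def excess_zero using assms by (intro SUP_upper) auto

lemma total_var_le:
  assumes "\<And>xs. sorted xs \<Longrightarrow> excess 0 f xs \<le> K"
  shows "total_var f \<le> ereal K"
  unfolding total_var_def using assms by (intro SUP_least) (auto simp: excess_zero)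

text \<open>At slope 0 the excess function is the variation function, so writing \<open>f\<close> as
  \<open>(?T x + f x) - ?T x\<close> is a Jordan decomposition into increasing functions.\<close>

lemma bounded_var_imp_bounded_measurable:
  assumes E: "\<And>xs. sorted xs \<Longrightarrow> excess 0 f xs \<le> K"
  shows "f \<in> borel_measurable borel" "\<bar>f x\<bar> \<le> \<bar>f 0\<bar> + K"
proof -
  let ?T = "excess_upto 0 f"
  have inc: "\<bar>f y - f x\<bar> \<le> ?T y - ?T x" if "x \<le> y" for x y
    using excess_upto_increment[OF E that] by simp
  have "mono ?T" using excess_upto_mono[OF E] by (auto simp: mono_def)
  moreover have "mono (\<lambda>x. ?T x + f x)"
    unfolding mono_def
  proof (intro allI impI)
    show "?T x + f x \<le> ?T y + f y" if "x \<le> y" for x y using inc[OF that] by simp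
  qed
  ultimately have "(\<lambda>x. (?T x + f x) - ?T x) \<in> borel_measurable borel"
    by (intro borel_measurable_diff borel_measurable_mono)
  then show "f \<in> borel_measurable borel" by simp
  show "\<bar>f x\<bar> \<le> \<bar>f 0\<bar> + K"
    using E[of "[0, x]"] E[of "[x, 0]"] by (cases "0 \<le> x") auto
qed

lemma nt_max_bounded_var:
  assumes "0 \<le> \<alpha>" "bounded_var f"
  shows "bounded_var (nt_max \<alpha> f) \<and> total_var (nt_max \<alpha> f) \<le> total_var f"
proof -
  have "total_var f \<noteq> \<infinity>" "total_var f \<noteq> - \<infinity>"
    using assms(2) excess_zero_le_total_var[of "[]" f] by (auto simp: bounded_var_def)
  then obtain K where K: "total_var f = ereal K" by (cases "total_var f") auto
  have E: "excess 0 f xs \<le> K" if "sorted xs" for xs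
    using excess_zero_le_total_var[OF that, of f] K by simp
  note f = bounded_var_imp_bounded_measurable[OF E]
  have "excess 0 (nt_max \<alpha> f) xs \<le> K" if xs: "sorted xs" for xs
  proof (cases xs)
    case Nil
    then show ?thesis using E[of "[]"] by simp
  next
    case (Cons x ys)
    define l where "l = last (x # ys) - x"
    have l: "0 \<le> l" using xs unfolding l_def Cons by (cases ys) auto
    show ?thesis
    proof (rule field_le_epsilon)
      fix e :: real assume e: "0 < e"
      \<comment> \<open>Passing from slope \<open>\<kappa>\<close> to slope 0 costs at most
        \<open>\<kappa> * l\<close> on this partition; \<open>l + 1\<close> avoids dividing by
        zero.\<close>
      define \<kappa> where "\<kappa> = e / (l + 1)"
      have k: "0 < \<kappa>" using e l by (simp add: \<kappa>_def)
      have "excess 0 (nt_max \<alpha> f) xs \<le> excess \<kappa> (nt_max \<alpha> f) xs + (\<kappa> - 0) * (last (x # ys) - x)"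
        unfolding Cons using k xs Cons by (intro excess_change_slope) auto
      also have "excess \<kappa> (nt_max \<alpha> f) xs \<le> K"
      proof (rule excess_nt_max_le[OF f assms(1) k _ xs])
        show "excess \<kappa> f ys \<le> K" if "sorted ys" for ys
          using excess_antimono[of 0 \<kappa> ys f] k that E[OF that] by simp
      qed
      also have "(\<kappa> - 0) * (last (x # ys) - x) \<le> e"
        using e l unfolding l_def[symmetric] by (simp add: \<kappa>_def field_simps)
      finally show "excess 0 (nt_max \<alpha> f) xs \<le> K + e" by simp
    qed
  qed
  then have "total_var (nt_max \<alpha> f) \<le> total_var f" unfolding K by (rule total_var_le)
  then show ?thesis using K by (auto simp: bounded_var_def)
qed

text \<open>The slope term is the integral of the constant \<open>\<kappa>\<close>, so an interval
  carries at most the integral of the positive part of \<open>\<bar>g\<bar> - \<kappa>\<close> over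
  it. Integrating over the half-line right of \<open>x\<close> lets the induction split off one
  interval.\<close>

lemma excess_primitive_le:
  assumes G: "primitive_of g G" and xs: "sorted (x # xs)"
  shows "ennreal (excess \<kappa> G (x # xs)) \<le> (\<integral>\<^sup>+z. ennreal (\<bar>g z\<bar> - \<kappa>) * indicator {x<..} z \<partial>lborel)"
  using xs
proof (induction xs arbitrary: x)
  case (Cons y xs)
  note [measurable] = primitive_ofD(1)[OF G]
  have xy: "x \<le> y" using Cons.prems by simp
  let ?m = "\<lambda>z. indicator {x<..y} z * max 0 (\<bar>g z\<bar> - \<kappa>)" and ?M = "max 0 (\<bar>G y - G x\<bar> - \<kappa> * (y - x))"
  let ?J = "\<lambda>A. \<integral>\<^sup>+z. ennreal (\<bar>g z\<bar> - \<kappa>) * indicator A z \<partial>lborel"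
  have gi: "integrable lborel (\<lambda>z. indicator {x<..y} z * \<bar>g z\<bar>)"
    using set_integrable_abs[OF primitive_ofD(2)[OF G xy]] by (simp add: set_integrable_def)
  have mi: "integrable lborel (\<lambda>z. ?m z)"
  proof (rule Bochner_Integration.integrable_bound)
    show "integrable lborel (\<lambda>z. indicator {x<..y} z * \<bar>g z\<bar> + indicator {x<..y} z * \<bar>\<kappa>\<bar>)"
      using gi by auto
    show "AE z in lborel. norm (?m z) \<le> norm (indicator {x<..y} z * \<bar>g z\<bar> + indicator {x<..y} z * \<bar>\<kappa>\<bar>)"
      by (intro AE_I2) (auto simp: indicator_def)
  qed measurable
  have "\<bar>G y - G x\<bar> - \<kappa> * (y - x) \<le> (LINT z|lborel. indicator {x<..y} z * \<bar>g z\<bar>) - \<kappa> * (y - x)"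
    using set_integral_norm_bound[OF primitive_ofD(2)[OF G xy]] primitive_ofD(3)[OF G xy]
    by (simp add: set_lebesgue_integral_def)
  also have "\<dots> = (LINT z|lborel. indicator {x<..y} z * \<bar>g z\<bar> - \<kappa> * indicator {x<..y} z)"
    using gi xy by simp
  also have "\<dots> \<le> (LINT z|lborel. ?m z)"
  proof (rule integral_mono)
    show "integrable lborel (\<lambda>z. indicator {x<..y} z * \<bar>g z\<bar> - \<kappa> * indicator {x<..y} z)"
      using gi by simp
  qed (use mi in \<open>auto simp: indicator_def\<close>)
  finally have "?M \<le> (LINT z|lborel. ?m z)"
    by (auto intro: Bochner_Integration.integral_nonneg)
  then have "ennreal ?M \<le> ennreal (LINT z|lborel. ?m z)"
    by (rule ennreal_leI)
  also have "\<dots> = (\<integral>\<^sup>+z. ennreal (?m z) \<partial>lborel)"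
    using mi by (intro nn_integral_eq_integral[symmetric]) auto
  also have "\<dots> = ?J {x<..y}"
    by (intro nn_integral_cong) (auto simp: indicator_def max_def ennreal_neg)
  finally have 1: "ennreal ?M \<le> ?J {x<..y}" .
  have 2: "ennreal (excess \<kappa> G (y # xs)) \<le> ?J {y<..}"
    using Cons by simp
  have "ennreal (excess \<kappa> G (x # y # xs)) = ennreal ?M + ennreal (excess \<kappa> G (y # xs))"
    by (simp add: excess_nonneg ennreal_plus)
  also have "\<dots> \<le> ?J {x<..y} + ?J {y<..}"
    by (intro add_mono 1 2)
  also have "\<dots> = (\<integral>\<^sup>+z. ennreal (\<bar>g z\<bar> - \<kappa>) * indicator {x<..y} z + ennreal (\<bar>g z\<bar> - \<kappa>) * indicator {y<..} z \<partial>lborel)"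
    by (rule nn_integral_add[symmetric]) measurable
  also have "\<dots> = (\<integral>\<^sup>+z. ennreal (\<bar>g z\<bar> - \<kappa>) * indicator {x<..} z \<partial>lborel)"
    using xy by (intro nn_integral_cong) (auto simp: indicator_def)
  finally show ?case .
qed simp

lemma excess_primitive_le':
  assumes G: "primitive_of g G" and xs: "sorted xs" and E: "tail_integral g \<kappa> \<le> ennreal E" "0 \<le> E"
  shows "excess \<kappa> G xs \<le> E"
proof (cases xs)
  case (Cons x ys)
  have "ennreal (excess \<kappa> G xs) \<le> (\<integral>\<^sup>+z. ennreal (\<bar>g z\<bar> - \<kappa>) * indicator {x<..} z \<partial>lborel)"
    using excess_primitive_le[OF G, of x ys] xs Cons by simp
  also have "\<dots> \<le> tail_integral g \<kappa>"
    by (intro nn_integral_mono) (auto simp: indicator_def)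
  finally show ?thesis using E by (meson ennreal_le_iff order_trans)
qed (use E in simp)

section \<open>Consequences of membership in L^p\<close>

lemma memLp_infty_AE:
  assumes "memLp \<infinity> h"
  obtains L where "0 \<le> L" "esssup lborel (\<lambda>x. ereal \<bar>h x\<bar>) = ereal L" "AE x in lborel. \<bar>h x\<bar> \<le> L"
proof -
  define S where "S = esssup lborel (\<lambda>x. ereal \<bar>h x\<bar>)"
  have fin: "S < \<infinity>" using assms by (simp add: memLp_def S_def)
  have AE: "AE x in lborel. ereal \<bar>h x\<bar> \<le> S" unfolding S_def by (rule esssup_AE)
  \<comment> \<open>A negative essential supremum would force a null whole line. This excludes minus
    infinity, so the norm loses nothing in passing to a real number.\<close>
  have "0 \<le> S"
  proof (rule ccontr)
    assume "\<not> 0 \<le> S"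
    then have "S < 0" by simp
    have "AE x in (lborel :: real measure). False"
      using AE
    proof eventually_elim
      case (elim x)
      then have "ereal \<bar>h x\<bar> < 0" using \<open>S < 0\<close> by (rule le_less_trans)
      then show False by simp
    qed
    then show False by (simp add: AE_iff_null null_sets_def)
  qed
  then obtain L where L: "S = ereal L" "0 \<le> L" using fin by (cases S) auto
  show ?thesis
    using AE L by (intro that[of L]) (auto simp: S_def)
qed

lemma memLp_finiteD:
  assumes "memLp p h" "1 \<le> p" "p \<noteq> \<infinity>"
  obtains q where "p = ereal q" "1 \<le> q" "integrable lborel (\<lambda>x. \<bar>h x\<bar> powr q)"
  using assms by (cases p) (auto simp: memLp_def)

lemma le_one_plus_powr: "0 \<le> r \<Longrightarrow> 1 \<le> q \<Longrightarrow> r \<le> 1 + r powr q" for r q :: real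
  using powr_mono[of 1 q r] by (cases "1 \<le> r") (auto intro: order_trans add_increasing2)

lemma memLp_small_excess:
  assumes h: "memLp p h" and p: "1 \<le> p" and e: "0 < e"
  shows "\<exists>\<mu>>0. tail_integral h \<mu> \<le> ennreal e"
proof (cases "p = \<infinity>")
  case True
  obtain L where L: "0 \<le> L" "AE x in lborel. \<bar>h x\<bar> \<le> L"
    using memLp_infty_AE h unfolding True by metis
  have "tail_integral h (L + 1) = (\<integral>\<^sup>+x. 0 \<partial>(lborel :: real measure))"
  proof (rule nn_integral_cong_AE)
    show "AE x in lborel. ennreal (\<bar>h x\<bar> - (L + 1)) = 0"
      using L(2) by eventually_elim (simp add: ennreal_neg)
  qed
  then show ?thesis using L(1) by (intro exI[of _ "L + 1"]) simp
next
  case False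
  obtain q where q: "p = ereal q" "1 \<le> q" "integrable lborel (\<lambda>x. \<bar>h x\<bar> powr q)"
    using memLp_finiteD[OF h p False] .
  have [measurable]: "h \<in> borel_measurable borel" using h by (simp add: memLp_def)
  \<comment> \<open>A nonzero left-hand side forces \<bar>h x\<bar> > 1, where \<bar>h x\<bar> is at
    most its q-th power.\<close>
  have dom: "max 0 (\<bar>h x\<bar> - real (Suc n)) \<le> \<bar>h x\<bar> powr q" for x n
    using powr_mono[of 1 q "\<bar>h x\<bar>"] q(2) by (cases "1 \<le> \<bar>h x\<bar>") auto
  have i: "integrable lborel (\<lambda>x. max 0 (\<bar>h x\<bar> - real (Suc n)))" for n
    by (rule Bochner_Integration.integrable_bound[OF q(3)]) (use dom in \<open>auto intro!: AE_I2\<close>)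
  have "(\<lambda>n. LINT x|lborel. max 0 (\<bar>h x\<bar> - real (Suc n))) \<longlonglongrightarrow> (LINT x|(lborel :: real measure). 0)"
  proof (rule integral_dominated_convergence[OF _ _ q(3)])
    show "AE x in lborel. (\<lambda>n. max 0 (\<bar>h x\<bar> - real (Suc n))) \<longlonglongrightarrow> 0"
    proof (rule AE_I2)
      fix x
      obtain N where "\<bar>h x\<bar> \<le> real N" using real_arch_simple by blast
      then have "\<forall>\<^sub>F n in sequentially. max 0 (\<bar>h x\<bar> - real (Suc n)) = 0"
        by (intro eventually_sequentiallyI[of N]) auto
      then show "(\<lambda>n. max 0 (\<bar>h x\<bar> - real (Suc n))) \<longlonglongrightarrow> 0" by (rule tendsto_eventually)
    qed
    show "AE x in lborel. norm (max 0 (\<bar>h x\<bar> - real (Suc n))) \<le> \<bar>h x\<bar> powr q" for n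
      using dom by (intro AE_I2) auto
  qed measurable
  then have "\<forall>\<^sub>F n in sequentially. (LINT x|lborel. max 0 (\<bar>h x\<bar> - real (Suc n))) < e"
    using e by (simp add: order_tendsto_iff del: of_nat_Suc)
  then obtain n where n: "(LINT x|lborel. max 0 (\<bar>h x\<bar> - real (Suc n))) < e"
    by (auto dest: eventually_happens simp: eventually_sequentially)
  have "tail_integral h (real (Suc n)) = (\<integral>\<^sup>+x. ennreal (max 0 (\<bar>h x\<bar> - real (Suc n))) \<partial>lborel)"
    by (intro nn_integral_cong) (auto simp: max_def ennreal_neg)
  also have "\<dots> = ennreal (LINT x|lborel. max 0 (\<bar>h x\<bar> - real (Suc n)))"
    using i by (intro nn_integral_eq_integral) auto
  finally show ?thesis using n by (intro exI[of _ "real (Suc n)"]) (auto intro: ennreal_leI)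
qed

text \<open>In either case \<bar>h\<bar> is almost everywhere at most a constant plus a fixed
  integrable function, by \<open>r \<le> 1 + r powr q\<close> for finite exponents; such a bound is
  uniform over intervals of length 1.\<close>

lemma memLp_unit_interval_bound:
  assumes h: "memLp p h" and p: "1 \<le> p"
  shows "\<exists>K. \<forall>x. set_integrable lborel {x<..x + 1} h \<longrightarrow> (LINT z:{x<..x + 1}|lborel. \<bar>h z\<bar>) \<le> K"
proof -
  obtain c w where w: "integrable lborel w" "\<And>z. 0 \<le> w z" and hw: "AE z in lborel. \<bar>h z\<bar> \<le> c + w z"
  proof (cases "p = \<infinity>")
    case True
    obtain L where "AE x in lborel. \<bar>h x\<bar> \<le> L"
      using memLp_infty_AE h unfolding True by metis
    then show ?thesis by (intro that[of "\<lambda>_. 0" L]) auto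
  next
    case False
    obtain q where "1 \<le> q" "integrable lborel (\<lambda>x. \<bar>h x\<bar> powr q)"
      using memLp_finiteD[OF h p False] by metis
    then show ?thesis
      by (intro that[of "\<lambda>x. \<bar>h x\<bar> powr q" 1]) (auto intro!: AE_I2 le_one_plus_powr)
  qed
  have "(LINT z:{x<..x + 1}|lborel. \<bar>h z\<bar>) \<le> c + (LINT z|lborel. w z)" if "set_integrable lborel {x<..x + 1} h" for x
  proof -
    have "(LINT z:{x<..x + 1}|lborel. \<bar>h z\<bar>) \<le> (LINT z|lborel. c * indicator {x<..x + 1} z + w z)"
      unfolding set_lebesgue_integral_def
    proof (rule integral_mono_AE)
      show "integrable lborel (\<lambda>z. indicator {x<..x + 1} z *\<^sub>R \<bar>h z\<bar>)"
        using set_integrable_abs[OF that] by (simp add: set_integrable_def)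
      show "AE z in lborel. indicator {x<..x + 1} z *\<^sub>R \<bar>h z\<bar> \<le> c * indicator {x<..x + 1} z + w z"
        using hw by eventually_elim (use w(2) in \<open>auto simp: indicator_def\<close>)
    qed (use w in auto)
    also have "\<dots> = c + (LINT z|lborel. w z)"
      using w(1) by (subst Bochner_Integration.integral_add) auto
    finally show ?thesis .
  qed
  then show ?thesis by blast
qed

text \<open>Average \<bar>G x\<bar> \<le> \<bar>G z\<bar> + \<bar>G z - G x\<bar> over
  \<open>z\<close> in the unit interval to the right of \<open>x\<close>. Boundedness makes the
  results on Poisson extensions applicable to Sobolev data.\<close>

lemma sobolev_primitive_bounded:
  assumes G: "primitive_of g G" and p: "1 \<le> p" and "memLp p g" "memLp p G"
  shows "\<exists>B. \<forall>x. \<bar>G x\<bar> \<le> B"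
proof -
  obtain K1 where K1: "\<And>x. set_integrable lborel {x<..x + 1} g \<Longrightarrow> (LINT z:{x<..x + 1}|lborel. \<bar>g z\<bar>) \<le> K1"
    using memLp_unit_interval_bound[OF assms(3) p] by blast
  obtain K2 where K2: "\<And>x. set_integrable lborel {x<..x + 1} G \<Longrightarrow> (LINT z:{x<..x + 1}|lborel. \<bar>G z\<bar>) \<le> K2"
    using memLp_unit_interval_bound[OF assms(4) p] by blast
  have "\<bar>G x\<bar> \<le> K1 + K2" for x
  proof -
    have gi: "set_integrable lborel {x<..x + 1} g" by (rule primitive_ofD(2)[OF G]) simp
    have Gi: "set_integrable lborel {x<..x + 1} G" by (rule primitive_of_integrable[OF G])
    have Gi': "integrable lborel (\<lambda>z. indicator {x<..x + 1} z * \<bar>G z\<bar>)"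
      using set_integrable_abs[OF Gi] by (simp add: set_integrable_def)
    have "(LINT z|lborel. \<bar>G x\<bar> * indicator {x<..x + 1} z) \<le> (LINT z|lborel. indicator {x<..x + 1} z * \<bar>G z\<bar> + K1 * indicator {x<..x + 1} z)"
    proof (rule integral_mono)
      fix z
      show "\<bar>G x\<bar> * indicator {x<..x + 1} z \<le> indicator {x<..x + 1} z * \<bar>G z\<bar> + K1 * indicator {x<..x + 1} z"
        using primitive_of_bounded[OF G, of x z "x + 1"] K1[OF gi] by (auto simp: indicator_def)
    qed (use Gi' in auto)
    also have "\<dots> = (LINT z:{x<..x + 1}|lborel. \<bar>G z\<bar>) + K1"
      using Gi' by (simp add: set_lebesgue_integral_def)
    finally show ?thesis using K2[OF Gi] by simp
  qed
  then show ?thesis by blast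
qed

text \<open>Poisson extensions do not see null sets, so the datum may be replaced by a primitive of
  its weak derivative, to which the excess estimates apply.\<close>

lemma nt_max_sobolev:
  assumes alpha: "0 \<le> \<alpha>" and p: "1 \<le> p" and u: "memLp p u" and w: "has_weak_deriv u g0" and g0: "memLp p g0"
  obtains G B g where "primitive_of g0 G" "AE x in lborel. u x = G x" "memLp p G" "\<And>x. \<bar>G x\<bar> \<le> B"
    "nt_max \<alpha> u = nt_max \<alpha> G" "primitive_of g (nt_max \<alpha> u)"
    "\<And>t. 0 < t \<Longrightarrow> tail_integral g t \<le> tail_integral g0 t"
proof -
  have [measurable]: "u \<in> borel_measurable borel" "g0 \<in> borel_measurable borel"
    using u g0 by (auto simp: memLp_def)
  obtain G where G: "primitive_of g0 G" "AE x in lborel. u x = G x"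
    using has_weak_deriv_primitive[OF w] by auto
  have Gm [measurable]: "G \<in> borel_measurable borel" by (rule primitive_of_measurable[OF G(1)])
  have GLp: "memLp p G"
  proof (cases "p = \<infinity>")
    case True
    have "esssup lborel (\<lambda>x. ereal \<bar>u x\<bar>) = esssup lborel (\<lambda>x. ereal \<bar>G x\<bar>)"
      using G(2) by (intro esssup_AE_cong) auto
    then show ?thesis using u by (simp add: memLp_def True)
  next
    case False
    have "integrable lborel (\<lambda>x. \<bar>u x\<bar> powr real_of_ereal p) \<longleftrightarrow> integrable lborel (\<lambda>x. \<bar>G x\<bar> powr real_of_ereal p)"
      by (rule integrable_cong_AE) (use G(2) in auto)
    then show ?thesis using u False by (simp add: memLp_def)
  qed
  obtain B where B: "\<And>x. \<bar>G x\<bar> \<le> B"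
    using sobolev_primitive_bounded[OF G(1) p g0 GLp] by blast
  have "poisson_ext u y t = poisson_ext G y t" for y t
    unfolding poisson_ext_def
  proof (rule integral_cong_AE)
    show "AE z in lborel. poisson (y - z) t * \<bar>u z\<bar> = poisson (y - z) t * \<bar>G z\<bar>"
      using G(2) by eventually_elim simp
  qed measurable
  then have nt: "nt_max \<alpha> u = nt_max \<alpha> G" by (simp add: nt_max_def fun_eq_iff)
  have E: "excess \<kappa> (nt_max \<alpha> u) xs \<le> E"
    if "0 < \<kappa>" "tail_integral g0 \<kappa> \<le> ennreal E" "0 \<le> E" "sorted xs" for \<kappa> E xs
    unfolding nt using that excess_primitive_le'[OF G(1) _ that(2,3)]
    by (intro excess_nt_max_le[OF Gm B alpha]) auto
  have small: "\<exists>\<mu>\<ge>0. \<forall>ys. sorted ys \<longrightarrow> excess \<mu> (nt_max \<alpha> u) ys \<le> e" if e: "0 < e" for e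
  proof -
    obtain \<mu> where "0 < \<mu>" "tail_integral g0 \<mu> \<le> ennreal e"
      using memLp_small_excess[OF g0 p e] by blast
    then show ?thesis using E[of \<mu> e] e by (intro exI[of _ \<mu>]) auto
  qed
  obtain g where g: "primitive_of g (nt_max \<alpha> u)"
    using small_excess_density[OF small] .
  show ?thesis
  proof (rule that[OF G GLp B nt])
    show "primitive_of g (nt_max \<alpha> u)" by (rule g)
    fix t :: real assume t: "0 < t"
    \<comment> \<open>An infinite right-hand side is possible, for instance at low levels when p is
      infinite, and then the claim is trivial. Otherwise its own value serves as the bound on the
      excess.\<close>
    show "tail_integral g t \<le> tail_integral g0 t"
    proof (cases "tail_integral g0 t")
      case (real E')
      have "tail_integral g t \<le> ennreal E'"
      proof (rule excess_density_bound[OF small g])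
        show "excess t (nt_max \<alpha> u) ys \<le> E'" if "sorted ys" for ys
          using real by (intro E[OF t _ _ that]) auto
      qed
      then show ?thesis using real by simp
    qed simp
  qed
qed

text \<open>For infinite p the tails of \<open>g0\<close> vanish above its essential supremum, hence
  so do those of \<open>g\<close>; for finite p this is the majorization inequality.\<close>

lemma Lp_deriv_bound:
  assumes p: "1 \<le> p" and [measurable]: "g \<in> borel_measurable borel" and g0: "memLp p g0"
    and le: "\<And>t. 0 < t \<Longrightarrow> tail_integral g t \<le> tail_integral g0 t"
  shows "memLp p g \<and> Lp_norm p g \<le> Lp_norm p g0"
proof (cases "p = \<infinity>")
  case True
  let ?S = "\<lambda>g :: real \<Rightarrow> real. esssup lborel (\<lambda>x. ereal \<bar>g x\<bar>)"
  have g0m [measurable]: "g0 \<in> borel_measurable borel" using g0 by (simp add: memLp_def)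
  obtain L where L: "0 \<le> L" "esssup lborel (\<lambda>x. ereal \<bar>g0 x\<bar>) = ereal L" "AE x in lborel. \<bar>g0 x\<bar> \<le> L"
    using memLp_infty_AE g0 unfolding True by metis
  have "?S g \<le> ereal L"
  proof (rule ereal_le_epsilon2)
    fix e :: real assume e: "0 < e"
    have "tail_integral g0 (L + e) = (\<integral>\<^sup>+x. 0 \<partial>(lborel :: real measure))"
    proof (rule nn_integral_cong_AE)
      show "AE x in lborel. ennreal (\<bar>g0 x\<bar> - (L + e)) = 0"
        using L(3) by eventually_elim (use e in \<open>simp add: ennreal_neg\<close>)
    qed
    then have "tail_integral g (L + e) = 0"
      using le[of "L + e"] e L(1) by simp
    then have "AE x in lborel. ennreal (\<bar>g x\<bar> - (L + e)) = 0"
      by (subst (asm) nn_integral_0_iff_AE) auto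
    then have "AE x in lborel. ereal \<bar>g x\<bar> \<le> ereal L + ereal e"
      by eventually_elim (simp add: ennreal_eq_0_iff)
    then show "?S g \<le> ereal L + ereal e" by (intro esssup_I) auto
  qed
  then have m: "memLp p g" by (auto simp: memLp_def True)
  obtain L' where "?S g = ereal L'"
    using memLp_infty_AE m unfolding True by metis
  with m \<open>?S g \<le> ereal L\<close> show ?thesis
    by (simp add: Lp_norm_def True L(2))
next
  case False
  obtain q where q: "p = ereal q" "1 \<le> q" "integrable lborel (\<lambda>x. \<bar>g0 x\<bar> powr q)"
    using memLp_finiteD[OF g0 p False] .
  have g0m [measurable]: "g0 \<in> borel_measurable borel" using g0 by (simp add: memLp_def)
  have le': "(\<integral>\<^sup>+x. ennreal (\<bar>g x\<bar> powr q) \<partial>lborel) \<le> (\<integral>\<^sup>+x. ennreal (\<bar>g0 x\<bar> powr q) \<partial>lborel)"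
    by (rule nn_integral_powr_majorization[OF q(2)]) (use le in auto)
  also have "\<dots> = ennreal (LINT x|lborel. \<bar>g0 x\<bar> powr q)"
    using q(3) by (intro nn_integral_eq_integral) auto
  finally have le'': "(\<integral>\<^sup>+x. ennreal (\<bar>g x\<bar> powr q) \<partial>lborel) \<le> ennreal (LINT x|lborel. \<bar>g0 x\<bar> powr q)" .
  then have gi: "integrable lborel (\<lambda>x. \<bar>g x\<bar> powr q)"
    by (intro integrableI_bounded) (auto simp: order_le_less_trans)
  have "(LINT x|lborel. \<bar>g x\<bar> powr q) \<le> (LINT x|lborel. \<bar>g0 x\<bar> powr q)"
    using le'' nn_integral_eq_integral[OF gi] by (simp add: Bochner_Integration.integral_nonneg)
  then have "(LINT x|lborel. \<bar>g x\<bar> powr q) powr (1 / q) \<le> (LINT x|lborel. \<bar>g0 x\<bar> powr q) powr (1 / q)"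
    using q(2) by (intro powr_mono2) auto
  then show ?thesis using gi by (simp add: memLp_def Lp_norm_def q(1))
qed

lemma nt_max_powr_integrable:
  assumes alpha: "0 \<le> \<alpha>" and q: "1 < q" and Gm [measurable]: "G \<in> borel_measurable borel" and B: "\<And>x. \<bar>G x\<bar> \<le> B"
    and Um [measurable]: "nt_max \<alpha> G \<in> borel_measurable borel"
    and Gq: "integrable lborel (\<lambda>x. \<bar>G x\<bar> powr q)"
  shows "integrable lborel (\<lambda>x. \<bar>nt_max \<alpha> G x\<bar> powr q)"
proof -
  \<comment> \<open>The Harnack constant moves a point of the cone above its vertex, and
    \<open>16 / pi\<close> compares the extension there with averages over balls. After division by
    \<open>C\<close> the maximal function is dominated by the centred Hardy-Littlewood maximal
    function.\<close>
  define C where "C = (2 * \<alpha>\<^sup>2 + 2) * (16 / pi)"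
  have C: "0 < C" by (simp add: C_def add_nonneg_pos)
  have U0: "0 \<le> nt_max \<alpha> G x" for x using nt_max_bounds[OF Gm B alpha] by simp
  have "(\<integral>\<^sup>+x. ennreal ((nt_max \<alpha> G x / C) powr q) \<partial>lborel) \<noteq> \<infinity>"
  proof (rule nn_integral_maximal_powr_finite[OF q, where f = "\<lambda>x. \<bar>G x\<bar>"])
    show "(\<integral>\<^sup>+x. ennreal (\<bar>G x\<bar> powr q) \<partial>lborel) \<noteq> \<infinity>"
      using nn_integral_eq_integral[OF Gq] by simp
    fix x m :: real assume m: "0 < m" "m < nt_max \<alpha> G x / C"
    show "\<exists>r>0. ennreal (2 * r * m) < (\<integral>\<^sup>+z. ennreal \<bar>G z\<bar> * indicator (ball x r) z \<partial>lborel)"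
    proof (rule ccontr)
      assume no: "\<not> ?thesis"
      have avg: "(\<integral>\<^sup>+z. ennreal \<bar>G z\<bar> * indicator (ball x r) z \<partial>lborel) \<le> ennreal (2 * r * m)" if "0 < r" for r
        using that no by (meson not_less)
      have "nt_max \<alpha> G x \<le> C * m"
      proof (rule nt_max_least[OF Gm B alpha])
        fix y t assume t: "0 < t" and y: "\<bar>y - x\<bar> \<le> \<alpha> * t"
        have i: "integrable lborel (\<lambda>z. poisson (w - z) t * \<bar>G z\<bar>)" for w
          using B by (intro integrable_poisson_mult[OF t, where B = B]) auto
        have "ennreal (poisson_ext G x t) = (\<integral>\<^sup>+z. ennreal (poisson (x - z) t * \<bar>G z\<bar>) \<partial>lborel)"
          unfolding poisson_ext_def using i poisson_nonneg[OF t] by (intro nn_integral_eq_integral[symmetric]) auto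
        also have "\<dots> = (\<integral>\<^sup>+z. ennreal (poisson (x - z) t) * ennreal \<bar>G z\<bar> \<partial>lborel)"
          using poisson_nonneg[OF t] by (simp add: ennreal_mult)
        also have "\<dots> \<le> ennreal (16 / pi * m)"
          using m(1) by (intro nn_integral_poisson_le_maximal t avg) auto
        finally have xt: "poisson_ext G x t \<le> 16 / pi * m" using m(1) by simp
        have "poisson_ext G y t \<le> (LINT z|lborel. (2 * \<alpha>\<^sup>2 + 2) * (poisson (x - z) t * \<bar>G z\<bar>))"
          unfolding poisson_ext_def
        proof (rule integral_mono)
          show "poisson (y - z) t * \<bar>G z\<bar> \<le> (2 * \<alpha>\<^sup>2 + 2) * (poisson (x - z) t * \<bar>G z\<bar>)" for z
            using mult_right_mono[OF poisson_harnack[OF t y, of z], of "\<bar>G z\<bar>"] by (simp add: mult.assoc)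
        qed (use i in auto)
        also have "\<dots> = (2 * \<alpha>\<^sup>2 + 2) * poisson_ext G x t" by (simp add: poisson_ext_def)
        also have "\<dots> \<le> C * m"
        proof -
          have "(2 * \<alpha>\<^sup>2 + 2) * poisson_ext G x t \<le> (2 * \<alpha>\<^sup>2 + 2) * (16 / pi * m)"
            by (rule mult_left_mono[OF xt]) simp
          then show ?thesis by (simp only: C_def mult.assoc)
        qed
        finally show "poisson_ext G y t \<le> C * m" .
      qed
      then show False using m C by (simp add: field_simps)
    qed
  qed (use U0 C in auto)
  then have "integrable lborel (\<lambda>x. (nt_max \<alpha> G x / C) powr q)"
    by (intro integrableI_bounded) (auto simp: less_top)
  then have "integrable lborel (\<lambda>x. C powr q * (nt_max \<alpha> G x / C) powr q)" by simp
  moreover have "C powr q * (nt_max \<alpha> G x / C) powr q = \<bar>nt_max \<alpha> G x\<bar> powr q" for x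
    using U0[of x] C by (simp add: powr_mult[symmetric])
  ultimately show ?thesis by simp
qed

theorem theorem4:
  fixes \<alpha> :: real and u0 :: "real \<Rightarrow> real"
  assumes "\<alpha> \<ge> 0"
  shows
   "(\<forall>p g0. 1 < p \<and> memLp p u0 \<and> has_weak_deriv u0 g0 \<and> memLp p g0 \<longrightarrow>
       memLp p (nt_max \<alpha> u0) \<and>
       (\<exists>g. has_weak_deriv (nt_max \<alpha> u0) g \<and> memLp p g \<and> Lp_norm p g \<le> Lp_norm p g0))
    \<and> (\<forall>g0. memLp 1 u0 \<and> has_weak_deriv u0 g0 \<and> memLp 1 g0 \<longrightarrow>
       memLp \<infinity> (nt_max \<alpha> u0) \<and>
       (\<exists>g. has_weak_deriv (nt_max \<alpha> u0) g \<and> memLp 1 g \<and> Lp_norm 1 g \<le> Lp_norm 1 g0))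
    \<and> (bounded_var u0 \<longrightarrow>
       bounded_var (nt_max \<alpha> u0) \<and> total_var (nt_max \<alpha> u0) \<le> total_var u0)"
proof -
  \<comment> \<open>Parts (i) and (ii) are instances of one statement for p at least 1; only
    membership of the maximal function in L^p is restricted to p > 1.\<close>
  have deriv: "memLp \<infinity> (nt_max \<alpha> u0) \<and> (1 < p \<longrightarrow> memLp p (nt_max \<alpha> u0)) \<and>
      (\<exists>g. has_weak_deriv (nt_max \<alpha> u0) g \<and> memLp p g \<and> Lp_norm p g \<le> Lp_norm p g0)"
    if p: "1 \<le> p" and u: "memLp p u0" "has_weak_deriv u0 g0" "memLp p g0" for p g0
  proof -
    obtain G B g where G: "primitive_of g0 G" "AE x in lborel. u0 x = G x" "memLp p G" "\<And>x. \<bar>G x\<bar> \<le> B" "nt_max \<alpha> u0 = nt_max \<alpha> G"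
      and g: "primitive_of g (nt_max \<alpha> u0)"
        "\<And>t. 0 < t \<Longrightarrow> tail_integral g t \<le> tail_integral g0 t"
      by (rule nt_max_sobolev[OF assms p u], rule that, assumption+)
    note Gm = primitive_of_measurable[OF G(1)] and Um = primitive_of_measurable[OF g(1)]
    have "esssup lborel (\<lambda>x. ereal \<bar>nt_max \<alpha> u0 x\<bar>) \<le> ereal B"
      using nt_max_bounds[OF Gm G(4) assms] Um by (intro esssup_I AE_I2) (auto simp: G(5))
    then have inf: "memLp \<infinity> (nt_max \<alpha> u0)" using Um by (auto simp: memLp_def)
    have "memLp p (nt_max \<alpha> u0)" if "1 < p"
    proof (cases "p = \<infinity>")
      case False
      obtain q where q: "p = ereal q" "integrable lborel (\<lambda>x. \<bar>G x\<bar> powr q)"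
        using memLp_finiteD[OF G(3) p False] by metis
      have "1 < q" using that q(1) by simp
      then have "integrable lborel (\<lambda>x. \<bar>nt_max \<alpha> G x\<bar> powr q)"
        using Um[unfolded G(5)] q(2) by (intro nt_max_powr_integrable[OF assms _ Gm G(4)])
      then show ?thesis using Um by (simp add: memLp_def q(1) G(5))
    qed (use inf in simp)
    moreover have "memLp p g \<and> Lp_norm p g \<le> Lp_norm p g0"
      by (rule Lp_deriv_bound[OF p primitive_ofD(1)[OF g(1)] u(3) g(2)])
    ultimately show ?thesis using inf primitive_of_has_weak_deriv[OF g(1)] by blast
  qed
  show ?thesis
  proof (intro conjI allI impI)
    fix p g0 assume "1 < p \<and> memLp p u0 \<and> has_weak_deriv u0 g0 \<and> memLp p g0"
    then show "memLp p (nt_max \<alpha> u0)" "\<exists>g. has_weak_deriv (nt_max \<alpha> u0) g \<and> memLp p g \<and> Lp_norm p g \<le> Lp_norm p g0"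
      using deriv[of p g0] by auto
  next
    fix g0 assume "memLp 1 u0 \<and> has_weak_deriv u0 g0 \<and> memLp 1 g0"
    then show "memLp \<infinity> (nt_max \<alpha> u0)" "\<exists>g. has_weak_deriv (nt_max \<alpha> u0) g \<and> memLp 1 g \<and> Lp_norm 1 g \<le> Lp_norm 1 g0"
      using deriv[of 1 g0] by auto
  next
    assume "bounded_var u0"
    then show "bounded_var (nt_max \<alpha> u0)" "total_var (nt_max \<alpha> u0) \<le> total_var u0"
      using nt_max_bounded_var[OF assms] by auto
  qed
qed

end
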